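(* Let $A$ be a ring, let $S=A[X_0,\dots,X_r]$, let $M=\bigoplus_{i=1}^pS$, and let $N$ be a graded $S$-submodule of $M$, generated in degrees at most $d$. Write $Q=M/N$ and let $n\le d$. If the graded component $Q_t$ is a locally free $A$-module of rank $n$ for $t=d$ and $t=d+1$, then $Q_t$ is a locally free $A$-module of rank $n$ for all $t\ge d$.
   Context: Rings are commutative with unit. $S=A[X_0,\dots,X_r]$ has the standard grading ($\deg X_i=1$, $A$ in degree $0$), $M=\bigoplus_{i=1}^p S$ is the free graded module with generators in degree $0$, and $Q_t$ denotes the degree-$t$ component of $Q$, viewed as an $A$-module. "Generated in degrees at most $d$" means that $N$ is generated as an $S$-module by homogeneous elements of degree at most $d$. *)

theory Defs
  imports "HOL-Algebra.Indexed_Polynomials" "HOL-Algebra.QuotRing"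
begin

text \<open>
  All rings and modules are carrier-based (\<^locale>\<open>cring\<close>, \<^locale>\<open>module\<close>); the zero ring is allowed.
  A module record also has the fields \<^const>\<open>monoid.mult\<close> and \<^const>\<open>one\<close> inherited from rings;
  they play no role for modules.
\<close>

section \<open>Modules\<close>

definition free_module :: "('a, 'b) ring_scheme \<Rightarrow> nat \<Rightarrow> ('a, nat \<Rightarrow> 'a) module"
  where "free_module R p =
    \<lparr>carrier = {1..p} \<rightarrow>\<^sub>E carrier R,
     monoid.mult = undefined, one = undefined,
     ring.zero = (\<lambda>i\<in>{1..p}. \<zero>\<^bsub>R\<^esub>),
     add = (\<lambda>x y. \<lambda>i\<in>{1..p}. x i \<oplus>\<^bsub>R\<^esub> y i),
     smult = (\<lambda>a x. \<lambda>i\<in>{1..p}. a \<otimes>\<^bsub>R\<^esub> x i)\<rparr>"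

definition quotient_module ::
    "('a, 'b, 'c) module_scheme \<Rightarrow> 'b set \<Rightarrow> ('a, 'b set) module"
  where "quotient_module M N =
    \<lparr>carrier = a_rcosets\<^bsub>M\<^esub> N,
     monoid.mult = undefined, one = undefined,
     ring.zero = N,
     add = set_add M,
     smult = (\<lambda>a C. \<Union>x\<in>C. N +>\<^bsub>M\<^esub> (a \<odot>\<^bsub>M\<^esub> x))\<rparr>"

definition restrict_scalars ::
    "('a \<Rightarrow> 'b) \<Rightarrow> ('b, 'c, 'd) module_scheme \<Rightarrow> ('a, 'c) module"
  where "restrict_scalars \<phi> M =
    \<lparr>carrier = carrier M, monoid.mult = undefined, one = undefined,
     ring.zero = \<zero>\<^bsub>M\<^esub>, add = add M, smult = (\<lambda>a. smult M (\<phi> a))\<rparr>"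

definition submodule_generated ::
    "('a, 'b) ring_scheme \<Rightarrow> ('a, 'c, 'd) module_scheme \<Rightarrow> 'c set \<Rightarrow> 'c set"
  where "submodule_generated R M G = \<Inter>{H. submodule H R M \<and> G \<subseteq> H}"

definition module_iso ::
    "('a, 'b) ring_scheme \<Rightarrow> ('a, 'c, 'd) module_scheme \<Rightarrow> ('a, 'e, 'f) module_scheme \<Rightarrow> ('c \<Rightarrow> 'e) set"
  where "module_iso R M M' =
    {h. bij_betw h (carrier M) (carrier M') \<and>
        (\<forall>x\<in>carrier M. \<forall>y\<in>carrier M. h (x \<oplus>\<^bsub>M\<^esub> y) = h x \<oplus>\<^bsub>M'\<^esub> h y) \<and>
        (\<forall>a\<in>carrier R. \<forall>x\<in>carrier M. h (a \<odot>\<^bsub>M\<^esub> x) = a \<odot>\<^bsub>M'\<^esub> h x)}"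

definition free_of_rank :: "('a, 'b) ring_scheme \<Rightarrow> ('a, 'c, 'd) module_scheme \<Rightarrow> nat \<Rightarrow> bool"
  where "free_of_rank R M n \<longleftrightarrow> module_iso R (free_module R n) M \<noteq> {}"


section \<open>Localization\<close>

text \<open>
  For a multiplicative set \<open>T\<close> of \<open>R\<close>, the fraction \<open>x / s\<close> is the class of \<open>(x, s)\<close> under
  \<open>(x, s) \<sim> (y, t)\<close> iff \<open>u (t x) = u (s y)\<close> for some \<open>u \<in> T\<close>.
\<close>

definition frac_rel ::
    "'a set \<Rightarrow> ('a, 'c, 'd) module_scheme \<Rightarrow> (('c \<times> 'a) \<times> ('c \<times> 'a)) set"
  where "frac_rel T M =
    {((x, s), (y, t)). x \<in> carrier M \<and> y \<in> carrier M \<and> s \<in> T \<and> t \<in> T \<and>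
       (\<exists>u\<in>T. u \<odot>\<^bsub>M\<^esub> (t \<odot>\<^bsub>M\<^esub> x) = u \<odot>\<^bsub>M\<^esub> (s \<odot>\<^bsub>M\<^esub> y))}"

definition fraction :: "'a set \<Rightarrow> ('a, 'c, 'd) module_scheme \<Rightarrow> 'c \<Rightarrow> 'a \<Rightarrow> ('c \<times> 'a) set"
  where "fraction T M x s = frac_rel T M `` {(x, s)}"

definition loc_module ::
    "('a, 'b) ring_scheme \<Rightarrow> 'a set \<Rightarrow> ('a, 'c, 'd) module_scheme \<Rightarrow> (('a \<times> 'a) set, ('c \<times> 'a) set) module"
  where "loc_module R T M =
    \<lparr>carrier = (carrier M \<times> T) // frac_rel T M,
     monoid.mult = undefined, one = undefined,
     ring.zero = fraction T M \<zero>\<^bsub>M\<^esub> \<one>\<^bsub>R\<^esub>,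
     add = (\<lambda>C D. \<Union>(x, s)\<in>C. \<Union>(y, t)\<in>D.
              fraction T M ((t \<odot>\<^bsub>M\<^esub> x) \<oplus>\<^bsub>M\<^esub> (s \<odot>\<^bsub>M\<^esub> y)) (s \<otimes>\<^bsub>R\<^esub> t)),
     smult = (\<lambda>C D. \<Union>(a, s)\<in>C. \<Union>(y, t)\<in>D. fraction T M (a \<odot>\<^bsub>M\<^esub> y) (s \<otimes>\<^bsub>R\<^esub> t))\<rparr>"

definition self_module :: "('a, 'b) ring_scheme \<Rightarrow> ('a, 'a) module"
  where "self_module R =
    \<lparr>carrier = carrier R, monoid.mult = monoid.mult R, one = one R,
     ring.zero = ring.zero R, add = add R, smult = monoid.mult R\<rparr>"

text \<open>The scalar multiplication of \<open>T\<inverse>R\<close> on itself is its ring multiplication.\<close>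

definition loc_ring :: "('a, 'b) ring_scheme \<Rightarrow> 'a set \<Rightarrow> (('a \<times> 'a) set) ring"
  where "loc_ring R T =
    (let L = loc_module R T (self_module R) in
     \<lparr>carrier = carrier L, monoid.mult = smult L, one = fraction T (self_module R) \<one>\<^bsub>R\<^esub> \<one>\<^bsub>R\<^esub>,
      ring.zero = ring.zero L, add = add L\<rparr>)"

definition powers :: "('a, 'b) ring_scheme \<Rightarrow> 'a \<Rightarrow> 'a set"
  where "powers R f = range (\<lambda>k::nat. f [^]\<^bsub>R\<^esub> k)"

text \<open>
  Local freeness in the Zariski sense: every point \<open>P\<close> of \<open>Spec R\<close> has a basic open neighbourhood
  \<open>D(f)\<close> such that \<open>M\<^sub>f\<close> is isomorphic to \<open>(R\<^sub>f)\<^sup>n\<close>.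
\<close>

definition locally_free_of_rank ::
    "('a, 'b) ring_scheme \<Rightarrow> ('a, 'c, 'd) module_scheme \<Rightarrow> nat \<Rightarrow> bool"
  where "locally_free_of_rank R M n \<longleftrightarrow>
    (\<forall>P. primeideal P R \<longrightarrow>
      (\<exists>f\<in>carrier R - P. free_of_rank (loc_ring R (powers R f)) (loc_module R (powers R f) M) n))"


section \<open>Polynomials and gradings\<close>

text \<open>
  \<open>A[X\<^sub>0, \<dots>, X\<^sub>r]\<close>, on the library's indexed polynomials: a polynomial maps a monomial, i.e. a
  multiset of variable indices, to its coefficient. The degree of a monomial is its \<^const>\<open>size\<close>.
\<close>

definition mpoly_ring :: "('a, 'b) ring_scheme \<Rightarrow> nat \<Rightarrow> (nat multiset \<Rightarrow> 'a) ring"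
  where "mpoly_ring A r =
    \<lparr>carrier = ring.indexed_pset A {..r} (carrier A),
     monoid.mult = (\<lambda>P Q m. \<Oplus>\<^bsub>A\<^esub>u \<in> {u. u \<subseteq># m}. P u \<otimes>\<^bsub>A\<^esub> Q (m - u)),
     one = ring.indexed_const A \<one>\<^bsub>A\<^esub>,
     ring.zero = ring.indexed_const A \<zero>\<^bsub>A\<^esub>,
     add = ring.indexed_padd A\<rparr>"

definition mpoly_part :: "('a, 'b) ring_scheme \<Rightarrow> nat \<Rightarrow> nat \<Rightarrow> (nat multiset \<Rightarrow> 'a) set"
  where "mpoly_part A r t =
    {P \<in> carrier (mpoly_ring A r). \<forall>m. P m \<noteq> \<zero>\<^bsub>A\<^esub> \<longrightarrow> size m = t}"

definition free_part ::
    "('a, 'b) ring_scheme \<Rightarrow> nat \<Rightarrow> nat \<Rightarrow> nat \<Rightarrow> (nat \<Rightarrow> nat multiset \<Rightarrow> 'a) set"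
  where "free_part A r p t = {1..p} \<rightarrow>\<^sub>E mpoly_part A r t"

text \<open>
  The degree-\<open>t\<close> component of \<open>M/N\<close>, where \<open>M = A[X\<^sub>0, \<dots>, X\<^sub>r]\<^sup>p\<close>: the image of that of \<open>M\<close>,
  with \<open>A\<close> acting through the constant polynomials.
\<close>

definition quotient_part ::
    "('a, 'b) ring_scheme \<Rightarrow> nat \<Rightarrow> nat \<Rightarrow> (nat \<Rightarrow> nat multiset \<Rightarrow> 'a) set \<Rightarrow> nat \<Rightarrow>
     ('a, (nat \<Rightarrow> nat multiset \<Rightarrow> 'a) set) module"
  where "quotient_part A r p N t =
    (let M = free_module (mpoly_ring A r) p in
     restrict_scalars (ring.indexed_const A)
       (quotient_module M N \<lparr>carrier := (\<lambda>x. N +>\<^bsub>M\<^esub> x) ` free_part A r p t\<rparr>))"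

text \<open>
  Here \<open>G t\<close> is the degree-\<open>t\<close> component of \<open>M\<close>. A submodule \<open>N\<close> is graded if it is the sum of the
  \<open>N \<inter> G t\<close>; the sum is direct as soon as the \<open>G t\<close> are independent.
\<close>

definition graded_submodule ::
    "('a, 'b) ring_scheme \<Rightarrow> ('a, 'c, 'd) module_scheme \<Rightarrow> (nat \<Rightarrow> 'c set) \<Rightarrow> 'c set \<Rightarrow> bool"
  where "graded_submodule R M G N \<longleftrightarrow>
    submodule N R M \<and>
    (\<forall>x\<in>N. \<exists>k h. (\<forall>t\<le>k. h t \<in> N \<inter> G t) \<and> x = (\<Oplus>\<^bsub>M\<^esub>t\<in>{..k}. h t))"

definition generated_in_degrees_le ::
    "('a, 'b) ring_scheme \<Rightarrow> ('a, 'c, 'd) module_scheme \<Rightarrow> (nat \<Rightarrow> 'c set) \<Rightarrow> 'c set \<Rightarrow> nat \<Rightarrow> bool"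
  where "generated_in_degrees_le R M G N d \<longleftrightarrow>
    (\<exists>B \<subseteq> (\<Union>t\<le>d. G t). N = submodule_generated R M B)"

end

theory Submission
  imports Defs "HOL-Library.Function_Algebras" "Jordan_Normal_Form.Determinant"
begin

text \<open>
  Fix a prime \<open>P\<close>. Since \<open>n \<le> d\<close>, Green's hyperplane restriction theorem provides, after a base change
  which makes the residue field infinite, a linear form \<open>l\<close> with \<open>l Q\<^sub>d\<^sub>-\<^sub>1 = Q\<^sub>d\<close> at \<open>P\<close>. Then
  \<open>l Q\<^sub>d = Q\<^sub>d\<^sub>+\<^sub>1\<close>, so \<open>l\<close> is an isomorphism between these free modules of rank \<open>n\<close>, and the maps \<open>l\<^sup>-\<^sup>1 X\<^sub>i\<close>
  are endomorphisms of \<open>Q\<^sub>d\<close>, which commute because \<open>Q\<^sub>d = l Q\<^sub>d\<^sub>-\<^sub>1\<close>. As the relations of \<open>Q\<close> in degrees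
  above \<open>d\<close> are linear, these endomorphisms extend \<open>Q\<^sub>d \<cong> Q\<^sub>d\<^sub>+\<^sub>1\<close> to \<open>Q\<^sub>d\<^sub>+\<^sub>2 \<cong> Q\<^sub>d\<close>, and one continues by
  induction. A basis at \<open>P\<close> generates on a neighbourhood \<open>D(f)\<close>, and it is independent there because it
  is so at every prime of \<open>D(f)\<close>.

  All this takes place over a ring type of which \<open>A\<close> is a quotient, modulo the kernel.
\<close>

section \<open>Linear algebra modulo a prime ideal\<close>

text \<open>Why \<open>n \<le> d\<close>: the Macaulay representation of such an \<open>n\<close> in
  degree \<open>d\<close> consists of \<open>n\<close> binomials with equal entries, so Green's
  bound for the restriction of \<open>Q\<close> to a general hyperplane is 0 in degree
  \<open>d\<close>. The theorem is thus the case of constant growth in Gotzmann's persistence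
  theorem. For \<open>d = 0\<close> it is read with \<open>Q_{-1} = 0\<close>. No local ring or
  residue field is constructed. A statement at \<open>P\<close> is a statement over the ring itself
  with multipliers outside \<open>P\<close>, and zero in the local ring becomes membership in an
  ideal \<open>J\<close> closed under cancelling such multipliers. Ranks are taken modulo
  \<open>P\<close>; determinants and adjugates then lift what is known modulo \<open>P\<close> to
  exact identities up to a factor outside \<open>P\<close>, in the role of Nakayama's lemma. The new
  variable of the base change has to be removed at the end. A basis over the polynomial ring need
  not have constant coefficients, but the monomial vectors do and they span, so a basis can be
  selected among them.\<close>

lemma choice2: "\<forall>x. \<exists>y z. R x y z \<Longrightarrow> \<exists>f g. \<forall>x. R x (f x) (g x)"
  by metis

definition scl :: "'r::comm_ring_1 \<Rightarrow> ('i \<Rightarrow> 'r) \<Rightarrow> 'i \<Rightarrow> 'r"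
  where "scl a m = (\<lambda>i. a * m i)"

lemma scl_apply [simp]: "scl a m i = a * m i"
  by (simp add: scl_def)

global_interpretation fm: Modules.module scl
  by standard (auto simp: fun_eq_iff algebra_simps)

abbreviation lin :: "(('i \<Rightarrow> 'r::comm_ring_1) \<Rightarrow> ('j \<Rightarrow> 'r)) \<Rightarrow> bool"
  where "lin \<equiv> Modules.module_hom scl scl"

lemmas hom = module_hom.add module_hom.scale module_hom.sum module_hom.diff

lemma linI:
  assumes "\<And>x y. f (x + y) = f x + f y" "\<And>a x. f (scl a x) = scl a (f x)"
  shows "lin f"
  using assms by unfold_locales auto

lemma lin_span_into:
  assumes "lin f" "fm.subspace H" "\<And>x. x \<in> B \<Longrightarrow> f x \<in> H" "m \<in> fm.span B"
  shows "f m \<in> H"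
  using fm.span_minimal[of B "{m. f m \<in> H}"] module_hom.subspace_linear_preimage[OF assms(1,2)] assms(3,4) by blast

lemma fun_sum_apply [simp]: "(\<Sum>x\<in>A. f x) i = (\<Sum>x\<in>A. (f x i :: 'r::comm_monoid_add))"
  by (induction A rule: infinite_finite_induct) auto

section \<open>Ideals and primes of a ring type, and denominators at a prime\<close>

definition idl :: "'r::comm_ring_1 set \<Rightarrow> bool"
  where "idl J \<longleftrightarrow> 0 \<in> J \<and> (\<forall>a\<in>J. \<forall>b\<in>J. a + b \<in> J) \<and> (\<forall>a. \<forall>b\<in>J. a * b \<in> J)"

lemma idl_0: "idl J \<Longrightarrow> 0 \<in> J"
  and idl_add: "idl J \<Longrightarrow> a \<in> J \<Longrightarrow> b \<in> J \<Longrightarrow> a + b \<in> J"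
  and idl_mult: "idl J \<Longrightarrow> b \<in> J \<Longrightarrow> a * b \<in> J"
  by (auto simp: idl_def)

lemma idl_mult2: "idl J \<Longrightarrow> b \<in> J \<Longrightarrow> b * a \<in> J"
  by (metis idl_mult mult.commute)

lemma idl_uminus: "idl J \<Longrightarrow> a \<in> J \<Longrightarrow> - a \<in> J"
  using idl_mult[of J a "-1"] by simp

lemma idl_diff: "idl J \<Longrightarrow> a \<in> J \<Longrightarrow> b \<in> J \<Longrightarrow> a - b \<in> J"
  using idl_add[of J a "-b"] idl_uminus[of J b] by simp

lemma idl_sum: "idl J \<Longrightarrow> (\<And>x. x \<in> A \<Longrightarrow> f x \<in> J) \<Longrightarrow> sum f A \<in> J"
  by (induction A rule: infinite_finite_induct) (auto intro: idl_0 idl_add)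

definition prm :: "'r::comm_ring_1 set \<Rightarrow> bool"
  where "prm P \<longleftrightarrow> idl P \<and> 1 \<notin> P \<and> (\<forall>a b. a * b \<in> P \<longrightarrow> a \<in> P \<or> b \<in> P)"

lemma prm_idl: "prm P \<Longrightarrow> idl P"
  and prm_1: "prm P \<Longrightarrow> 1 \<notin> P"
  and prm_mult: "prm P \<Longrightarrow> a \<notin> P \<Longrightarrow> b \<notin> P \<Longrightarrow> a * b \<notin> P"
  by (auto simp: prm_def)

lemma prm_cancel: "prm P \<Longrightarrow> s \<notin> P \<Longrightarrow> s * a \<in> P \<Longrightarrow> a \<in> P"
  by (auto simp: prm_def)

lemma prm_power: "prm P \<Longrightarrow> a \<notin> P \<Longrightarrow> a ^ k \<notin> P"
  by (induction k) (auto simp: prm_1 prm_mult)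

lemma prm_prod: "prm P \<Longrightarrow> (\<And>x. x \<in> A \<Longrightarrow> f x \<notin> P) \<Longrightarrow> prod f A \<notin> P"
  by (induction A rule: infinite_finite_induct) (auto simp: prm_1 prm_mult)

text \<open>Two denominators multiply to a common one outside \<open>P\<close>. The set is the
  preimage of the localization of \<open>H\<close> at \<open>P\<close>.\<close>

lemma subspace_sat:
  assumes P: "prm P" and H: "fm.subspace H"
  shows "fm.subspace {m. \<exists>s. s \<notin> P \<and> scl s m \<in> H}"
proof (rule fm.subspaceI)
  show "0 \<in> {m. \<exists>s. s \<notin> P \<and> scl s m \<in> H}"
    using prm_1[OF P] fm.subspace_0[OF H] by auto
next
  fix x y assume "x \<in> {m. \<exists>s. s \<notin> P \<and> scl s m \<in> H}" "y \<in> {m. \<exists>s. s \<notin> P \<and> scl s m \<in> H}"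
  then obtain s s' where *: "s \<notin> P" "scl s x \<in> H" "s' \<notin> P" "scl s' y \<in> H" by blast
  have "scl s' (scl s x) + scl s (scl s' y) \<in> H"
    by (intro fm.subspace_add fm.subspace_scale H *)
  then have "scl (s * s') (x + y) \<in> H" by (simp add: fm.scale_right_distrib mult.commute)
  then show "x + y \<in> {m. \<exists>s. s \<notin> P \<and> scl s m \<in> H}" using prm_mult[OF P *(1,3)] by blast
next
  fix c x assume "x \<in> {m. \<exists>s. s \<notin> P \<and> scl s m \<in> H}"
  then obtain s where *: "s \<notin> P" "scl s x \<in> H" by blast
  then show "scl c x \<in> {m. \<exists>s. s \<notin> P \<and> scl s m \<in> H}"
    using fm.subspace_scale[OF H, of "scl s x" c] by (auto simp: mult.commute)
qed

text \<open>Functions on \<open>unit\<close> form the free module of rank one; through it ideals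
  inherit results on submodules, such as \<open>subspace_sat\<close>.\<close>

lemma idl_iff_subspace: "idl L \<longleftrightarrow> fm.subspace {v :: unit \<Rightarrow> 'r::comm_ring_1. v () \<in> L}"
proof
  assume R: "fm.subspace {v :: unit \<Rightarrow> 'r. v () \<in> L}"
  show "idl L"
    unfolding idl_def using fm.subspace_0[OF R] fm.subspace_add[OF R, of "\<lambda>_. a" "\<lambda>_. b" for a b]
      fm.subspace_scale[OF R, of "\<lambda>_. a" for a] by auto
qed (auto simp: idl_def fm.subspace_def)

lemma power_common:
  assumes J: "idl J" and "finite S" "\<And>i. i \<in> S \<Longrightarrow> \<exists>k. f ^ k * a i \<in> J"
  shows "\<exists>k. \<forall>i\<in>S. f ^ k * a i \<in> J"
  using assms(2,3)
proof (induction S rule: finite_induct)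
  case (insert x S)
  then obtain k l where k: "\<forall>i\<in>S. f ^ k * a i \<in> J" and l: "f ^ l * a x \<in> J" by blast
  have "f ^ (k + l) * a i = f ^ l * (f ^ k * a i)" "f ^ (k + l) * a i = f ^ k * (f ^ l * a i)" for i
    by (simp_all add: power_add mult_ac)
  then have "\<forall>i\<in>insert x S. f ^ (k + l) * a i \<in> J"
    using k l idl_mult[OF J] by (metis insert_iff)
  then show ?case ..
qed simp

text \<open>For a prime \<open>K\<close>, clearing denominators shows that this is linear
  independence over the residue field of \<open>K\<close>, for the first \<open>k\<close> rows with
  \<open>n\<close> entries each.\<close>

definition indep :: "'r::comm_ring_1 set \<Rightarrow> nat \<Rightarrow> nat \<Rightarrow> (nat \<Rightarrow> nat \<Rightarrow> 'r) \<Rightarrow> bool"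
  where "indep K n k C \<longleftrightarrow> (\<forall>a. (\<forall>c<n. (\<Sum>i<k. a i * C i c) \<in> K) \<longrightarrow> (\<forall>i<k. a i \<in> K))"

lemma indepD: "indep K n k C \<Longrightarrow> (\<And>c. c < n \<Longrightarrow> (\<Sum>i<k. a i * C i c) \<in> K) \<Longrightarrow> i < k \<Longrightarrow> a i \<in> K"
  unfolding indep_def by blast

lemma indep_Suc:
  assumes "indep K n (Suc k) C"
  shows "indep K n k C"
  unfolding indep_def
proof (intro allI impI)
  fix a i assume a: "\<forall>c<n. (\<Sum>i<k. a i * C i c) \<in> K" and i: "i < k"
  have "(a(k := 0)) i \<in> K"
    by (rule indepD[OF assms]) (use a i in auto)
  then show "a i \<in> K" using i by simp
qed

abbreviation diag_prod :: "nat \<Rightarrow> nat \<Rightarrow> (nat \<Rightarrow> nat \<Rightarrow> 'r::comm_ring_1) \<Rightarrow> (nat \<Rightarrow> nat \<Rightarrow> 'r) \<Rightarrow> 'r \<Rightarrow> bool"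
  where "diag_prod k n C D d \<equiv> \<forall>i<k. \<forall>j<k. (\<Sum>c<n. C i c * D c j) = (if i = j then d else 0)"

text \<open>If \<open>C D = d\<close> then \<open>C (d - D C) = 0\<close>, so the columns of
  \<open>d - D C\<close> are annihilated by the rows of \<open>C\<close>. The formula multiplies an
  arbitrary row \<open>v\<close> by the \<open>b\<close>-th such column.\<close>

lemma sum_project:
  fixes v :: "nat \<Rightarrow> 'r::comm_ring_1" and C D :: "nat \<Rightarrow> nat \<Rightarrow> 'r"
  assumes "b < n"
  shows "(\<Sum>c<n. v c * (d * (if c = b then 1 else 0) - (\<Sum>j<k. D c j * C j b)))
    = d * v b - (\<Sum>j<k. (\<Sum>c<n. v c * D c j) * C j b)"
proof -
  have "(\<Sum>c<n. v c * (d * (if c = b then 1 else 0) - (\<Sum>j<k. D c j * C j b)))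
    = (\<Sum>c<n. if c = b then d * v c else 0) - (\<Sum>c<n. \<Sum>j<k. v c * D c j * C j b)"
    unfolding sum_subtractf[symmetric]
    by (intro sum.cong) (auto simp: right_diff_distrib sum_distrib_left mult_ac)
  also have "(\<Sum>c<n. \<Sum>j<k. v c * D c j * C j b) = (\<Sum>j<k. (\<Sum>c<n. v c * D c j) * C j b)"
    by (subst sum.swap) (simp add: sum_distrib_right)
  finally show ?thesis using assms by simp
qed

text \<open>Gaussian elimination without division: the new row is reduced by the earlier ones, and
  an entry that survives modulo \<open>P\<close> becomes the pivot. Independence is known only
  modulo \<open>P\<close>, yet the resulting identity is exact.\<close>

lemma indep_right_inverse:
  assumes "prm P" "indep P n k C"
  shows "\<exists>D d. d \<notin> P \<and> diag_prod k n C D d"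
  using assms(2)
proof (induction k)
  case 0
  then show ?case using prm_1[OF assms(1)] by auto
next
  case (Suc k)
  obtain D d where d: "d \<notin> P"
    and D: "\<And>i j. i < k \<Longrightarrow> j < k \<Longrightarrow> (\<Sum>c<n. C i c * D c j) = (if i = j then d else 0)"
    using Suc.IH[OF indep_Suc[OF Suc.prems]] by blast
  define q where "q j = (\<Sum>c<n. C k c * D c j)" for j
  \<comment> \<open>The reduced row. Were all its entries in \<open>P\<close>, the coefficients
    \<open>- q i\<close> and \<open>d\<close> would form a nontrivial relation modulo
    \<open>P\<close>.\<close>
  define c' where "c' c = d * C k c - (\<Sum>j<k. q j * C j c)" for c
  have "\<exists>b<n. c' b \<notin> P"
  proof (rule ccontr)
    assume "\<not> ?thesis"
    then have "(\<Sum>i<Suc k. (if i = k then d else - q i) * C i c) \<in> P" if "c < n" for c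
      using that by (auto simp: c'_def sum_negf)
    from indepD[OF Suc.prems this, of k] d show False by simp
  qed
  then obtain b where b: "b < n" "c' b \<notin> P" by blast
  \<comment> \<open>The \<open>b\<close>-th column of \<open>d - D C\<close>: the earlier rows
    annihilate it, and row \<open>k\<close> sends it to the pivot \<open>c' b\<close>.\<close>
  define x where "x c = d * (if c = b then 1 else 0) - (\<Sum>j<k. D c j * C j b)" for c
  have Cx: "(\<Sum>c<n. C i c * x c) = d * C i b - (\<Sum>j<k. (\<Sum>c<n. C i c * D c j) * C j b)" for i
    unfolding x_def using b(1) by (rule sum_project)
  have Cx0: "(\<Sum>c<n. C i c * x c) = 0" if "i < k" for i
  proof -
    have "(\<Sum>j<k. (\<Sum>c<n. C i c * D c j) * C j b) = (\<Sum>j<k. if i = j then d * C j b else 0)"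
      by (rule sum.cong) (use that D in auto)
    then show ?thesis using that by (simp add: Cx)
  qed
  have Cxk: "(\<Sum>c<n. C k c * x c) = c' b"
    by (simp add: Cx c'_def q_def)
  \<comment> \<open>The last column is a multiple of \<open>x\<close>; from the others a multiple of
    \<open>x\<close> is subtracted so that row \<open>k\<close> annihilates them.\<close>
  define D' where "D' c j = (if j = k then d * x c else c' b * D c j - q j * x c)" for c j
  have "(\<Sum>c<n. C i c * D' c j) = (if i = j then d * c' b else 0)" if ij: "i < Suc k" "j < Suc k" for i j
  proof (cases "j = k")
    case True
    have "(\<Sum>c<n. C i c * D' c j) = d * (\<Sum>c<n. C i c * x c)"
      unfolding sum_distrib_left D'_def by (rule sum.cong) (use True in \<open>auto simp: mult_ac\<close>)
    then show ?thesis using ij Cx0[of i] Cxk True by (auto simp: less_Suc_eq)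
  next
    case False
    have "(\<Sum>c<n. C i c * D' c j) = c' b * (\<Sum>c<n. C i c * D c j) - q j * (\<Sum>c<n. C i c * x c)"
      unfolding sum_distrib_left sum_subtractf[symmetric] D'_def
      by (rule sum.cong) (use False in \<open>auto simp: algebra_simps\<close>)
    then show ?thesis using ij False Cx0[of i] Cxk D[of i j] 
      by (auto simp: less_Suc_eq q_def mult_ac)
  qed
  moreover have "d * c' b \<notin> P" using d b prm_mult[OF assms(1)] by blast
  ultimately show ?case by blast
qed

lemma det_zero_col:
  assumes "A \<in> carrier_mat k k" "n < k" "\<And>i. i < k \<Longrightarrow> A $$ (i, n) = (0::'r::comm_ring_1)"
  shows "det A = 0"
  unfolding det_def'[OF assms(1)]
proof (rule sum.neutral, safe)
  fix p assume p: "p permutes {0..<k}"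
  obtain i where "i < k" "p i = n"
    using permutes_image[OF p] assms(2) by (metis atLeastLessThan_iff imageE zero_le)
  then have "(\<Prod>i = 0..<k. A $$ (i, p i)) = 0"
    using assms(3)[of i] by (intro prod_zero) auto
  then show "signof p * (\<Prod>i = 0..<k. A $$ (i, p i)) = 0" by simp
qed

lemma mat_mult_diag:
  assumes "\<And>i j. i < n \<Longrightarrow> j < n \<Longrightarrow> (\<Sum>c<n. C i c * D c j) = (if i = j then d else (0::'r::comm_ring_1))"
  shows "mat n n (\<lambda>(i, c). C i c) * mat n n (\<lambda>(c, j). D c j) = d \<cdot>\<^sub>m 1\<^sub>m n"
  by (rule eq_matI) (use assms in \<open>auto simp: scalar_prod_def lessThan_atLeast0\<close>)

text \<open>Otherwise the rows, padded by zeros to a square matrix, have determinant 0, while the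
  right inverse makes this determinant a divisor of \<open>d ^ k\<close>, which lies outside
  \<open>P\<close>.\<close>

lemma indep_bound:
  assumes P: "prm P" and "indep P n k C"
  shows "k \<le> n"
proof (rule ccontr)
  assume nk: "\<not> k \<le> n"
  obtain D d where d: "d \<notin> P"
    and D: "\<And>i j. i < k \<Longrightarrow> j < k \<Longrightarrow> (\<Sum>c<n. C i c * D c j) = (if i = j then d else 0)"
    using indep_right_inverse[OF assms] by blast
  let ?A = "mat k k (\<lambda>(i, c). if c < n then C i c else 0)" and ?B = "mat k k (\<lambda>(i, c). D i c)"
  have "(\<Sum>c<k. (if c < n then C i c else 0) * D c j) = (\<Sum>c<n. C i c * D c j)" for i j
  proof -
    have "(\<Sum>c<k. (if c < n then C i c else 0) * D c j) = (\<Sum>c\<in>{..<k} \<inter> {c. c < n}. C i c * D c j)"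
      unfolding sum.inter_restrict[OF finite_lessThan] by (rule sum.cong) auto
    also have "{..<k} \<inter> {c. c < n} = {..<n}" using nk by auto
    finally show ?thesis .
  qed
  then have "?A * ?B = d \<cdot>\<^sub>m 1\<^sub>m k"
    by (intro mat_mult_diag) (simp add: D)
  then have "det ?A * det ?B = d ^ k"
    by (metis (no_types, lifting) det_mult det_one det_smult index_one_mat(3) mat_carrier mult.right_neutral)
  moreover have "det ?A = 0"
    by (rule det_zero_col[of _ k n]) (use nk in auto)
  ultimately have "d ^ k = 0" by simp
  then show False using prm_power[OF P d, of k] idl_0[OF prm_idl[OF P]] by simp
qed

text \<open>The determinant of \<open>C\<close> divides \<open>d ^ n\<close>, so it lies outside
  \<open>P\<close>, and the adjugate is an inverse on both sides up to it. The right inverse itself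
  need not be one on the left, since there may be zero divisors.\<close>

lemma indep_two_sided_inverse:
  assumes P: "prm P" and "indep P n n C"
  shows "\<exists>D d. d \<notin> P \<and> diag_prod n n C D d \<and> diag_prod n n D C d"
proof -
  obtain D d where d: "d \<notin> P"
    and D: "\<And>i j. i < n \<Longrightarrow> j < n \<Longrightarrow> (\<Sum>c<n. C i c * D c j) = (if i = j then d else 0)"
    using indep_right_inverse[OF assms] by blast
  let ?A = "mat n n (\<lambda>(i, c). C i c)" and ?B = "mat n n (\<lambda>(i, c). D i c)"
  have "?A * ?B = d \<cdot>\<^sub>m 1\<^sub>m n" by (intro mat_mult_diag) (simp add: D)
  then have "det ?A * det ?B = d ^ n"
    by (metis (no_types, lifting) det_mult det_one det_smult index_one_mat(3) mat_carrier mult.right_neutral)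
  then have dA: "det ?A \<notin> P"
    using prm_power[OF P d, of n] idl_mult2[OF prm_idl[OF P], of "det ?A" "det ?B"] by auto
  let ?D = "\<lambda>i j. adj_mat ?A $$ (i, j)"
  have A: "?A \<in> carrier_mat n n" by simp
  have eq: "(U * V) $$ (i, j) = (\<Sum>c<n. U $$ (i, c) * V $$ (c, j))"
    if "U \<in> carrier_mat n n" "V \<in> carrier_mat n n" "i < n" "j < n" for U V and i j
    using that by (auto simp: scalar_prod_def lessThan_atLeast0)
  have "(\<Sum>c<n. C i c * ?D c j) = (if i = j then det ?A else 0)" if ij: "i < n" "j < n" for i j
  proof -
    have "(\<Sum>c<n. C i c * ?D c j) = (?A * adj_mat ?A) $$ (i, j)"
      by (subst eq[OF A adj_mat(1)[OF A] ij]) (simp add: ij)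
    then show ?thesis by (simp add: adj_mat(2)[OF A] ij del: index_mult_mat)
  qed
  moreover have "(\<Sum>c<n. ?D i c * C c j) = (if i = j then det ?A else 0)" if ij: "i < n" "j < n" for i j
  proof -
    have "(\<Sum>c<n. ?D i c * C c j) = (adj_mat ?A * ?A) $$ (i, j)"
      by (subst eq[OF adj_mat(1)[OF A] A ij]) (simp add: ij)
    then show ?thesis by (simp add: adj_mat(3)[OF A] ij del: index_mult_mat)
  qed
  ultimately show ?thesis using dA by (intro exI[of _ ?D] exI[of _ "det ?A"] conjI) auto
qed

lemma columns_two_sided_inverse:
  fixes n :: nat
  assumes P: "prm P"
    and "\<And>x c. (\<And>i. i < n \<Longrightarrow> (\<Sum>c<n. C i c * x c) \<in> P) \<Longrightarrow> c < n \<Longrightarrow> x c \<in> P"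
  shows "\<exists>D d. d \<notin> P \<and> diag_prod n n C D d \<and> diag_prod n n D C d"
proof -
  have "indep P n n (\<lambda>i j. C j i)"
    unfolding indep_def using assms(2) by (auto simp: mult.commute)
  from indep_two_sided_inverse[OF P this] obtain D d where d: "d \<notin> P"
    and D: "\<And>i j. i < n \<Longrightarrow> j < n \<Longrightarrow> (\<Sum>c<n. C c i * D c j) = (if i = j then d else 0)"
      "\<And>i j. i < n \<Longrightarrow> j < n \<Longrightarrow> (\<Sum>c<n. D i c * C j c) = (if i = j then d else 0)"
    by blast
  have "(\<Sum>c<n. C i c * D j c) = (if i = j then d else 0)" if "i < n" "j < n" for i j
    using D(2)[OF that(2,1)] by (auto simp: mult.commute)
  moreover have "(\<Sum>c<n. D c i * C c j) = (if i = j then d else 0)" if "i < n" "j < n" for i j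
    using D(1)[OF that(2,1)] by (auto simp: mult.commute)
  ultimately show ?thesis using d by (intro exI[of _ "\<lambda>i j. D j i"] exI[of _ d]) auto
qed

text \<open>The counterpart of Nakayama's lemma: \<open>n\<close> vectors spanning a free module of
  rank \<open>n\<close> form a basis. \<open>E\<close> holds the coordinates of a basis up to
  \<open>\<sigma>\<close>, the rows of \<open>C\<close> those of the vectors. A column killed by
  \<open>C\<close> modulo \<open>P\<close> is killed by all that they span, in particular by
  \<open>E\<close>, so it vanishes modulo \<open>P\<close>.\<close>

lemma spanning_two_sided_inverse:
  fixes n :: nat
  assumes P: "prm P" and \<eta>: "\<eta> \<notin> P" and \<sigma>: "\<sigma> \<notin> P"
    and E: "\<And>k j. k < n \<Longrightarrow> j < n \<Longrightarrow> E k j - (if k = j then \<sigma> else 0) \<in> P"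
    and span: "\<And>k. k < n \<Longrightarrow> \<exists>a. \<forall>j<n. \<eta> * E k j - (\<Sum>b<n. a b * C b j) \<in> P"
  shows "\<exists>D d. d \<notin> P \<and> diag_prod n n C D d \<and> diag_prod n n D C d"
proof (rule columns_two_sided_inverse[OF P])
  fix x k assume x: "\<And>b. b < n \<Longrightarrow> (\<Sum>j<n. C b j * x j) \<in> P" and k: "k < n"
  note P_ = prm_idl[OF P]
  obtain a where a: "\<And>j. j < n \<Longrightarrow> \<eta> * E k j - (\<Sum>b<n. a b * C b j) \<in> P" using span[OF k] by blast
  have "(\<Sum>j<n. (\<eta> * E k j - (\<Sum>b<n. a b * C b j)) * x j) + (\<Sum>b<n. a b * (\<Sum>j<n. C b j * x j))
     - (\<Sum>j<n. \<eta> * (E k j - (if k = j then \<sigma> else 0)) * x j) \<in> P"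
  proof (intro idl_diff[OF P_] idl_add[OF P_])
    show "(\<Sum>j<n. (\<eta> * E k j - (\<Sum>b<n. a b * C b j)) * x j) \<in> P"
      by (rule idl_sum[OF P_], rule idl_mult2[OF P_], rule a) simp
    show "(\<Sum>b<n. a b * (\<Sum>j<n. C b j * x j)) \<in> P"
      by (rule idl_sum[OF P_], rule idl_mult[OF P_], rule x) simp
    show "(\<Sum>j<n. \<eta> * (E k j - (if k = j then \<sigma> else 0)) * x j) \<in> P"
      by (rule idl_sum[OF P_], rule idl_mult2[OF P_], rule idl_mult[OF P_], rule E[OF k]) simp
  qed
  also have "(\<Sum>b<n. a b * (\<Sum>j<n. C b j * x j)) = (\<Sum>j<n. (\<Sum>b<n. a b * C b j) * x j)"
    unfolding sum_distrib_left sum_distrib_right by (subst sum.swap) (simp add: mult.assoc)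
  also have "(\<Sum>j<n. (\<eta> * E k j - (\<Sum>b<n. a b * C b j)) * x j) + (\<Sum>j<n. (\<Sum>b<n. a b * C b j) * x j)
     - (\<Sum>j<n. \<eta> * (E k j - (if k = j then \<sigma> else 0)) * x j) = (\<Sum>j<n. if j = k then \<eta> * \<sigma> * x j else 0)"
    unfolding sum.distrib[symmetric] sum_subtractf[symmetric] by (rule sum.cong) (auto simp: algebra_simps)
  also have "\<dots> = \<eta> * \<sigma> * x k" using k by simp
  finally show "x k \<in> P" using prm_mult[OF P \<eta> \<sigma>] prm_cancel[OF P] by blast
qed

text \<open>The candidates are the columns of \<open>d - D C\<close>. The rows of \<open>C\<close>
  annihilate them exactly and not just modulo \<open>P\<close>, as \<open>indep_insert\<close>
  requires.\<close>

lemma indep_annihilator: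
  assumes P: "prm P" and C: "indep P n k C" and "k < n"
  shows "\<exists>x. (\<exists>c<n. x c \<notin> P) \<and> (\<forall>i<k. (\<Sum>c<n. C i c * x c) = 0)"
proof (rule ccontr)
  assume none: "\<not> ?thesis"
  obtain D d where d: "d \<notin> P"
    and D: "\<And>i j. i < k \<Longrightarrow> j < k \<Longrightarrow> (\<Sum>c<n. C i c * D c j) = (if i = j then d else 0)"
    using indep_right_inverse[OF P C] by blast
  have x: "d * (if c = b then 1 else 0) - (\<Sum>j<k. D c j * C j b) \<in> P" if "b < n" "c < n" for b c
  proof -
    let ?x = "\<lambda>c. d * (if c = b then 1 else 0) - (\<Sum>j<k. D c j * C j b)"
    have "(\<Sum>c<n. C i c * ?x c) = 0" if i: "i < k" for i
    proof -
      have "(\<Sum>j<k. (\<Sum>c<n. C i c * D c j) * C j b) = (\<Sum>j<k. if i = j then d * C j b else 0)"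
        by (rule sum.cong) (use i D in auto)
      then show ?thesis using i by (simp add: sum_project[OF \<open>b < n\<close>])
    qed
    moreover have "\<not> ((\<exists>c<n. ?x c \<notin> P) \<and> (\<forall>i<k. (\<Sum>c<n. C i c * ?x c) = 0))"
      using none by (rule contrapos_nn) (erule exI)
    ultimately show ?thesis using that by blast
  qed
  \<comment> \<open>the rows of \<open>D\<close> would then be independent, but they have only \<open>k\<close> entries\<close>
  have "indep P k n D"
    unfolding indep_def
  proof (intro allI impI)
    fix a b assume a: "\<forall>c<k. (\<Sum>i<n. a i * D i c) \<in> P" and b: "b < n"
    have "(\<Sum>c<n. a c * (d * (if c = b then 1 else 0) - (\<Sum>j<k. D c j * C j b))) \<in> P"
      by (intro idl_sum[OF prm_idl[OF P]] idl_mult[OF prm_idl[OF P]] x b) auto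
    then have *: "d * a b - (\<Sum>j<k. (\<Sum>c<n. a c * D c j) * C j b) \<in> P" unfolding sum_project[OF b] .
    have "(\<Sum>j<k. (\<Sum>c<n. a c * D c j) * C j b) \<in> P"
      by (rule idl_sum[OF prm_idl[OF P]], rule idl_mult2[OF prm_idl[OF P]]) (use a in auto)
    from idl_add[OF prm_idl[OF P] * this] have "d * a b \<in> P" by simp
    then show "a b \<in> P" using prm_cancel[OF P d] by blast
  qed
  from indep_bound[OF P this] assms(3) show False by simp
qed

section \<open>Green's theorem for values at most the degree\<close>

text \<open>For a submodule \<open>W\<close>: the vectors of length \<open>n\<close> whose residues
  lie in the span of those of \<open>W\<close> over the residue field.\<close>

definition cl :: "'r::comm_ring_1 set \<Rightarrow> nat \<Rightarrow> (nat \<Rightarrow> 'r) set \<Rightarrow> (nat \<Rightarrow> 'r) set"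
  where "cl P n W = {v. \<exists>t w. t \<notin> P \<and> w \<in> W \<and> (\<forall>c<n. t * v c - w c \<in> P)}"

lemma clI: "t \<notin> P \<Longrightarrow> w \<in> W \<Longrightarrow> (\<And>c. c < n \<Longrightarrow> t * v c - w c \<in> P) \<Longrightarrow> v \<in> cl P n W"
  unfolding cl_def by blast

lemma clE:
  assumes "v \<in> cl P n W"
  obtains t w where "t \<notin> P" "w \<in> W" "\<And>c. c < n \<Longrightarrow> t * v c - w c \<in> P"
  using assms unfolding cl_def by blast

lemma cl_mono: "W \<subseteq> W' \<Longrightarrow> cl P n W \<subseteq> cl P n W'"
  unfolding cl_def by blast

lemma subspace_cl:
  assumes P: "prm P" and W: "fm.subspace W"
  shows "fm.subspace (cl P n W)"
proof (rule fm.subspaceI)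
  show "0 \<in> cl P n W"
    by (rule clI[of 1 _ 0]) (use prm_1[OF P] fm.subspace_0[OF W] idl_0[OF prm_idl[OF P]] in auto)
next
  fix x y assume "x \<in> cl P n W" "y \<in> cl P n W"
  then obtain t w t' w' where *: "t \<notin> P" "w \<in> W" "\<And>c. c < n \<Longrightarrow> t * x c - w c \<in> P"
    "t' \<notin> P" "w' \<in> W" "\<And>c. c < n \<Longrightarrow> t' * y c - w' c \<in> P"
    by (elim clE) blast
  show "x + y \<in> cl P n W"
  proof (rule clI)
    show "t * t' \<notin> P" using * prm_mult[OF P] by blast
    show "scl t' w + scl t w' \<in> W" using * W by (simp add: fm.subspace_add fm.subspace_scale)
    fix c assume c: "c < n"
    have "t' * (t * x c - w c) + t * (t' * y c - w' c) \<in> P"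
      by (intro idl_add idl_mult prm_idl P * c)
    then show "t * t' * (x + y) c - (scl t' w + scl t w') c \<in> P"
      by (simp add: algebra_simps)
  qed
next
  fix a x assume "x \<in> cl P n W"
  then obtain t w where *: "t \<notin> P" "w \<in> W" "\<And>c. c < n \<Longrightarrow> t * x c - w c \<in> P"
    by (elim clE) blast
  show "scl a x \<in> cl P n W"
  proof (rule clI)
    show "t \<notin> P" "scl a w \<in> W" using * W by (simp_all add: fm.subspace_scale)
    fix c assume c: "c < n"
    have "a * (t * x c - w c) \<in> P"
      by (intro idl_mult prm_idl P * c)
    then show "t * (scl a x) c - (scl a w) c \<in> P"
      by (simp add: algebra_simps)
  qed
qed

lemma cl_superset: "prm P \<Longrightarrow> W \<subseteq> cl P n W"
  by (auto intro!: clI[of 1] simp: prm_1 idl_0 prm_idl)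

lemma cl_cancel:
  assumes P: "prm P" and "a \<notin> P" "scl a v \<in> cl P n W"
  shows "v \<in> cl P n W"
proof -
  obtain t w where *: "t \<notin> P" "w \<in> W" "\<And>c. c < n \<Longrightarrow> t * (scl a v) c - w c \<in> P"
    using assms(3) by (elim clE) blast
  show ?thesis
    by (rule clI[of "t * a" _ w]) (use * prm_mult[OF P] assms(2) in \<open>auto simp: mult.assoc\<close>)
qed

text \<open>In a nontrivial relation among the rows and \<open>v\<close>, the coefficient of
  \<open>v\<close> lies outside \<open>P\<close>, because the rows alone are independent; so it
  serves as denominator.\<close>

lemma cl_extend:
  assumes P: "prm P" and W: "fm.subspace W" and C: "indep P n k C" "\<And>i. i < k \<Longrightarrow> C i \<in> W"
    and v: "\<not> indep P n (Suc k) (C(k := v))"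
  shows "v \<in> cl P n W"
proof -
  obtain a where a: "\<And>c. c < n \<Longrightarrow> (\<Sum>i<Suc k. a i * (C(k := v)) i c) \<in> P" and "\<exists>i<Suc k. a i \<notin> P"
    using v unfolding indep_def by blast
  have a': "(\<Sum>i<k. a i * C i c) + a k * v c \<in> P" if "c < n" for c
    using a[OF that] by simp
  have ak: "a k \<notin> P"
  proof
    assume ak: "a k \<in> P"
    have "(\<Sum>i<k. a i * C i c) \<in> P" if "c < n" for c
      using idl_diff[OF prm_idl[OF P] a'[OF that] idl_mult2[OF prm_idl[OF P] ak, of "v c"]] by simp
    then have "\<forall>i<k. a i \<in> P" using C(1) unfolding indep_def by blast
    with \<open>\<exists>i<Suc k. a i \<notin> P\<close> ak show False by (auto simp: less_Suc_eq)
  qed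
  show ?thesis
  proof (rule clI[OF ak])
    show "- (\<Sum>i<k. scl (a i) (C i)) \<in> W"
      by (intro fm.subspace_neg fm.subspace_sum fm.subspace_scale W C(2)) auto
  qed (use a' in \<open>simp add: algebra_simps\<close>)
qed

text \<open>Scaling a row by an element outside \<open>P\<close> and changing it modulo
  \<open>P\<close> both preserve independence; so \<open>cl\<close> does not raise the rank.\<close>

lemma indep_cl:
  assumes P: "prm P" and C: "indep P n k C" "\<And>i. i < k \<Longrightarrow> C i \<in> cl P n W"
  shows "\<exists>C'. indep P n k C' \<and> (\<forall>i<k. C' i \<in> W)"
proof -
  have "\<forall>i. \<exists>t w. i < k \<longrightarrow> t \<notin> P \<and> w \<in> W \<and> (\<forall>c<n. t * C i c - w c \<in> P)"
    using C(2) unfolding cl_def by auto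
  then obtain t w where tw: "\<And>i. i < k \<Longrightarrow> t i \<notin> P" "\<And>i. i < k \<Longrightarrow> w i \<in> W"
    "\<And>i c. i < k \<Longrightarrow> c < n \<Longrightarrow> t i * C i c - w i c \<in> P"
    by metis
  have "indep P n k w"
    unfolding indep_def
  proof (intro allI impI)
    fix a i assume a: "\<forall>c<n. (\<Sum>i<k. a i * w i c) \<in> P" and i: "i < k"
    have "a i * t i \<in> P"
    proof (rule indepD[OF C(1) _ i])
      fix c assume c: "c < n"
      have "(\<Sum>i<k. a i * w i c) + (\<Sum>i<k. a i * (t i * C i c - w i c)) \<in> P"
        by (rule idl_add[OF prm_idl[OF P]], use a c in blast)
          (intro idl_sum idl_mult prm_idl P tw(3) c, simp)
      then show "(\<Sum>i<k. a i * t i * C i c) \<in> P"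
        by (simp add: sum.distrib[symmetric] algebra_simps)
    qed
    then show "a i \<in> P" using tw(1)[OF i] P by (auto simp: prm_def)
  qed
  then show ?thesis using tw(2) by blast
qed

section \<open>General linear forms on a rational normal curve\<close>

locale rational_curve =
  fixes P :: "'r::comm_ring_1 set" and s :: "nat \<Rightarrow> 'r"
    and Y :: "nat \<Rightarrow> ('i \<Rightarrow> 'r) \<Rightarrow> ('i \<Rightarrow> 'r)" and r :: nat
  assumes P: "prm P" and s: "a \<noteq> b \<Longrightarrow> s a - s b \<notin> P"
    and linY: "lin (Y k)" and Y_commute: "Y k (Y l m) = Y l (Y k m)"
begin

text \<open>The sum is a polynomial with vector coefficients, evaluated at \<open>s m\<close>.
  Subtracting its value at one parameter \<open>s t\<close> and dividing by
  \<open>s m - s t\<close>, as \<open>sat\<close> permits, lowers the degree and keeps infinitely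
  many parameters.\<close>

lemma vandermonde:
  fixes v :: "nat \<Rightarrow> 'j \<Rightarrow> 'r"
  assumes C: "fm.subspace C" and sat: "\<And>a v. a \<notin> P \<Longrightarrow> scl a v \<in> C \<Longrightarrow> v \<in> C"
    and "infinite T" "\<And>m. m \<in> T \<Longrightarrow> (\<Sum>k\<le>q. scl (s m ^ k) (v k)) \<in> C" "k \<le> q"
  shows "v k \<in> C"
  using assms(3-5)
proof (induction q arbitrary: v T k)
  case 0
  then obtain m where "m \<in> T" by (metis finite.emptyI equals0I)
  with 0 show ?case by fastforce
next
  case (Suc q)
  then obtain t where t: "t \<in> T" by (metis finite.emptyI equals0I)
  \<comment> \<open>The coefficients of the quotient by the linear factor with root
    \<open>s t\<close>; the top one is \<open>v (Suc q)\<close>.\<close>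
  define w where "w i = (\<Sum>k=Suc i..Suc q. scl (s t ^ (k - Suc i)) (v k))" for i
  have w: "w k \<in> C" if "k \<le> q" for k
  proof (rule Suc.IH[of "T - {t}", OF _ _ that])
    show "infinite (T - {t})" using Suc.prems by simp
    fix m assume m: "m \<in> T - {t}"
    have "(\<Sum>k\<le>Suc q. scl (s m ^ k) (v k)) - (\<Sum>k\<le>Suc q. scl (s t ^ k) (v k)) \<in> C"
      using m t by (intro fm.subspace_diff C Suc.prems(2)) auto
    also have "(\<Sum>k\<le>Suc q. scl (s m ^ k) (v k)) - (\<Sum>k\<le>Suc q. scl (s t ^ k) (v k))
      = scl (s m - s t) (\<Sum>k\<le>q. scl (s m ^ k) (w k))"
    proof
      fix i
      have "(\<Sum>k\<le>Suc q. s m ^ k * v k i) - (\<Sum>k\<le>Suc q. s t ^ k * v k i)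
        = (s m - s t) * (\<Sum>k\<le>Suc q. \<Sum>j<k. s t ^ (k - Suc j) * s m ^ j * v k i)"
        unfolding sum_subtractf[symmetric] sum_distrib_left left_diff_distrib[symmetric] power_diff_sumr2
        by (simp add: sum_distrib_right sum_distrib_left mult_ac)
      also have "(\<Sum>k\<le>Suc q. \<Sum>j<k. s t ^ (k - Suc j) * s m ^ j * v k i)
        = (\<Sum>j<Suc q. \<Sum>k=Suc j..Suc q. s t ^ (k - Suc j) * s m ^ j * v k i)"
        by (rule sum.nested_swap')
      also have "\<dots> = (\<Sum>j\<le>q. s m ^ j * w j i)"
        unfolding w_def lessThan_Suc_atMost
        by (simp del: sum.cl_ivl_Suc add: sum_distrib_left mult_ac)
      finally show "((\<Sum>k\<le>Suc q. scl (s m ^ k) (v k)) - (\<Sum>k\<le>Suc q. scl (s t ^ k) (v k))) i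
        = scl (s m - s t) (\<Sum>k\<le>q. scl (s m ^ k) (w k)) i"
        by (simp only: minus_apply fun_sum_apply scl_apply)
    qed
    finally show "(\<Sum>k\<le>q. scl (s m ^ k) (w k)) \<in> C"
      by (rule sat[rotated]) (use m s[of m t] in auto)
  qed
  have v: "v (Suc q) \<in> C" using w[of q] by (simp add: w_def)
  show ?case
  proof (cases "k = Suc q")
    case False
    show ?thesis
    proof (rule Suc.IH)
      fix m assume "m \<in> T"
      then have "(\<Sum>k\<le>Suc q. scl (s m ^ k) (v k)) - scl (s m ^ Suc q) (v (Suc q)) \<in> C"
        using v by (intro fm.subspace_diff fm.subspace_scale C Suc.prems(2)) auto
      then show "(\<Sum>k\<le>q. scl (s m ^ k) (v k)) \<in> C" by simp
    qed (use False Suc.prems in auto)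
  qed (use v in simp)
qed

text \<open>Infinitely many roots modulo \<open>P\<close> would put every coefficient into
  \<open>P\<close>, by \<open>vandermonde\<close> for \<open>P\<close> viewed as a
  submodule.\<close>

lemma poly_cofinite:
  assumes "poly g (s m0) \<notin> P"
  shows "finite {m. poly g (s m) \<in> P}"
proof (rule ccontr)
  assume inf: "infinite {m. poly g (s m) \<in> P}"
  have "(\<lambda>_::unit. coeff g k) \<in> {v. v () \<in> P}" if "k \<le> degree g" for k
  proof (rule vandermonde[OF _ _ inf _ that])
    show "fm.subspace {v::unit \<Rightarrow> 'r. v () \<in> P}"
      using prm_idl[OF P] by (simp only: idl_iff_subspace)
    fix a and v :: "unit \<Rightarrow> 'r" assume "a \<notin> P" "scl a v \<in> {v. v () \<in> P}"
    then show "v \<in> {v. v () \<in> P}" using prm_cancel[OF P, of a "v ()"] by simp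
  qed (simp add: poly_altdef mult.commute)
  then have "poly g (s m0) \<in> P"
    unfolding poly_altdef by (intro idl_sum prm_idl P idl_mult2) auto
  with assms show False by simp
qed

text \<open>A right inverse found over the polynomial ring specializes to every parameter at which
  its factor \<open>d\<close> stays outside \<open>P\<close>.\<close>

lemma indep_cofinite:
  assumes C: "indep P n k (\<lambda>i c. poly (p i c) (s m0))"
  shows "finite {m. \<not> indep P n k (\<lambda>i c. poly (p i c) (s m))}"
proof -
  \<comment> \<open>The prime ideal of the polynomials that vanish at \<open>s m0\<close> modulo
    \<open>P\<close>; the polynomial rows are independent modulo it.\<close>
  define P' where "P' = {g. poly g (s m0) \<in> P}"
  have P': "prm P'"
    using P unfolding prm_def idl_def P'_def by (auto; blast)
  have "indep P' n k p"
    unfolding indep_def P'_def mem_Collect_eq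
  proof (intro allI impI)
    fix a i assume a: "\<forall>c<n. poly (\<Sum>i<k. a i * p i c) (s m0) \<in> P" and i: "i < k"
    show "poly (a i) (s m0) \<in> P"
      by (rule indepD[OF C _ i]) (use a in \<open>simp add: poly_sum\<close>)
  qed
  from indep_right_inverse[OF P' this] obtain D d where d: "d \<notin> P'"
    and D: "\<And>i j. i < k \<Longrightarrow> j < k \<Longrightarrow> (\<Sum>c<n. p i c * D c j) = (if i = j then d else 0)"
    by blast
  have "indep P n k (\<lambda>i c. poly (p i c) (s m))" if m: "poly d (s m) \<notin> P" for m
    unfolding indep_def
  proof (intro allI impI)
    fix a j assume a: "\<forall>c<n. (\<Sum>i<k. a i * poly (p i c) (s m)) \<in> P" and j: "j < k"
    have "(\<Sum>c<n. (\<Sum>i<k. a i * poly (p i c) (s m)) * poly (D c j) (s m)) \<in> P"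
      by (rule idl_sum[OF prm_idl[OF P]], rule idl_mult2[OF prm_idl[OF P]]) (use a in auto)
    also have "(\<Sum>c<n. (\<Sum>i<k. a i * poly (p i c) (s m)) * poly (D c j) (s m))
      = (\<Sum>i<k. a i * poly (\<Sum>c<n. p i c * D c j) (s m))"
      unfolding poly_sum poly_mult sum_distrib_left sum_distrib_right
      by (subst sum.swap) (simp add: mult_ac)
    also have "\<dots> = (\<Sum>i<k. if i = j then a i * poly d (s m) else 0)"
      by (rule sum.cong) (use D j in auto)
    finally have "a j * poly d (s m) \<in> P" using j by simp
    then show "a j \<in> P" using m P by (auto simp: prm_def)
  qed
  then have "{m. \<not> indep P n k (\<lambda>i c. poly (p i c) (s m))} \<subseteq> {m. poly d (s m) \<in> P}" by blast
  then show ?thesis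
    using poly_cofinite[of d m0] d finite_subset unfolding P'_def by blast
qed

text \<open>The form with coefficients \<open>1, t, ..., t ^ r\<close>. This one-parameter family is
  general enough: by \<open>vandermonde\<close>, what holds for infinitely many of its members holds
  for every \<open>Y k\<close>.\<close>

definition ell :: "'r \<Rightarrow> ('i \<Rightarrow> 'r) \<Rightarrow> ('i \<Rightarrow> 'r)"
  where "ell t m = (\<Sum>k\<le>r. scl (t ^ k) (Y k m))"

lemmas Y_add = module_hom.add[OF linY] and Y_scl = module_hom.scale[OF linY]
  and Y_sum = module_hom.sum[OF linY] and Y_0 = module_hom.zero[OF linY]

lemma lin_ell: "lin (ell t)"
  by (rule linI) (simp_all add: ell_def Y_add Y_scl fm.scale_right_distrib sum.distrib
      fm.scale_sum_right mult.commute)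

lemmas ell_sum = module_hom.sum[OF lin_ell] and ell_0 = module_hom.zero[OF lin_ell]

lemma ell_Y: "ell t (Y k m) = Y k (ell t m)"
  by (simp add: ell_def Y_sum Y_scl Y_commute)

text \<open>The degree \<open>j\<close> part of the graded module generated by \<open>U\<close> in
  degree 0.\<close>

primrec G :: "('i \<Rightarrow> 'r) set \<Rightarrow> nat \<Rightarrow> ('i \<Rightarrow> 'r) set"
  where "G U 0 = U"
  | "G U (Suc j) = fm.span (\<Union>k\<le>r. Y k ` G U j)"

lemma Y_G: "k \<le> r \<Longrightarrow> m \<in> G U j \<Longrightarrow> Y k m \<in> G U (Suc j)"
  by (auto intro: fm.span_base)

lemma subspace_G: "fm.subspace U \<Longrightarrow> fm.subspace (G U j)"
  by (cases j) auto

lemma ell_G: "fm.subspace U \<Longrightarrow> m \<in> G U j \<Longrightarrow> ell t m \<in> G U (Suc j)"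
  unfolding ell_def by (intro fm.subspace_sum fm.subspace_scale subspace_G Y_G) auto

lemma G_ell: "G (ell t ` U) j = ell t ` G U j"
  by (induction j) (simp_all add: image_UN image_image ell_Y flip: module_hom.span_image[OF lin_ell])

text \<open>One degree below \<open>G U d\<close>; for \<open>d = 0\<close> this is degree -1, where
  the module vanishes.\<close>

definition B :: "('i \<Rightarrow> 'r) set \<Rightarrow> nat \<Rightarrow> ('i \<Rightarrow> 'r) set"
  where "B U d = (case d of 0 \<Rightarrow> {0} | Suc j \<Rightarrow> G U j)"

lemma ell_B: "fm.subspace U \<Longrightarrow> m \<in> B U d \<Longrightarrow> ell t m \<in> G U d"
  by (cases d) (auto simp: B_def ell_0 fm.subspace_0 simp del: G.simps(2) intro: ell_G)

lemma B_ell: "B (ell t ` U) d = ell t ` B U d"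
  by (cases d) (auto simp: B_def ell_0 G_ell)

text \<open>If multiplication by a general form lowers the rank, the induction hypothesis applies to \<open>ell s ` U\<close>:
  the images of all general forms then coincide, so that they contain the images of all \<open>Y k\<close>.\<close>

lemma green:
  fixes \<psi> :: "('i \<Rightarrow> 'r) \<Rightarrow> (nat \<Rightarrow> 'r)"
  assumes "fm.subspace U" and \<psi>: "lin \<psi>"
    and "\<And>k C. indep P n k C \<Longrightarrow> (\<And>i. i < k \<Longrightarrow> C i \<in> \<psi> ` G U d) \<Longrightarrow> k \<le> d"
  shows "finite {m. \<not> \<psi> ` G U d \<subseteq> cl P n (\<psi> ` ell (s m) ` B U d)}"
  using assms(1,3)
proof (induction d arbitrary: U)
  case 0
  \<comment> \<open>Rank 0 means that a single vector is already dependent, that is, zero modulo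
    \<open>P\<close>.\<close>
  have "v \<in> cl P n (\<psi> ` ell (s m) ` B U 0)" if "v \<in> \<psi> ` G U 0" for v m
  proof (rule cl_extend[OF P, of _ n 0 "\<lambda>_. v"])
    show "fm.subspace (\<psi> ` ell (s m) ` B U 0)"
      by (simp add: B_def ell_0 module_hom.zero[OF \<psi>])
    show "\<not> indep P n (Suc 0) ((\<lambda>_. v)(0 := v))"
      using 0(2)[of "Suc 0" "(\<lambda>_. v)(0 := v)"] that by fastforce
  qed (auto simp: indep_def)
  then have "{m. \<not> \<psi> ` G U 0 \<subseteq> cl P n (\<psi> ` ell (s m) ` B U 0)} = {}" by blast
  then show ?case by simp
next
  case (Suc d)
  note U = Suc.prems(1)
  have BS: "B U (Suc d) = G U d" by (simp add: B_def)
  have sub: "fm.subspace (\<psi> ` ell t ` G U d)" for t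
    by (intro module_hom.subspace_image[OF \<psi>] module_hom.subspace_image[OF lin_ell] subspace_G U)
  \<comment> \<open>Some form of the family has an image of rank at least \<open>k\<close>. The
    maximal rank \<open>\<rho>\<close> occurs at \<open>m0\<close>; as the entries are polynomials
    in the parameter, it also occurs at all \<open>m\<close> outside a finite set
    \<open>F\<close>.\<close>
  define rk where "rk k \<longleftrightarrow> (\<exists>m C. indep P n k C \<and> (\<forall>i<k. C i \<in> \<psi> ` ell (s m) ` G U d))" for k
  have fin: "finite {k. rk k}"
    by (rule finite_subset[of _ "{..n}"]) (auto simp: rk_def dest: indep_bound[OF P])
  have rk0: "rk 0" by (auto simp: rk_def indep_def)
  define \<rho> where "\<rho> = Max {k. rk k}"
  have \<rho>: "rk \<rho>" and \<rho>_max: "\<And>k. rk k \<Longrightarrow> k \<le> \<rho>"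
    unfolding \<rho>_def using Max_in[OF fin] rk0 Max_ge[OF fin] by auto
  from \<rho> obtain m0 C where C: "indep P n \<rho> C" "\<forall>i<\<rho>. C i \<in> \<psi> ` ell (s m0) ` G U d"
    unfolding rk_def by blast
  have "\<forall>i. \<exists>x. i < \<rho> \<longrightarrow> x \<in> G U d \<and> C i = \<psi> (ell (s m0) x)" using C(2) by blast
  from choice[OF this] obtain u where u: "\<And>i. i < \<rho> \<Longrightarrow> u i \<in> G U d \<and> C i = \<psi> (ell (s m0) (u i))"
    by blast
  define p where "p i c = (\<Sum>k\<le>r. monom (\<psi> (Y k (u i)) c) k)" for i c
  have p: "poly (p i c) t = \<psi> (ell t (u i)) c" for i c t
    by (simp add: p_def poly_sum poly_monom ell_def module_hom.sum[OF \<psi>] module_hom.scale[OF \<psi>] mult.commute)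
  define F where "F = {m. \<not> indep P n \<rho> (\<lambda>i. \<psi> (ell (s m) (u i)))}"
  have "indep P n \<rho> (\<lambda>i c. poly (p i c) (s m0))"
    using C(1) u unfolding indep_def p by simp
  from indep_cofinite[OF this] have F: "finite F" by (simp add: p F_def)
  have "\<psi> ` G U (Suc d) \<subseteq> cl P n (\<psi> ` ell (s m) ` G U d)" if m: "m \<notin> F" for m
  proof (cases "\<rho> \<le> d")
    case False
    \<comment> \<open>Here \<open>\<rho>\<close> already exceeds \<open>d\<close>, so by the rank
      bound no vector in degree \<open>Suc d\<close> is independent of the image.\<close>
    show ?thesis
    proof
      fix v assume v: "v \<in> \<psi> ` G U (Suc d)"
      show "v \<in> cl P n (\<psi> ` ell (s m) ` G U d)"
      proof (rule cl_extend[OF P sub, of _ \<rho>])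
        show "indep P n \<rho> (\<lambda>i. \<psi> (ell (s m) (u i)))" using m by (simp add: F_def)
        show "\<not> indep P n (Suc \<rho>) ((\<lambda>i. \<psi> (ell (s m) (u i)))(\<rho> := v))"
        proof
          assume *: "indep P n (Suc \<rho>) ((\<lambda>i. \<psi> (ell (s m) (u i)))(\<rho> := v))"
          have "Suc \<rho> \<le> Suc d"
            by (rule Suc.prems(2)[OF *])
              (use v u ell_G[OF U] in \<open>auto simp: less_Suc_eq simp del: G.simps\<close>)
          with False show False by simp
        qed
      qed (use u in auto)
    qed
  next
    case True
    \<comment> \<open>The image of \<open>U\<close> under \<open>ell (s m)\<close> generates in
      degree \<open>d\<close> a module of rank at most \<open>\<rho> \<le> d\<close>, so the
      induction hypothesis applies to it.\<close>
    define F' where "F' = {m'. \<not> \<psi> ` G (ell (s m) ` U) d \<subseteq> cl P n (\<psi> ` ell (s m') ` B (ell (s m) ` U) d)}"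
    have F': "finite F'"
      unfolding F'_def
    proof (rule Suc.IH)
      show "fm.subspace (ell (s m) ` U)" by (rule module_hom.subspace_image[OF lin_ell U])
      fix k C assume "indep P n k C" "\<And>i. i < k \<Longrightarrow> C i \<in> \<psi> ` G (ell (s m) ` U) d"
      then have "rk k" unfolding rk_def G_ell by blast
      then show "k \<le> d" using \<rho>_max[of k] True by simp
    qed
    let ?K = "cl P n (\<psi> ` ell (s m) ` G U d)"
    have K: "fm.subspace ?K" by (rule subspace_cl[OF P sub])
    have *: "\<psi> (ell (s m') x) \<in> ?K" if m': "m' \<notin> F'" and x: "x \<in> G U d" for m' x
    proof (rule cl_extend[OF P sub, of _ \<rho>])
      show "indep P n \<rho> (\<lambda>i. \<psi> (ell (s m) (u i)))" using m by (simp add: F_def)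
      show "\<not> indep P n (Suc \<rho>) ((\<lambda>i. \<psi> (ell (s m) (u i)))(\<rho> := \<psi> (ell (s m') x)))"
      proof
        let ?C = "(\<lambda>i. \<psi> (ell (s m) (u i)))(\<rho> := \<psi> (ell (s m') x))"
        assume C: "indep P n (Suc \<rho>) ?C"
        \<comment> \<open>As the forms commute, the induction hypothesis places the image under
          \<open>ell (s m)\<close> inside the closure of that under \<open>ell (s m')\<close>. An
          additional independent vector would then make the rank at \<open>m'\<close> larger than
          \<open>\<rho>\<close>.\<close>
        have sub': "\<psi> ` ell (s m) ` G U d \<subseteq> cl P n (\<psi> ` ell (s m') ` G U d)"
        proof -
          have "\<psi> ` ell (s m) ` G U d \<subseteq> cl P n (\<psi> ` ell (s m') ` B (ell (s m) ` U) d)"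
            using m' unfolding F'_def G_ell by blast
          also have "\<dots> \<subseteq> cl P n (\<psi> ` ell (s m') ` G U d)"
            by (intro cl_mono image_mono) (auto simp: B_ell ell_B[OF U])
          finally show ?thesis .
        qed
        have "?C i \<in> cl P n (\<psi> ` ell (s m') ` G U d)" if "i < Suc \<rho>" for i
        proof (cases "i = \<rho>")
          case True
          then show ?thesis using x by (auto intro!: subsetD[OF cl_superset[OF P]])
        next
          case False
          then show ?thesis using u[of i] that sub' by auto
        qed
        from indep_cl[OF P C this] have "rk (Suc \<rho>)" unfolding rk_def by blast
        then show False using \<rho>_max by fastforce
      qed
    qed (use u in auto)
    \<comment> \<open>\<open>?K\<close> contains the images under infinitely many
      \<open>ell (s m')\<close>, hence those under the single variables.\<close>
    have Y: "\<psi> (Y k x) \<in> ?K" if "k \<le> r" "x \<in> G U d" for k x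
    proof (rule vandermonde[OF K])
      show "infinite (- F')" using F' by simp
      show "(\<Sum>k\<le>r. scl (s m' ^ k) (\<psi> (Y k x))) \<in> ?K" if "m' \<in> - F'" for m'
        using *[of m' x] that \<open>x \<in> G U d\<close>
        by (simp add: ell_def module_hom.sum[OF \<psi>] module_hom.scale[OF \<psi>])
    qed (use that cl_cancel[OF P] in auto)
    show ?thesis
    proof
      fix v assume "v \<in> \<psi> ` G U (Suc d)"
      then obtain x where x: "x \<in> fm.span (\<Union>k\<le>r. Y k ` G U d)" "v = \<psi> x" by auto
      show "v \<in> ?K" unfolding x(2) by (rule lin_span_into[OF \<psi> K _ x(1)]) (use Y in auto)
    qed
  qed
  then have "{m. \<not> \<psi> ` G U (Suc d) \<subseteq> cl P n (\<psi> ` ell (s m) ` B U (Suc d))} \<subseteq> F"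
    unfolding BS by blast
  then show ?case using F finite_subset by blast
qed

end

section \<open>Polynomial vectors and their coordinates at a prime\<close>

type_synonym 'r vect = "nat \<times> nat multiset \<Rightarrow> 'r"

definition mons :: "nat \<Rightarrow> nat \<Rightarrow> nat \<Rightarrow> (nat \<times> nat multiset) set"
  where "mons p r t = {(j, u). j \<in> {1..p} \<and> set_mset u \<subseteq> {..r} \<and> size u = t}"

lemma finite_mons: "finite (mons p r t)"
proof -
  have "{u. set_mset u \<subseteq> {..r} \<and> size u = t} \<subseteq> mset ` {xs. set xs \<subseteq> {..r} \<and> length xs = t}"
  proof
    fix u assume "u \<in> {u. set_mset u \<subseteq> {..r} \<and> size u = t}"
    moreover obtain xs where "mset xs = u" using ex_mset by blast
    ultimately show "u \<in> mset ` {xs. set xs \<subseteq> {..r} \<and> length xs = t}" by force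
  qed
  then have "finite {u. set_mset u \<subseteq> {..r} \<and> size u = t}"
    by (rule finite_subset) (intro finite_imageI finite_lists_length_eq finite_atMost)
  then have "finite ({1..p} \<times> {u. set_mset u \<subseteq> {..r} \<and> size u = t})" by blast
  then show ?thesis by (rule finite_subset[rotated]) (auto simp: mons_def)
qed

definition part :: "nat \<Rightarrow> nat \<Rightarrow> nat \<Rightarrow> ('r::comm_ring_1) vect set"
  where "part p r t = {m. \<forall>i. i \<notin> mons p r t \<longrightarrow> m i = 0}"

lemma partD: "m \<in> part p r t \<Longrightarrow> m (j, u) \<noteq> 0 \<Longrightarrow> j \<in> {1..p} \<and> set_mset u \<subseteq> {..r} \<and> size u = t"
  unfolding part_def mons_def by blast

lemma partI: "(\<And>j u. m (j, u) \<noteq> 0 \<Longrightarrow> j \<in> {1..p} \<and> set_mset u \<subseteq> {..r} \<and> size u = t) \<Longrightarrow> m \<in> part p r t"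
  unfolding part_def mons_def by fast

lemma subspace_part: "fm.subspace (part p r t)"
  by (rule fm.subspaceI) (auto simp: part_def)

text \<open>Multiplication by the variable \<open>X_i\<close>, on coefficients.\<close>

definition shift :: "nat \<Rightarrow> ('r::comm_ring_1) vect \<Rightarrow> nat \<times> nat multiset \<Rightarrow> 'r"
  where "shift i m = (\<lambda>(j, u). if i \<in># u then m (j, u - {#i#}) else 0)"

text \<open>The coefficient of \<open>X\<^sub>i\<close> when every monomial is written as its largest variable times the rest.\<close>

definition lead :: "nat \<Rightarrow> ('r::comm_ring_1) vect \<Rightarrow> nat \<times> nat multiset \<Rightarrow> 'r"
  where "lead i m = (\<lambda>(j, u). if \<forall>k\<in>#u. k \<le> i then m (j, add_mset i u) else 0)"

lemma lin_shift: "lin (shift i)"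
  by (rule linI) (auto simp: shift_def fun_eq_iff)

lemma lin_lead: "lin (lead i)"
  by (rule linI) (auto simp: lead_def fun_eq_iff)

lemma shift_commute: "shift i (shift k m) = shift k (shift i m)"
proof
  fix x :: "nat \<times> nat multiset"
  obtain j u where x: "x = (j, u)" by (cases x)
  have "(i \<in># u \<and> k \<in># u - {#i#}) = (k \<in># u \<and> i \<in># u - {#k#})"
    by (metis diff_single_trivial diff_union_swap2 in_diffD insert_DiffM insert_noteq_member union_single_eq_member)
  moreover have "u - {#i#} - {#k#} = u - {#k#} - {#i#}"
    by (simp only: diff_diff_add add.commute)
  ultimately show "shift i (shift k m) x = shift k (shift i m) x"
    by (auto simp: shift_def x)
qed

lemma shift_part:
  assumes "i \<le> r" "m \<in> part p r t"
  shows "shift i m \<in> part p r (Suc t)"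
proof (rule partI)
  fix j u assume "shift i m (j, u) \<noteq> 0"
  then have i: "i \<in># u" and "m (j, u - {#i#}) \<noteq> 0" by (auto simp: shift_def split: if_splits)
  from partD[OF assms(2) this(2)] i obtain v where "u = add_mset i v" "j \<in> {1..p}" "set_mset v \<subseteq> {..r}" "size v = t"
    by (metis insert_DiffM)
  then show "j \<in> {1..p} \<and> set_mset u \<subseteq> {..r} \<and> size u = Suc t"
    using assms(1) by auto
qed

lemma lead_part:
  assumes "m \<in> part p r (Suc t)"
  shows "lead i m \<in> part p r t"
proof (rule partI)
  fix j u assume "lead i m (j, u) \<noteq> 0"
  then have "m (j, add_mset i u) \<noteq> 0" by (auto simp: lead_def split: if_splits)
  from partD[OF assms this] show "j \<in> {1..p} \<and> set_mset u \<subseteq> {..r} \<and> size u = t" by auto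
qed

lemma shift_lead: "shift i (lead i m) (j, u) = (if u \<noteq> {#} \<and> i = Max (set_mset u) then m (j, u) else 0)"
proof -
  have "(i \<in># u \<and> (\<forall>k\<in>#u - {#i#}. k \<le> i)) \<longleftrightarrow> u \<noteq> {#} \<and> i = Max (set_mset u)"
  proof
    assume *: "i \<in># u \<and> (\<forall>k\<in>#u - {#i#}. k \<le> i)"
    have "k \<le> i" if "k \<in># u" for k
      using * that by (metis insert_DiffM insert_iff nle_le set_mset_add_mset_insert)
    then show "u \<noteq> {#} \<and> i = Max (set_mset u)"
      using * by (auto intro!: Max_eqI[symmetric])
  next
    assume *: "u \<noteq> {#} \<and> i = Max (set_mset u)"
    then have "i \<in># u" "\<forall>k\<in>#u. k \<le> i" by auto
    then show "i \<in># u \<and> (\<forall>k\<in>#u - {#i#}. k \<le> i)" by (auto dest: in_diffD)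
  qed
  then show ?thesis by (auto simp: shift_def lead_def)
qed

lemma sum_shift_lead:
  assumes m: "m \<in> part p r t"
  shows "(\<Sum>l\<in>{l. l \<le> r \<and> Q l}. shift l (lead l m)) (j, u)
    = (if u \<noteq> {#} \<and> Q (Max (set_mset u)) then m (j, u) else 0)"
proof -
  have "Max (set_mset u) \<le> r" if "u \<noteq> {#}" "m (j, u) \<noteq> 0"
    using partD[OF m that(2)] that(1) by auto
  moreover have "shift l (lead l m) (j, u) = (if l = Max (set_mset u) then if u \<noteq> {#} then m (j, u) else 0 else 0)" for l
    by (simp add: shift_lead)
  moreover have "finite {l. l \<le> r \<and> Q l}" by simp
  ultimately show ?thesis by auto
qed

text \<open>A monomial of positive degree has exactly one largest variable. The quotients
  \<open>lead i m\<close> depend linearly on \<open>m\<close>, so maps in the next degree can be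
  defined through them.\<close>

lemma part_decomp:
  assumes m: "m \<in> part p r (Suc t)"
  shows "m = (\<Sum>i\<le>r. shift i (lead i m))"
proof
  fix x :: "nat \<times> nat multiset"
  obtain j u where x: "x = (j, u)" by (cases x)
  have *: "m (j, {#}) = 0" using partD[OF m, of j "{#}"] by auto
  show "m x = (\<Sum>i\<le>r. shift i (lead i m)) x"
    using sum_shift_lead[OF m, of "\<lambda>_. True" j u] * by (auto simp: x atMost_def)
qed

text \<open>A monomial divisible by \<open>X_k\<close> has no smaller largest variable. With the
  next two lemmas this describes how multiplication by \<open>X_k\<close> affects the sorting by
  largest variables.\<close>

lemma lead_shift_less: "i < k \<Longrightarrow> lead i (shift k m) = 0"
  by (auto simp: lead_def shift_def fun_eq_iff)

lemma lead_shift_greater: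
  assumes "k < i"
  shows "lead i (shift k m) = shift k (lead i m)"
proof
  fix x :: "nat \<times> nat multiset"
  obtain j u where x: "x = (j, u)" by (cases x)
  show "lead i (shift k m) x = shift k (lead i m) x"
  proof (cases "k \<in># u")
    case True
    then obtain v where "u = add_mset k v" by (metis insert_DiffM)
    then show ?thesis using assms by (simp add: x lead_def shift_def add_mset_commute)
  qed (use assms in \<open>auto simp: x lead_def shift_def\<close>)
qed

text \<open>In \<open>X_k m\<close> the largest variable is \<open>k\<close> exactly for the terms
  of \<open>m\<close> with all variables at most \<open>k\<close>; the remaining terms are
  subtracted.\<close>

lemma lead_shift_same:
  assumes m: "m \<in> part p r t"
  shows "lead k (shift k m) = m - (\<Sum>l\<in>{k<..r}. shift l (lead l m))"
proof
  fix x :: "nat \<times> nat multiset"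
  obtain j u where x: "x = (j, u)" by (cases x)
  have "(\<forall>l\<in>#u. l \<le> k) \<longleftrightarrow> \<not> (u \<noteq> {#} \<and> k < Max (set_mset u))"
    by (cases "u = {#}") (auto simp: not_less)
  moreover have "{k<..r} = {l. l \<le> r \<and> k < l}" by auto
  ultimately show "lead k (shift k m) x = (m - (\<Sum>l\<in>{k<..r}. shift l (lead l m))) x"
    using sum_shift_lead[OF m, of "\<lambda>l. k < l" j u] by (simp add: x lead_def shift_def)
qed

text \<open>\<open>co\<close> computes coordinates, in the localization at \<open>P\<close> of the degree \<open>t\<close> component of the quotient,
  with respect to the basis \<open>e\<close>, up to the unit \<open>\<sigma>\<close>.\<close>

definition is_coord :: "'r::comm_ring_1 set \<Rightarrow> 'r set \<Rightarrow> nat \<Rightarrow> nat \<Rightarrow> nat \<Rightarrow> nat \<Rightarrow> 'r vect set \<Rightarrow>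
    ('r vect \<Rightarrow> nat \<Rightarrow> 'r) \<Rightarrow> (nat \<Rightarrow> 'r vect) \<Rightarrow> 'r \<Rightarrow> bool"
  where "is_coord P J p r n t N co e \<sigma> \<longleftrightarrow> lin co \<and> \<sigma> \<notin> P \<and> (\<forall>b<n. e b \<in> part p r t)
    \<and> (\<forall>m\<in>part p r t. m \<in> N \<longleftrightarrow> (\<forall>b<n. co m b \<in> J))
    \<and> (\<forall>b<n. \<forall>c<n. co (e b) c - (if b = c then \<sigma> else 0) \<in> J)"

lemma is_coordD:
  assumes "is_coord P J p r n t N co e \<sigma>"
  shows "lin co" "\<sigma> \<notin> P" "\<And>b. b < n \<Longrightarrow> e b \<in> part p r t"
    "\<And>m. m \<in> part p r t \<Longrightarrow> m \<in> N \<longleftrightarrow> (\<forall>b<n. co m b \<in> J)"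
    "\<And>b c. b < n \<Longrightarrow> c < n \<Longrightarrow> co (e b) c - (if b = c then \<sigma> else 0) \<in> J"
  using assms unfolding is_coord_def by blast+

definition coord :: "'r::comm_ring_1 set \<Rightarrow> 'r set \<Rightarrow> nat \<Rightarrow> nat \<Rightarrow> nat \<Rightarrow> nat \<Rightarrow> 'r vect set \<Rightarrow> bool"
  where "coord P J p r n t N \<longleftrightarrow> (\<exists>co e \<sigma>. is_coord P J p r n t N co e \<sigma>)"

text \<open>\<open>J\<close> stands for zero in the local ring at \<open>P\<close> and
  \<open>N t\<close> for the relations there in degree \<open>t\<close>; \<open>J_sat\<close> and
  \<open>N_sat\<close> say that both are contracted from the localization.\<close>

locale local_graded =
  fixes P J :: "'r::comm_ring_1 set" and p r :: nat and N :: "nat \<Rightarrow> 'r vect set" and d0 :: nat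
  assumes P: "prm P" and J: "idl J" and JP: "J \<subseteq> P" and J_sat: "s \<notin> P \<Longrightarrow> s * a \<in> J \<Longrightarrow> a \<in> J"
    and subspace_N: "fm.subspace (N t)" and N_part: "N t \<subseteq> part p r t"
    and N_sat: "m \<in> part p r t \<Longrightarrow> s \<notin> P \<Longrightarrow> scl s m \<in> N t \<Longrightarrow> m \<in> N t"
    and N_J: "a \<in> J \<Longrightarrow> m \<in> part p r t \<Longrightarrow> scl a m \<in> N t"
    and N_shift: "i \<le> r \<Longrightarrow> m \<in> N t \<Longrightarrow> shift i m \<in> N (Suc t)"
    and N_gen: "d0 \<le> t \<Longrightarrow> m \<in> N (Suc t) \<Longrightarrow>
      \<exists>s. s \<notin> P \<and> scl s m \<in> fm.span (\<Union>i\<le>r. shift i ` N t)"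

locale local_graded_curve = local_graded P J p r N d0
  for P J :: "'r::comm_ring_1 set" and p r N d0 +
  fixes s :: "nat \<Rightarrow> 'r"
  assumes s: "a \<noteq> b \<Longrightarrow> s a - s b \<notin> P"

sublocale local_graded_curve \<subseteq> rational_curve P s shift r
  by unfold_locales (use P s shift_commute in \<open>auto simp: module_hom.add[OF lin_shift] module_hom.scale[OF lin_shift]
      fm.scale_right_distrib fm.scale_left_distrib\<close>)

context local_graded_curve
begin

lemma G_part: "G (part p r 0) t = part p r t"
proof (induction t)
  case (Suc t)
  show ?case
  proof (intro equalityI subsetI)
    fix m :: "nat \<times> nat multiset \<Rightarrow> 'r" assume m: "m \<in> part p r (Suc t)"
    show "m \<in> G (part p r 0) (Suc t)"
      by (subst part_decomp[OF m], intro fm.subspace_sum subspace_G subspace_part Y_G)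
        (use Suc lead_part[OF m] in auto)
  next
    have "fm.span (\<Union>k\<le>r. shift k ` part p r t) \<subseteq> part p r (Suc t)"
      by (intro fm.span_minimal subspace_part) (auto intro: shift_part)
    then show "m \<in> part p r (Suc t)" if "m \<in> G (part p r 0) (Suc t)" for m
      using that Suc by auto
  qed
qed simp

lemma ell_part: "m \<in> part p r t \<Longrightarrow> ell z m \<in> part p r (Suc t)"
  unfolding ell_def by (intro fm.subspace_sum subspace_part fm.subspace_scale shift_part) auto

lemma ell_N: "m \<in> N t \<Longrightarrow> ell z m \<in> N (Suc t)"
  unfolding ell_def by (intro fm.subspace_sum subspace_N fm.subspace_scale N_shift) auto

text \<open>Write \<open>l\<close> for \<open>ell z\<close>. If the \<open>l f_b\<close> span degree
  \<open>t\<close>, then \<open>X_i l f_b = l (X_i f_b)\<close>, where \<open>X_i f_b\<close> has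
  degree \<open>t\<close> and is again a combination of the \<open>l f_b\<close>; so the
  \<open>l^2 f_b\<close> span degree \<open>t + 1\<close>. The hypothesis on
  \<open>shift i (f b)\<close> admits \<open>f b = 0\<close> when \<open>t = 0\<close>.\<close>

lemma span_lift:
  assumes span: "\<And>m. m \<in> part p r t \<Longrightarrow> \<exists>a. scl \<eta> m - (\<Sum>b<n. scl (a b) (ell z (f b))) \<in> N t"
    and f: "\<And>b i. b < n \<Longrightarrow> i \<le> r \<Longrightarrow> shift i (f b) \<in> part p r t"
    and m: "m \<in> part p r (Suc t)"
  shows "\<exists>a. scl (\<eta>\<^sup>2) m - (\<Sum>b<n. scl (a b) (ell z (ell z (f b)))) \<in> N (Suc t)"
proof -
  have "\<forall>i. \<exists>a. scl \<eta> (lead i m) - (\<Sum>b<n. scl (a b) (ell z (f b))) \<in> N t"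
    using span lead_part[OF m] by blast
  from choice[OF this] obtain a where a: "\<And>i. scl \<eta> (lead i m) - (\<Sum>b<n. scl (a i b) (ell z (f b))) \<in> N t"
    by blast
  define w where "w = (\<Sum>i\<le>r. \<Sum>b<n. scl (a i b) (shift i (f b)))"
  have w: "w \<in> part p r t"
    unfolding w_def by (intro fm.subspace_sum subspace_part fm.subspace_scale f) auto
  from span[OF w] obtain a' where a': "scl \<eta> w - (\<Sum>b<n. scl (a' b) (ell z (f b))) \<in> N t" by blast
  have "(\<Sum>i\<le>r. shift i (scl \<eta> (lead i m) - (\<Sum>b<n. scl (a i b) (ell z (f b))))) \<in> N (Suc t)"
    by (intro fm.subspace_sum subspace_N N_shift a) auto
  also have "(\<Sum>i\<le>r. shift i (scl \<eta> (lead i m) - (\<Sum>b<n. scl (a i b) (ell z (f b)))))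
    = scl \<eta> (\<Sum>i\<le>r. shift i (lead i m)) - ell z w"
    by (simp add: w_def module_hom.diff[OF lin_shift] Y_scl Y_sum ell_sum module_hom.scale[OF lin_ell]
        ell_Y sum_subtractf fm.scale_sum_right)
  also have "(\<Sum>i\<le>r. shift i (lead i m)) = m" using part_decomp[OF m] by simp
  finally have 1: "scl \<eta> m - ell z w \<in> N (Suc t)" .
  have 2: "scl \<eta> (ell z w) - (\<Sum>b<n. scl (a' b) (ell z (ell z (f b)))) \<in> N (Suc t)"
    using ell_N[OF a', of z] by (simp add: module_hom.diff[OF lin_ell] module_hom.scale[OF lin_ell] ell_sum)
  have "scl \<eta> (scl \<eta> m - ell z w) + (scl \<eta> (ell z w) - (\<Sum>b<n. scl (a' b) (ell z (ell z (f b))))) \<in> N (Suc t)"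
    by (intro fm.subspace_add fm.subspace_scale subspace_N 1 2)
  then have "scl (\<eta>\<^sup>2) m - (\<Sum>b<n. scl (a' b) (ell z (ell z (f b)))) \<in> N (Suc t)"
    by (simp add: fm.scale_right_diff_distrib power2_eq_square)
  then show ?thesis by blast
qed

end

section \<open>Persistence at a prime\<close>

context local_graded_curve
begin

text \<open>The coordinate vectors that vanish over the local ring; equations between coordinates
  will hold modulo \<open>VJ n\<close>.\<close>

definition VJ :: "nat \<Rightarrow> (nat \<Rightarrow> 'r) set"
  where "VJ n = {v. \<forall>c<n. v c \<in> J}"

lemma subspace_VJ: "fm.subspace (VJ n)"
  by (rule fm.subspaceI) (use J in \<open>auto simp: VJ_def intro: idl_0 idl_add idl_mult\<close>)

lemma VJ_sat: "a \<notin> P \<Longrightarrow> scl a v \<in> VJ n \<Longrightarrow> v \<in> VJ n"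
  using J_sat unfolding VJ_def by auto

lemma VJ_cong: "v \<in> VJ n \<Longrightarrow> (\<And>c. c < n \<Longrightarrow> v c = w c) \<Longrightarrow> w \<in> VJ n"
  unfolding VJ_def by auto

lemmas VJ_intros = fm.subspace_add[OF subspace_VJ] fm.subspace_diff[OF subspace_VJ]
  fm.subspace_scale[OF subspace_VJ] fm.subspace_sum[OF subspace_VJ] fm.subspace_neg[OF subspace_VJ]

definition vmul :: "nat \<Rightarrow> (nat \<Rightarrow> nat \<Rightarrow> 'r) \<Rightarrow> (nat \<Rightarrow> 'r) \<Rightarrow> nat \<Rightarrow> 'r"
  where "vmul n D v = (\<Sum>b<n. scl (v b) (D b))"

lemma lin_vmul: "lin (vmul n D)"
  by (rule linI) (simp_all add: vmul_def fm.scale_left_distrib sum.distrib fm.scale_sum_right)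

lemma vmul_VJ: "v \<in> VJ n \<Longrightarrow> vmul n D v \<in> VJ n"
  unfolding VJ_def vmul_def mem_Collect_eq fun_sum_apply scl_apply
  by (intro allI impI idl_sum[OF J] idl_mult2[OF J]) auto

text \<open>By Green's theorem some form maps degree \<open>d - 1\<close> onto degree
  \<open>d\<close> over the residue field. A left inverse of the matrix of \<open>n\<close>
  independent images turns them into exact multiples of the unit vectors.\<close>

lemma green_coord:
  assumes "n \<le> d" and co: "lin co" and \<sigma>: "\<sigma> \<notin> P" and e: "\<And>b. b < n \<Longrightarrow> e b \<in> part p r d"
    and coe: "\<And>b c. b < n \<Longrightarrow> c < n \<Longrightarrow> co (e b) c - (if b = c then \<sigma> else 0) \<in> J"
  obtains z u \<delta> where "\<delta> \<notin> P" "\<And>b. b < n \<Longrightarrow> u b \<in> B (part p r 0) d"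
    "\<And>b c. b < n \<Longrightarrow> c < n \<Longrightarrow> co (ell z (u b)) c = (if b = c then \<delta> else 0)"
proof -
  have "finite {m. \<not> co ` G (part p r 0) d \<subseteq> cl P n (co ` ell (s m) ` B (part p r 0) d)}"
  proof (rule green[OF subspace_part co])
    \<comment> \<open>Here \<open>n \<le> d\<close> enters: coordinate vectors of length
      \<open>n\<close> have rank at most \<open>n\<close>.\<close>
    fix k C assume "indep P n k C"
    from indep_bound[OF P this] \<open>n \<le> d\<close> show "k \<le> d" by simp
  qed
  then have "\<exists>m. m \<notin> {m. \<not> co ` G (part p r 0) d \<subseteq> cl P n (co ` ell (s m) ` B (part p r 0) d)}"
    by (rule ex_new_if_finite[OF infinite_UNIV_nat])
  then obtain z where z: "co ` part p r d \<subseteq> cl P n (co ` ell z ` B (part p r 0) d)"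
    by (auto simp: G_part)
  note P_ = prm_idl[OF P]
  have "indep P n n (\<lambda>b. co (e b))"
    unfolding indep_def
  proof (intro allI impI)
    fix a i assume a: "\<forall>c<n. (\<Sum>b<n. a b * co (e b) c) \<in> P" and i: "i < n"
    have "(\<Sum>b<n. a b * co (e b) i) - (\<Sum>b<n. a b * (co (e b) i - (if b = i then \<sigma> else 0))) \<in> P"
      by (rule idl_diff[OF P_], use a i in blast)
        (rule idl_sum[OF P_], rule idl_mult[OF P_], rule subsetD[OF JP coe], use i in auto)
    also have "(\<Sum>b<n. a b * co (e b) i) - (\<Sum>b<n. a b * (co (e b) i - (if b = i then \<sigma> else 0)))
      = (\<Sum>b<n. if b = i then \<sigma> * a b else 0)"
      unfolding sum_subtractf[symmetric] by (rule sum.cong) (auto simp: algebra_simps)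
    finally show "a i \<in> P" using prm_cancel[OF P \<sigma>] i by simp
  qed
  from indep_cl[OF P this, of "co ` ell z ` B (part p r 0) d"] obtain C where C: "indep P n n C"
    "\<forall>b<n. C b \<in> co ` ell z ` B (part p r 0) d" using z e by blast
  have "\<forall>b. \<exists>x. b < n \<longrightarrow> x \<in> B (part p r 0) d \<and> C b = co (ell z x)" using C(2) by blast
  from choice[OF this] obtain x where x: "\<And>b. b < n \<Longrightarrow> x b \<in> B (part p r 0) d"
    and Cx: "\<And>b. b < n \<Longrightarrow> C b = co (ell z (x b))" by blast
  have "indep P n n (\<lambda>b. co (ell z (x b)))"
    using C(1) Cx unfolding indep_def by simp
  from indep_two_sided_inverse[OF P this] obtain D \<delta> where \<delta>: "\<delta> \<notin> P"
    and D: "\<And>i j. i < n \<Longrightarrow> j < n \<Longrightarrow> (\<Sum>c<n. D i c * co (ell z (x c)) j) = (if i = j then \<delta> else 0)" by blast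
  define u where "u b = (\<Sum>c<n. scl (D b c) (x c))" for b
  have "fm.subspace (B (part p r 0) d)"
    by (cases d) (simp_all add: B_def subspace_G subspace_part del: G.simps)
  then have "u b \<in> B (part p r 0) d" for b
    unfolding u_def by (intro fm.subspace_sum fm.subspace_scale x) auto
  moreover have "co (ell z (u b)) c = (if b = c then \<delta> else 0)" if "b < n" "c < n" for b c
    using D[OF that] by (simp add: u_def module_hom.sum[OF co] module_hom.scale[OF co] module_hom.scale[OF lin_ell] ell_sum)
  ultimately show thesis using that \<delta> by blast
qed

text \<open>With \<open>l = ell z\<close>, the coordinates of \<open>m\<close> in degree
  \<open>d + 2\<close> are those of \<open>\<beta>^2 l^-2 m\<close>. For \<open>m\<close> the sum of
  the \<open>X_i m_i\<close> they are computed as the sum of the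
  \<open>(\<beta> l^-1 X_i) (\<beta> l^-1 m_i)\<close>, and the basis consists of the
  \<open>l^2 E_b\<close>.\<close>

theorem coord_step:
  assumes "n \<le> d" and d: "d0 \<le> Suc d" and "coord P J p r n d (N d)" "coord P J p r n (Suc d) (N (Suc d))"
  shows "coord P J p r n (Suc (Suc d)) (N (Suc (Suc d)))"
proof -
  obtain co e \<sigma> where ic: "is_coord P J p r n d (N d) co e \<sigma>" using assms(3) unfolding coord_def by blast
  note co = is_coordD(1)[OF ic] and \<sigma> = is_coordD(2)[OF ic] and e = is_coordD(3)[OF ic]
    and coN = is_coordD(4)[OF ic] and coe = is_coordD(5)[OF ic]
  obtain co' e' \<sigma>' where ic': "is_coord P J p r n (Suc d) (N (Suc d)) co' e' \<sigma>'"
    using assms(4) unfolding coord_def by blast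
  note co' = is_coordD(1)[OF ic'] and \<sigma>' = is_coordD(2)[OF ic'] and e' = is_coordD(3)[OF ic']
    and coN' = is_coordD(4)[OF ic'] and coe' = is_coordD(5)[OF ic']
  obtain z u \<delta> where \<delta>: "\<delta> \<notin> P" and u: "\<And>b. b < n \<Longrightarrow> u b \<in> B (part p r 0) d"
    and cou: "\<And>b c. b < n \<Longrightarrow> c < n \<Longrightarrow> co (ell z (u b)) c = (if b = c then \<delta> else 0)"
    by (rule green_coord[OF \<open>n \<le> d\<close> co \<sigma> e coe]; (assumption | (rule that; assumption)))
  note lins = hom[OF co] hom[OF co'] hom[OF lin_shift] hom[OF lin_ell] hom[OF lin_vmul] hom[OF lin_lead]
  have \<delta>2: "\<delta>\<^sup>2 \<notin> P" using prm_power[OF P \<delta>] .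
  \<comment> \<open>A basis in degree \<open>d\<close> up to \<open>\<delta>\<close>. Its elements
    are multiples of \<open>ell z\<close>, past which the variables can be moved.\<close>
  define E where "E b = ell z (u b)" for b
  have E: "E b \<in> part p r d" if "b < n" for b
    using ell_B[OF subspace_part u[OF that]] by (simp add: E_def G_part)
  have shift_u: "shift i (u b) \<in> part p r d" if "b < n" "i \<le> r" for i b
    using u[OF that(1)] shift_part[OF that(2)]
    by (cases d) (auto simp: B_def G_part Y_0 fm.subspace_0[OF subspace_part])
  have S0: "scl \<delta> m - (\<Sum>b<n. scl (co m b) (E b)) \<in> N d" if m: "m \<in> part p r d" for m
  proof -
    have "co (scl \<delta> m - (\<Sum>b<n. scl (co m b) (E b))) c = 0" if c: "c < n" for c
    proof -
      have "(\<Sum>b<n. co m b * co (E b) c) = (\<Sum>b<n. if b = c then co m b * \<delta> else 0)"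
        by (rule sum.cong) (use cou c in \<open>auto simp: E_def\<close>)
      then show ?thesis using c by (simp add: lins mult.commute)
    qed
    moreover have "scl \<delta> m - (\<Sum>b<n. scl (co m b) (E b)) \<in> part p r d"
      by (intro fm.subspace_diff fm.subspace_scale fm.subspace_sum subspace_part m E) auto
    ultimately show ?thesis using coN idl_0[OF J] by simp
  qed
  have S1: "\<exists>a. scl (\<delta>\<^sup>2) m - (\<Sum>b<n. scl (a b) (ell z (E b))) \<in> N (Suc d)"
    if "m \<in> part p r (Suc d)" for m
    unfolding E_def by (rule span_lift[OF _ shift_u that]) (use S0 E_def in auto)
  have S2: "\<exists>a. scl ((\<delta>\<^sup>2)\<^sup>2) m - (\<Sum>b<n. scl (a b) (ell z (ell z (E b)))) \<in> N (Suc (Suc d))"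
    if "m \<in> part p r (Suc (Suc d))" for m
    by (rule span_lift[OF S1 _ that]) (auto intro: E shift_part)

  \<comment> \<open>By \<open>S1\<close> the \<open>n\<close> vectors \<open>ell z (E b)\<close>
    span degree \<open>Suc d\<close>, which is free of rank \<open>n\<close>.\<close>
  have "\<exists>D d. d \<notin> P \<and> diag_prod n n (\<lambda>b. co' (ell z (E b))) D d \<and> diag_prod n n D (\<lambda>b. co' (ell z (E b))) d"
  proof (rule spanning_two_sided_inverse[OF P \<delta>2 \<sigma>'])
    show "co' (e' k) j - (if k = j then \<sigma>' else 0) \<in> P" if "k < n" "j < n" for k j
      using subsetD[OF JP coe'[OF that]] .
    fix k assume "k < n"
    then obtain a where a: "scl (\<delta>\<^sup>2) (e' k) - (\<Sum>b<n. scl (a b) (ell z (E b))) \<in> N (Suc d)"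
      using S1 e' by blast
    then have "\<forall>j<n. \<delta>\<^sup>2 * co' (e' k) j - (\<Sum>b<n. a b * co' (ell z (E b)) j) \<in> P"
      using coN' subsetD[OF N_part a] JP by (force simp: lins)
    then show "\<exists>a. \<forall>j<n. \<delta>\<^sup>2 * co' (e' k) j - (\<Sum>b<n. a b * co' (ell z (E b)) j) \<in> P" by (rule exI[of _ a])
  qed
  then obtain D \<beta> where \<beta>: "\<beta> \<notin> P"
    and D: "diag_prod n n (\<lambda>b. co' (ell z (E b))) D \<beta>"
    by (elim exE conjE) (rule that)
  \<comment> \<open>\<open>\<beta>\<close> times the inverse of \<open>ell z\<close>, with values
    written in coordinates relative to \<open>E\<close>.\<close>
  define la where "la m = vmul n D (co' m)" for m
  have lin_la: "lin la"
    unfolding la_def using module_hom_compose[OF co' lin_vmul] by (simp add: o_def)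
  note la = hom[OF lin_la]
  have la_N: "la m \<in> VJ n" if "m \<in> N (Suc d)" for m
    unfolding la_def by (rule vmul_VJ) (use that coN' N_part in \<open>auto simp: VJ_def\<close>)
  have la_ell: "la (ell z (E b)) c = (if b = c then \<beta> else 0)" if "b < n" "c < n" for b c
    using D that by (simp add: la_def vmul_def)
  \<comment> \<open>Row \<open>b\<close> of the matrix of \<open>\<beta> l^-1 X_i\<close> in the
    basis \<open>E\<close>; \<open>act i\<close> applies this matrix. The factors
    \<open>\<delta>\<close> below arise because \<open>co (E b)\<close> is \<open>\<delta>\<close>
    times a unit vector.\<close>
  define \<Xi> where "\<Xi> i b = la (shift i (E b))" for i b
  define act where "act i = vmul n (\<Xi> i)" for i
  have lin_act: "lin (act i)" for i unfolding act_def by (rule lin_vmul)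
  note act = hom[OF lin_act]
  have act_VJ: "v \<in> VJ n \<Longrightarrow> act i v \<in> VJ n" for i v unfolding act_def by (rule vmul_VJ)

  have la_shift: "scl \<delta> (la (shift i m)) - act i (co m) \<in> VJ n" if m: "m \<in> part p r d" and i: "i \<le> r" for i m
    using la_N[OF N_shift[OF i S0[OF m]]] by (simp add: lins la act_def vmul_def \<Xi>_def)
  have la_ell': "scl \<delta> (la (ell z m)) - scl \<beta> (co m) \<in> VJ n" if m: "m \<in> part p r d" for m
  proof (rule VJ_cong[OF la_N[OF ell_N[OF S0[OF m], of z]]])
    fix c assume c: "c < n"
    have "(\<Sum>b<n. co m b * la (ell z (E b)) c) = (\<Sum>b<n. if b = c then co m b * \<beta> else 0)"
      by (rule sum.cong) (use la_ell c in auto)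
    then show "la (ell z (scl \<delta> m - (\<Sum>b<n. scl (co m b) (E b)))) c = (scl \<delta> (la (ell z m)) - scl \<beta> (co m)) c"
      using c by (simp add: lins la mult.commute)
  qed
  \<comment> \<open>\<open>X\<^sub>i X\<^sub>k u = X\<^sub>k X\<^sub>i u\<close> computes both compositions, because the \<open>E b\<close> come from degree \<open>d - 1\<close>\<close>
  have comm: "act i (\<Xi> k b) - act k (\<Xi> i b) \<in> VJ n" if b: "b < n" and i: "i \<le> r" and k: "k \<le> r" for i k b
  proof -
    have 1: "scl \<delta> (act i (\<Xi> k b)) - scl \<beta> (act i (co (shift k (u b)))) \<in> VJ n" if k: "k \<le> r" for i k
      using act_VJ[OF la_ell'[OF shift_u[OF b k]], of i] by (simp add: act \<Xi>_def E_def ell_Y)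
    have 2: "scl \<delta> (la (shift i (shift k (u b)))) - act i (co (shift k (u b))) \<in> VJ n" if "i \<le> r" "k \<le> r" for i k
      using la_shift[OF shift_u[OF b that(2)] that(1)] .
    have "(scl \<delta> (act i (\<Xi> k b)) - scl \<beta> (act i (co (shift k (u b)))))
      - (scl \<delta> (act k (\<Xi> i b)) - scl \<beta> (act k (co (shift i (u b)))))
      - scl \<beta> ((scl \<delta> (la (shift i (shift k (u b)))) - act i (co (shift k (u b))))
         - (scl \<delta> (la (shift k (shift i (u b)))) - act k (co (shift i (u b))))) \<in> VJ n"
      by (intro VJ_intros 1 2 i k)
    then have "scl \<delta> (act i (\<Xi> k b) - act k (\<Xi> i b)) \<in> VJ n"
      by (simp add: shift_commute[of k i] fm.scale_right_diff_distrib algebra_simps)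
    then show ?thesis by (rule VJ_sat[OF \<delta>])
  qed
  have comm': "act i (act k v) - act k (act i v) \<in> VJ n" if i: "i \<le> r" and k: "k \<le> r" for i k v
  proof -
    have "(\<Sum>b<n. scl (v b) (act i (\<Xi> k b) - act k (\<Xi> i b))) \<in> VJ n"
      by (intro VJ_intros comm i k) auto
    moreover have "act i (act k v) = (\<Sum>b<n. scl (v b) (act i (\<Xi> k b)))" for i k
    proof -
      have "act k v = (\<Sum>b<n. scl (v b) (\<Xi> k b))" by (simp add: act_def vmul_def)
      then show ?thesis by (simp add: act)
    qed
    ultimately show ?thesis by (simp add: fm.scale_right_diff_distrib sum_subtractf)
  qed

  \<comment> \<open>Decomposing by largest variables defines a linear map on all vectors. Its
    compatibility with arbitrary products \<open>X_k m\<close> is \<open>co2_shift\<close>, which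
    rests on the commutativity of the \<open>act i\<close>.\<close>
  define co2 where "co2 m = (\<Sum>i\<le>r. act i (la (lead i m)))" for m
  have lin_co2: "lin co2"
    by (rule linI) (simp_all add: co2_def lins la act sum.distrib fm.scale_sum_right)
  note co2 = hom[OF lin_co2]
  have co2_shift: "co2 (shift k m) - act k (la m) \<in> VJ n" if m: "m \<in> part p r (Suc d)" and k: "k \<le> r" for k m
  proof -
    \<comment> \<open>With \<open>w = lead l m\<close> in degree \<open>d\<close>,
      \<open>\<delta>\<close> times the two terms are \<open>act l (act k (co w))\<close> and
      \<open>act k (act l (co w))\<close>.\<close>
    have 1: "act l (la (shift k (lead l m))) - act k (la (shift l (lead l m))) \<in> VJ n" if l: "l \<le> r" for l
    proof -
      note w = lead_part[OF m, of l]
      have "act l (scl \<delta> (la (shift k (lead l m))) - act k (co (lead l m)))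
        - act k (scl \<delta> (la (shift l (lead l m))) - act l (co (lead l m)))
        + (act l (act k (co (lead l m))) - act k (act l (co (lead l m)))) \<in> VJ n"
        by (intro VJ_intros act_VJ la_shift w comm' l k)
      then have "scl \<delta> (act l (la (shift k (lead l m))) - act k (la (shift l (lead l m)))) \<in> VJ n"
        by (simp add: act fm.scale_right_diff_distrib)
      then show ?thesis by (rule VJ_sat[OF \<delta>])
    qed
    have split: "(\<Sum>i\<le>r. g i) = (\<Sum>i<k. g i) + g k + (\<Sum>i\<in>{k<..r}. g i)" for g :: "nat \<Rightarrow> nat \<Rightarrow> 'r"
    proof -
      have "{..r} = insert k ({..<k} \<union> {k<..r})" using k by auto
      moreover have "sum g ({..<k} \<union> {k<..r}) = sum g {..<k} + sum g {k<..r}"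
        by (rule sum.union_disjoint) auto
      ultimately show ?thesis by (simp add: ac_simps)
    qed
    \<comment> \<open>Below \<open>k\<close> the quotients vanish, above \<open>k\<close> they
      commute with \<open>X_k\<close>, and at \<open>k\<close> the terms with a larger largest
      variable are missing; the last two contributions cancel by \<open>1\<close>.\<close>
    have "co2 (shift k m) = (\<Sum>i<k. act i (la (lead i (shift k m)))) + act k (la (lead k (shift k m)))
      + (\<Sum>i\<in>{k<..r}. act i (la (lead i (shift k m))))"
      unfolding co2_def by (rule split)
    also have "(\<Sum>i<k. act i (la (lead i (shift k m)))) = 0"
      by (rule sum.neutral) (simp add: lead_shift_less module_hom.zero[OF lin_act] module_hom.zero[OF lin_la])
    also have "(\<Sum>i\<in>{k<..r}. act i (la (lead i (shift k m)))) = (\<Sum>i\<in>{k<..r}. act i (la (shift k (lead i m))))"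
      by (rule sum.cong) (simp_all add: lead_shift_greater)
    also have "act k (la (lead k (shift k m))) = act k (la m) - (\<Sum>i\<in>{k<..r}. act k (la (shift i (lead i m))))"
      by (simp add: lead_shift_same[OF m] la act)
    finally have "co2 (shift k m) - act k (la m)
      = (\<Sum>l\<in>{k<..r}. act l (la (shift k (lead l m))) - act k (la (shift l (lead l m))))"
      by (simp add: fun_eq_iff sum_subtractf)
    then show ?thesis using 1 by (auto intro!: fm.subspace_sum[OF subspace_VJ])
  qed
  have co2_N: "co2 m \<in> VJ n" if m: "m \<in> N (Suc (Suc d))" for m
  proof -
    \<comment> \<open>Up to the denominator \<open>q\<close>, relations in this degree are
      combinations of \<open>X_i x\<close> with \<open>x\<close> a relation one degree below, where
      \<open>la\<close> vanishes.\<close>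
    obtain q where q: "q \<notin> P" and qm: "scl q m \<in> fm.span (\<Union>i\<le>r. shift i ` N (Suc d))"
      using N_gen[OF d m] by blast
    have "co2 (shift i x) \<in> VJ n" if i: "i \<le> r" and x: "x \<in> N (Suc d)" for i x
    proof -
      have "(co2 (shift i x) - act i (la x)) + act i (la x) \<in> VJ n"
        by (intro VJ_intros co2_shift act_VJ la_N x subsetD[OF N_part x] i)
      then show ?thesis by simp
    qed
    then have "co2 (scl q m) \<in> VJ n"
      by (intro lin_span_into[OF lin_co2 subspace_VJ _ qm]) auto
    then have "scl q (co2 m) \<in> VJ n" by (simp only: co2)
    then show ?thesis by (rule VJ_sat[OF q])
  qed
  define EE where "EE b = ell z (ell z (E b))" for b
  have EE: "EE b \<in> part p r (Suc (Suc d))" if "b < n" for b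
    unfolding EE_def using that by (intro ell_part E)
  have co2_EE: "co2 (EE b) c - (if b = c then \<beta>\<^sup>2 else 0) \<in> J" if b: "b < n" and c: "c < n" for b c
  proof -
    let ?v = "la (ell z (E b))"
    have "(\<Sum>k\<le>r. scl (z ^ k) (co2 (shift k (ell z (E b))) - act k ?v)) \<in> VJ n"
      by (intro VJ_intros co2_shift ell_part E b) auto
    then have *: "co2 (EE b) - (\<Sum>k\<le>r. scl (z ^ k) (act k ?v)) \<in> VJ n"
      by (simp add: EE_def ell_def co2 fm.scale_right_diff_distrib sum_subtractf)
    have "act k ?v = scl \<beta> (\<Xi> k b)" for k
    proof
      fix j
      have "(\<Sum>i<n. ?v i * \<Xi> k i j) = (\<Sum>i<n. if i = b then \<beta> * \<Xi> k i j else 0)"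
        by (rule sum.cong) (use la_ell b in auto)
      then show "act k ?v j = scl \<beta> (\<Xi> k b) j" using b by (simp add: act_def vmul_def)
    qed
    then have "(\<Sum>k\<le>r. scl (z ^ k) (act k ?v)) = scl \<beta> ?v"
      by (simp add: ell_def la \<Xi>_def fm.scale_sum_right mult.commute)
    with * la_ell[OF b c] c show ?thesis by (auto simp: VJ_def power2_eq_square)
  qed
  have "m \<in> N (Suc (Suc d)) \<longleftrightarrow> (\<forall>b<n. co2 m b \<in> J)" if m: "m \<in> part p r (Suc (Suc d))" for m
  proof
    assume "m \<in> N (Suc (Suc d))"
    then show "\<forall>b<n. co2 m b \<in> J" using co2_N unfolding VJ_def by blast
  next
    assume co2m: "\<forall>b<n. co2 m b \<in> J"
    \<comment> \<open>Expanding \<open>m\<close> in the spanning vectors \<open>EE b\<close>, the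
      vanishing of its coordinates gives \<open>\<beta>\<^sup>2 * a c\<close> in \<open>J\<close>,
      hence vanishing coefficients.\<close>
    obtain a where a: "scl ((\<delta>\<^sup>2)\<^sup>2) m - (\<Sum>b<n. scl (a b) (EE b)) \<in> N (Suc (Suc d))"
      using S2[OF m] unfolding EE_def by blast
    have "a c \<in> J" if c: "c < n" for c
    proof -
      have 1: "(\<delta>\<^sup>2)\<^sup>2 * co2 m c - (\<Sum>b<n. a b * co2 (EE b) c) \<in> J"
        using co2_N[OF a] c by (simp add: VJ_def co2)
      have 2: "(\<Sum>b<n. a b * co2 (EE b) c) = (\<Sum>b<n. a b * (co2 (EE b) c - (if b = c then \<beta>\<^sup>2 else 0)))
        + (\<Sum>b<n. if b = c then \<beta>\<^sup>2 * a b else 0)"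
        unfolding sum.distrib[symmetric] by (rule sum.cong) (auto simp: algebra_simps)
      have "(\<delta>\<^sup>2)\<^sup>2 * co2 m c - ((\<delta>\<^sup>2)\<^sup>2 * co2 m c - (\<Sum>b<n. a b * co2 (EE b) c))
        - (\<Sum>b<n. a b * (co2 (EE b) c - (if b = c then \<beta>\<^sup>2 else 0))) \<in> J"
        by (intro idl_diff[OF J] 1 idl_mult[OF J] idl_sum[OF J] co2_EE c) (use co2m c in auto)
      also have "(\<delta>\<^sup>2)\<^sup>2 * co2 m c - ((\<delta>\<^sup>2)\<^sup>2 * co2 m c - (\<Sum>b<n. a b * co2 (EE b) c))
        - (\<Sum>b<n. a b * (co2 (EE b) c - (if b = c then \<beta>\<^sup>2 else 0))) = (\<Sum>b<n. if b = c then \<beta>\<^sup>2 * a b else 0)"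
        by (subst 2) (simp add: algebra_simps)
      also have "\<dots> = \<beta>\<^sup>2 * a c" using c by simp
      finally show ?thesis using J_sat prm_power[OF P \<beta>] by blast
    qed
    then have "(\<Sum>b<n. scl (a b) (EE b)) \<in> N (Suc (Suc d))"
      by (intro fm.subspace_sum subspace_N N_J EE) auto
    from fm.subspace_add[OF subspace_N a this] have "scl ((\<delta>\<^sup>2)\<^sup>2) m \<in> N (Suc (Suc d))" by simp
    then show "m \<in> N (Suc (Suc d))" using N_sat[OF m] prm_power[OF P \<delta>2] by blast
  qed
  then show ?thesis
    unfolding coord_def is_coord_def using lin_co2 prm_power[OF P \<beta>, of 2] EE co2_EE by blast
qed

end

section \<open>Base change to polynomials in one variable\<close>

text \<open>The \<open>q b\<close> are a basis of \<open>V / N\<close> localized at the powers of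
  \<open>f\<close>, over the localized quotient by \<open>I\<close>, with denominators
  cleared.\<close>

definition basis_at :: "'r::comm_ring_1 set \<Rightarrow> nat \<Rightarrow> ('i \<Rightarrow> 'r) set \<Rightarrow> ('i \<Rightarrow> 'r) set \<Rightarrow> 'r \<Rightarrow> bool"
  where "basis_at I n V N f \<longleftrightarrow> (\<exists>q. (\<forall>b<n. q b \<in> V)
    \<and> (\<forall>m\<in>V. \<exists>k a. scl (f ^ k) m - (\<Sum>b<n. scl (a b) (q b)) \<in> N)
    \<and> (\<forall>a. (\<Sum>b<n. scl (a b) (q b)) \<in> N \<longrightarrow> (\<exists>k. \<forall>b<n. f ^ k * a b \<in> I)))"

definition zariski_free :: "'r::comm_ring_1 set \<Rightarrow> nat \<Rightarrow> ('i \<Rightarrow> 'r) set \<Rightarrow> ('i \<Rightarrow> 'r) set \<Rightarrow> bool"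
  where "zariski_free I n V N \<longleftrightarrow> (\<forall>P. prm P \<and> I \<subseteq> P \<longrightarrow> (\<exists>f. f \<notin> P \<and> basis_at I n V N f))"

definition cvec :: "'i \<Rightarrow> 'i \<Rightarrow> 'r::comm_ring_1"
  where "cvec \<mu> = (\<lambda>i. if i = \<mu> then 1 else 0)"

lemma cvec_part: "\<mu> \<in> mons p r t \<Longrightarrow> cvec \<mu> \<in> part p r t"
  by (auto simp: cvec_def part_def)

lemma part_cvec_sum:
  assumes "m \<in> part p r t"
  shows "m = (\<Sum>\<mu>\<in>mons p r t. scl (m \<mu>) (cvec \<mu>))"
proof
  fix x
  have "(\<Sum>\<mu>\<in>mons p r t. m \<mu> * cvec \<mu> x) = (\<Sum>\<mu>\<in>mons p r t. if \<mu> = x then m x else 0)"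
    by (rule sum.cong) (auto simp: cvec_def)
  also have "\<dots> = m x"
    using assms by (auto simp: finite_mons part_def simp del: split_paired_All)
  finally show "m x = (\<Sum>\<mu>\<in>mons p r t. scl (m \<mu>) (cvec \<mu>)) x" by simp
qed

text \<open>Pairing a relation with \<open>x\<close> removes the rows of \<open>C\<close> and leaves
  the coefficient of \<open>v\<close> times a factor outside \<open>P\<close>.\<close>

lemma indep_insert:
  assumes P: "prm P" and C: "indep P n k C" and x: "\<And>i. i < k \<Longrightarrow> (\<Sum>c<n. C i c * x c) = 0"
    and v: "(\<Sum>c<n. v c * x c) \<notin> P"
  shows "indep P n (Suc k) (C(k := v))"
  unfolding indep_def
proof (intro allI impI)
  fix a i assume "\<forall>c<n. (\<Sum>i<Suc k. a i * (C(k := v)) i c) \<in> P" and i: "i < Suc k"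
  then have a: "(\<Sum>i<k. a i * C i c) + a k * v c \<in> P" if "c < n" for c
    using that by simp
  note P_ = prm_idl[OF P]
  have "(\<Sum>c<n. ((\<Sum>i<k. a i * C i c) + a k * v c) * x c) \<in> P"
    by (rule idl_sum[OF P_], rule idl_mult2[OF P_], rule a) simp
  also have "(\<Sum>c<n. ((\<Sum>i<k. a i * C i c) + a k * v c) * x c)
    = (\<Sum>i<k. a i * (\<Sum>c<n. C i c * x c)) + a k * (\<Sum>c<n. v c * x c)"
    unfolding sum_distrib_left sum_distrib_right distrib_right sum.distrib
    by (subst sum.swap) (simp add: mult.assoc)
  also have "(\<Sum>i<k. a i * (\<Sum>c<n. C i c * x c)) = 0" by (rule sum.neutral) (simp add: x)
  finally have ak: "a k \<in> P" using v P unfolding prm_def by auto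
  have "(\<Sum>i<k. a i * C i c) \<in> P" if "c < n" for c
    using idl_diff[OF P_ a[OF that] idl_mult2[OF P_ ak, of "v c"]] by simp
  then have "\<forall>i<k. a i \<in> P" using C unfolding indep_def by blast
  then show "a i \<in> P" using ak i by (auto simp: less_Suc_eq)
qed

section \<open>Ideals, vectors and relations over the polynomial ring\<close>

definition poly_ext :: "'r::comm_ring_1 set \<Rightarrow> 'r poly set"
  where "poly_ext I = {g. \<forall>k. coeff g k \<in> I}"

lemma idl_poly_ext:
  assumes "idl I"
  shows "idl (poly_ext I)"
  unfolding idl_def poly_ext_def mem_Collect_eq
  using assms by (auto simp: coeff_mult intro: idl_0 idl_add idl_sum idl_mult)

text \<open>Gauss's argument: the first coefficients of \<open>a\<close> and \<open>b\<close>
  outside \<open>P\<close> give the only term outside \<open>P\<close> in one coefficient of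
  \<open>a * b\<close>.\<close>

lemma prm_poly_ext:
  assumes P: "prm P"
  shows "prm (poly_ext P)"
  unfolding prm_def
proof (intro conjI allI impI)
  show "idl (poly_ext P)" by (rule idl_poly_ext[OF prm_idl[OF P]])
  show "1 \<notin> poly_ext P" using prm_1[OF P] by (auto simp: poly_ext_def intro!: exI[of _ 0])
  fix a b assume ab: "a * b \<in> poly_ext P"
  show "a \<in> poly_ext P \<or> b \<in> poly_ext P"
  proof (rule ccontr)
    assume "\<not> ?thesis"
    then have a: "\<exists>i. coeff a i \<notin> P" and b: "\<exists>i. coeff b i \<notin> P"
      by (auto simp: poly_ext_def)
    define i where "i = (LEAST i. coeff a i \<notin> P)"
    define j where "j = (LEAST i. coeff b i \<notin> P)"
    have i: "coeff a i \<notin> P" "\<And>k. k < i \<Longrightarrow> coeff a k \<in> P"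
      unfolding i_def using LeastI_ex[OF a] not_less_Least by blast+
    have j: "coeff b j \<notin> P" "\<And>k. k < j \<Longrightarrow> coeff b k \<in> P"
      unfolding j_def using LeastI_ex[OF b] not_less_Least by blast+
    have "(\<Sum>k\<in>{..i + j} - {i}. coeff a k * coeff b (i + j - k)) \<in> P"
    proof (rule idl_sum[OF prm_idl[OF P]])
      fix k assume "k \<in> {..i + j} - {i}"
      then consider "k < i" | "i + j - k < j" by force
      then show "coeff a k * coeff b (i + j - k) \<in> P"
        using i(2) j(2) idl_mult[OF prm_idl[OF P]] idl_mult2[OF prm_idl[OF P]] by cases blast+
    qed
    moreover have "coeff (a * b) (i + j) \<in> P" using ab by (simp add: poly_ext_def)
    then have "coeff a i * coeff b j
      + (\<Sum>k\<in>{..i + j} - {i}. coeff a k * coeff b (i + j - k)) \<in> P"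
      by (simp add: coeff_mult sum.remove[of _ i])
    ultimately have "coeff a i * coeff b j \<in> P"
      using idl_diff[OF prm_idl[OF P]] by fastforce
    then show False using i(1) j(1) P unfolding prm_def by blast
  qed
qed

lemma const_poly_ext: "idl I \<Longrightarrow> [:a:] \<in> poly_ext I \<longleftrightarrow> a \<in> I"
  by (auto simp: poly_ext_def coeff_pCons idl_0 split: nat.splits)

definition cf :: "nat \<Rightarrow> ('i \<Rightarrow> 'r::comm_ring_1 poly) \<Rightarrow> 'i \<Rightarrow> 'r"
  where "cf k m = (\<lambda>i. coeff (m i) k)"

definition emb :: "('i \<Rightarrow> 'r::comm_ring_1) \<Rightarrow> 'i \<Rightarrow> 'r poly"
  where "emb m = (\<lambda>i. [:m i:])"

lemma cf_add: "cf k (m + m') = cf k m + cf k m'"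
  and cf_diff: "cf k (m - m') = cf k m - cf k m'"
  and cf_0: "cf k 0 = 0"
  by (auto simp: cf_def fun_eq_iff)

lemma cf_sum: "cf k (\<Sum>x\<in>A. f x) = (\<Sum>x\<in>A. cf k (f x))"
  by (auto simp: cf_def fun_eq_iff coeff_sum)

lemma cf_scl: "cf k (scl g m) = (\<Sum>j\<le>k. scl (coeff g j) (cf (k - j) m))"
  by (auto simp: cf_def fun_eq_iff coeff_mult)

lemma cf_scl_const: "cf k (scl [:a:] m) = scl a (cf k m)"
  by (auto simp: cf_def fun_eq_iff)

lemma cf_scl_emb: "cf k (scl g (emb m)) = scl (coeff g k) m"
  by (auto simp: cf_def emb_def fun_eq_iff mult.commute)

lemma cf_shift: "cf k (shift i m) = shift i (cf k m)"
  by (auto simp: cf_def shift_def fun_eq_iff)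

lemma cf_part: "m \<in> part p r t \<Longrightarrow> cf k m \<in> part p r t"
  by (auto simp: cf_def part_def)

lemma part_cf: "(\<And>k. cf k m \<in> part p r t) \<Longrightarrow> m \<in> part p r t"
  by (auto simp: cf_def part_def poly_eq_iff)

lemma emb_part: "m \<in> part p r t \<Longrightarrow> emb m \<in> part p r t"
  by (auto simp: emb_def part_def)

lemma emb_scl: "emb (scl a m) = scl [:a:] (emb m)"
  by (auto simp: emb_def fun_eq_iff)

lemma emb_cvec: "emb (cvec \<mu>) = cvec \<mu>"
  by (auto simp: emb_def cvec_def fun_eq_iff one_pCons)

lemma emb_0: "emb 0 = 0" and emb_add: "emb (x + y) = emb x + emb y"
  and emb_shift: "emb (shift i m) = shift i (emb m)"
  by (auto simp: emb_def shift_def fun_eq_iff)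

lemma emb_sum: "emb (\<Sum>x\<in>A. f x) = (\<Sum>x\<in>A. emb (f x))"
  by (induction A rule: infinite_finite_induct) (simp_all only: sum.infinite sum.empty sum.insert emb_0 emb_add not_False_eq_True simp_thms)

lemma cf_emb: "cf k (emb m) = (if k = 0 then m else 0)"
  by (auto simp: cf_def emb_def fun_eq_iff coeff_pCons split: nat.splits)

locale graded =
  fixes I :: "'r::comm_ring_1 set" and p r :: nat and N :: "nat \<Rightarrow> 'r vect set" and d0 :: nat
  assumes I: "idl I" and subspace_N: "fm.subspace (N t)" and N_part: "N t \<subseteq> part p r t"
    and N_I: "a \<in> I \<Longrightarrow> m \<in> part p r t \<Longrightarrow> scl a m \<in> N t"
    and N_shift: "i \<le> r \<Longrightarrow> m \<in> N t \<Longrightarrow> shift i m \<in> N (Suc t)"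
    and N_gen: "d0 \<le> t \<Longrightarrow> m \<in> N (Suc t) \<Longrightarrow> m \<in> fm.span (\<Union>i\<le>r. shift i ` N t)"
begin

definition N0 :: "nat \<Rightarrow> (nat \<times> nat multiset \<Rightarrow> 'r poly) set"
  where "N0 t = {m. \<forall>k. cf k m \<in> N t}"

lemma subspace_N0: "fm.subspace (N0 t)"
  by (rule fm.subspaceI)
    (auto simp: N0_def cf_0 cf_add cf_scl fm.subspace_0[OF subspace_N]
      intro!: fm.subspace_add[OF subspace_N] fm.subspace_sum[OF subspace_N] fm.subspace_scale[OF subspace_N])

lemma N0_part: "N0 t \<subseteq> part p r t"
  using N_part by (auto simp: N0_def intro: part_cf)

lemma N0_I:
  assumes "g \<in> poly_ext I" "m \<in> part p r t"
  shows "scl g m \<in> N0 t"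
  unfolding N0_def cf_scl mem_Collect_eq
  using assms by (intro allI fm.subspace_sum[OF subspace_N] N_I cf_part) (auto simp: poly_ext_def)

lemma N0_shift: "i \<le> r \<Longrightarrow> m \<in> N0 t \<Longrightarrow> shift i m \<in> N0 (Suc t)"
  by (simp add: N0_def cf_shift N_shift)

lemma emb_N0: "m \<in> N t \<Longrightarrow> emb m \<in> N0 t"
  by (simp add: N0_def cf_emb fm.subspace_0[OF subspace_N])

text \<open>In the expansion of \<open>m\<close> by powers of the new variable, which is finite as
  \<open>m\<close> has finite support, each coefficient is a relation over the base ring and
  \<open>N_gen\<close> applies to it.\<close>

lemma N0_gen:
  assumes t: "d0 \<le> t" and m: "m \<in> N0 (Suc t)"
  shows "m \<in> fm.span (\<Union>i\<le>r. shift i ` N0 t)"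
proof -
  let ?W = "fm.span (\<Union>i\<le>r. shift i ` N0 t)"
  have emb: "emb x \<in> ?W" if "x \<in> fm.span (\<Union>i\<le>r. shift i ` N t)" for x
    using that
  proof (induction rule: fm.span_induct_alt)
    case base
    show ?case unfolding emb_0 by (rule fm.span_zero)
  next
    case (step c x y)
    then obtain i z where "i \<le> r" "z \<in> N t" "x = shift i z" by blast
    then have "emb x \<in> ?W" unfolding emb_shift[of i z, folded \<open>x = shift i z\<close>] using emb_N0 by (intro fm.span_base) blast
    then show ?case unfolding emb_add emb_scl by (intro fm.span_add fm.span_scale step(2))
  qed
  define K where "K = Max (insert 0 ((\<lambda>x. degree (m x)) ` mons p r (Suc t)))"
  have K: "degree (m x) \<le> K" for x
    using subsetD[OF N0_part m] unfolding K_def part_def by (cases "x \<in> mons p r (Suc t)") (auto simp: finite_mons simp del: split_paired_All)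
  have "m = (\<Sum>k\<le>K. scl (monom 1 k) (emb (cf k m)))"
  proof
    fix x
    show "m x = (\<Sum>k\<le>K. scl (monom 1 k) (emb (cf k m))) x"
      using poly_as_sum_of_monoms'[OF K[of x]] by (simp add: emb_def cf_def smult_monom)
  qed
  also have "\<dots> \<in> ?W"
    using m by (intro fm.span_sum fm.span_scale emb N_gen[OF t]) (simp add: N0_def)
  finally show ?thesis .
qed

text \<open>The powers of the new variable are pairwise distinct modulo every prime, so they serve as
  parameters of the curve of linear forms even when the residue field is finite.\<close>

definition PP :: "'r set \<Rightarrow> 'r poly set" where "PP P = poly_ext P"
definition JJ :: "'r set \<Rightarrow> 'r poly set" where "JJ P = {g. \<exists>s. s \<notin> PP P \<and> s * g \<in> poly_ext I}"
definition NN :: "'r set \<Rightarrow> nat \<Rightarrow> (nat \<times> nat multiset \<Rightarrow> 'r poly) set"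
  where "NN P t = {m \<in> part p r t. \<exists>s. s \<notin> PP P \<and> scl s m \<in> N0 t}"

lemma N0_NN: "prm P \<Longrightarrow> m \<in> N0 t \<Longrightarrow> m \<in> NN P t"
  using N0_part prm_1[OF prm_poly_ext] by (auto simp: NN_def PP_def intro!: exI[of _ 1])

lemma local_graded:
  assumes P: "prm P" and IP: "I \<subseteq> P"
  shows "local_graded (PP P) (JJ P) p r (NN P) d0"
proof
  show PP: "prm (PP P)" unfolding PP_def by (rule prm_poly_ext[OF P])
  note I' = idl_poly_ext[OF I]
  show "idl (JJ P)"
    using subspace_sat[OF PP I'[unfolded idl_iff_subspace]] by (simp add: idl_iff_subspace JJ_def)
  show "JJ P \<subseteq> PP P"
  proof
    fix g assume "g \<in> JJ P"
    then obtain s where *: "s \<notin> PP P" "s * g \<in> poly_ext I" unfolding JJ_def by blast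
    then have "s * g \<in> PP P" using IP by (auto simp: PP_def poly_ext_def)
    then show "g \<in> PP P" by (rule prm_cancel[OF PP *(1)])
  qed
  fix s a assume "s \<notin> PP P" "s * a \<in> JJ P"
  then obtain s' where "s' \<notin> PP P" "s' * (s * a) \<in> poly_ext I" unfolding JJ_def by blast
  then show "a \<in> JJ P" using prm_mult[OF PP \<open>s' \<notin> PP P\<close> \<open>s \<notin> PP P\<close>]
    unfolding JJ_def mult.assoc[symmetric] by blast
next
  fix t
  have PP: "prm (PP P)" unfolding PP_def by (rule prm_poly_ext[OF P])
  have "NN P t = part p r t \<inter> {m. \<exists>s. s \<notin> PP P \<and> scl s m \<in> N0 t}" by (auto simp: NN_def)
  then show "fm.subspace (NN P t)"
    by (simp only: fm.subspace_inter subspace_part subspace_sat[OF PP subspace_N0])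
  show "NN P t \<subseteq> part p r t" by (auto simp: NN_def)
  show "m \<in> NN P t" if m: "m \<in> part p r t" "s \<notin> PP P" and sm: "scl s m \<in> NN P t" for m s
  proof -
    obtain s' where "s' \<notin> PP P" "scl s' (scl s m) \<in> N0 t" using sm unfolding NN_def by blast
    then show ?thesis using m(1) prm_mult[OF PP \<open>s' \<notin> PP P\<close> m(2)] unfolding NN_def by auto
  qed
  show "scl a m \<in> NN P t" if a: "a \<in> JJ P" and m: "m \<in> part p r t" for a m
  proof -
    obtain s where s: "s \<notin> PP P" "s * a \<in> poly_ext I" using a unfolding JJ_def by blast
    have "scl s (scl a m) \<in> N0 t" using N0_I[OF s(2) m] by simp
    then show ?thesis using s(1) fm.subspace_scale[OF subspace_part m] unfolding NN_def by blast
  qed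
  show "shift i m \<in> NN P (Suc t)" if i: "i \<le> r" and mN: "m \<in> NN P t" for i m
  proof -
    obtain s where s: "s \<notin> PP P" "scl s m \<in> N0 t" and m: "m \<in> part p r t" using mN unfolding NN_def by blast
    have "scl s (shift i m) \<in> N0 (Suc t)"
      using N0_shift[OF i s(2)] by (simp add: module_hom.scale[OF lin_shift])
    then show ?thesis using s(1) shift_part[OF i m] unfolding NN_def by blast
  qed
  show "\<exists>s. s \<notin> PP P \<and> scl s m \<in> fm.span (\<Union>i\<le>r. shift i ` NN P t)"
    if t: "d0 \<le> t" and mN: "m \<in> NN P (Suc t)" for m
  proof -
    obtain s where s: "s \<notin> PP P" "scl s m \<in> N0 (Suc t)" using mN unfolding NN_def by blast
    have "fm.span (\<Union>i\<le>r. shift i ` N0 t) \<subseteq> fm.span (\<Union>i\<le>r. shift i ` NN P t)"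
      using N0_NN[OF P] by (intro fm.span_mono) blast
    then show ?thesis using N0_gen[OF t s(2)] s(1) by blast
  qed
qed

lemma local_graded_curve:
  assumes P: "prm P" and IP: "I \<subseteq> P"
  shows "local_graded_curve (PP P) (JJ P) p r (NN P) d0 (monom 1)"
proof -
  note one = prm_1[OF P]
  interpret local_graded "PP P" "JJ P" p r "NN P" d0 by (rule local_graded[OF assms])
  show ?thesis
  proof
    fix a b :: nat assume "a \<noteq> b"
    then have "coeff (monom 1 a - monom 1 b) a = (1::'r)" by simp
    then show "monom 1 a - monom 1 b \<notin> PP P"
      unfolding PP_def poly_ext_def mem_Collect_eq using one by metis
  qed
qed

end

section \<open>Descent and Zariski neighbourhoods\<close>

text \<open>By Zorn's lemma some ideal is maximal among those containing \<open>K\<close> and no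
  power of \<open>f\<close>. Adjoining any further element catches a power of \<open>f\<close>,
  which forces primality.\<close>

lemma prime_avoiding:
  assumes K: "idl K" and f: "\<And>k. f ^ k \<notin> K"
  shows "\<exists>P. prm P \<and> K \<subseteq> P \<and> f \<notin> P"
proof -
  define S where "S = {L. idl L \<and> K \<subseteq> L \<and> (\<forall>k. f ^ k \<notin> L)}"
  have "\<exists>M\<in>S. \<forall>L\<in>S. M \<subseteq> L \<longrightarrow> L = M"
  proof (rule subset_Zorn_nonempty)
    show "S \<noteq> {}" using K f unfolding S_def by blast
    fix C assume "C \<noteq> {}" and C: "subset.chain S C"
    then have CS: "\<And>L. L \<in> C \<Longrightarrow> L \<in> S" and tot: "\<And>L L'. L \<in> C \<Longrightarrow> L' \<in> C \<Longrightarrow> L \<subseteq> L' \<or> L' \<subseteq> L"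
      unfolding subset_chain_def by blast+
    have "idl (\<Union>C)"
      unfolding idl_def
    proof (intro conjI ballI allI)
      obtain L where "L \<in> C" using \<open>C \<noteq> {}\<close> by blast
      moreover from this have "idl L" using CS unfolding S_def by blast
      ultimately show "0 \<in> \<Union>C" using idl_0 by blast
      fix a b assume "a \<in> \<Union>C" "b \<in> \<Union>C"
      then obtain L1 L2 where "L1 \<in> C" "a \<in> L1" "L2 \<in> C" "b \<in> L2" by blast
      moreover from this have "L1 \<subseteq> L2 \<or> L2 \<subseteq> L1" by (intro tot)
      ultimately obtain L where L: "L \<in> C" "a \<in> L" "b \<in> L" by blast
      then have "idl L" using CS unfolding S_def by blast
      then show "a + b \<in> \<Union>C" using idl_add L by blast
    next
      fix a b assume "b \<in> \<Union>C"
      then obtain L where L: "L \<in> C" "b \<in> L" by blast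
      then have "idl L" using CS unfolding S_def by blast
      then show "a * b \<in> \<Union>C" using idl_mult L by blast
    qed
    moreover have "K \<subseteq> \<Union>C" using \<open>C \<noteq> {}\<close> CS unfolding S_def by fastforce
    moreover have "f ^ k \<notin> \<Union>C" for k using CS unfolding S_def by blast
    ultimately show "\<Union>C \<in> S" unfolding S_def by blast
  qed
  then obtain M where MS: "M \<in> S" and max: "\<And>L. L \<in> S \<Longrightarrow> M \<subseteq> L \<Longrightarrow> L = M" by blast
  then have M: "idl M" "K \<subseteq> M" "\<And>k. f ^ k \<notin> M" unfolding S_def by auto
  interpret R: Modules.module "(*) :: 'a \<Rightarrow> 'a \<Rightarrow> 'a"
    by standard (auto simp: algebra_simps)
  have R: "R.subspace L \<longleftrightarrow> idl L" for L
    unfolding R.subspace_def idl_def by blast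
  have ext: "\<exists>k x. f ^ k - x * a \<in> M" if "a \<notin> M" for a
  proof (rule ccontr)
    assume "\<not> ?thesis"
    then have "\<And>k. f ^ k \<notin> R.span (insert a M)"
      by (simp add: R.span_insert R.span_eq_iff[THEN iffD2, OF R[THEN iffD2, OF M(1)]])
    then have "R.span (insert a M) \<in> S"
      using M(2) R.span_superset[of "insert a M"] R.subspace_span R unfolding S_def by blast
    with max[of "R.span (insert a M)"] R.span_superset[of "insert a M"] that show False by blast
  qed
  have "prm M"
    unfolding prm_def
  proof (intro conjI allI impI)
    show "idl M" "1 \<notin> M" using M(1) M(3)[of 0] by simp_all
    fix a b assume ab: "a * b \<in> M"
    show "a \<in> M \<or> b \<in> M"
    proof (rule ccontr)
      assume "\<not> ?thesis"
      then obtain k x l y where 1: "f ^ k - x * a \<in> M" and 2: "f ^ l - y * b \<in> M"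
        using ext by meson
      have "f ^ l * (f ^ k - x * a) + (x * a) * (f ^ l - y * b) + (x * y) * (a * b) \<in> M"
        by (intro idl_add[OF M(1)] idl_mult[OF M(1) ab] idl_mult[OF M(1) 1] idl_mult[OF M(1) 2])
      also have "f ^ l * (f ^ k - x * a) + (x * a) * (f ^ l - y * b) + (x * y) * (a * b) = f ^ (k + l)"
        by (simp only: power_add right_diff_distrib mult_ac) simp
      finally show False using M(3) by blast
    qed
  qed
  then show ?thesis using M(2) M(3)[of 1] by auto
qed

lemma matrix_relation:
  fixes n :: nat
  assumes J: "idl J" and D: "\<And>i j. i < n \<Longrightarrow> j < n \<Longrightarrow> (\<Sum>c<n. C i c * D c j) = (if i = j then d else 0)"
    and a: "\<And>c. c < n \<Longrightarrow> (\<Sum>b<n. a b * C b c) \<in> J" and j: "j < n"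
  shows "d * a j \<in> J"
proof -
  have "(\<Sum>c<n. (\<Sum>b<n. a b * C b c) * D c j) \<in> J"
    by (rule idl_sum[OF J], rule idl_mult2[OF J], rule a) simp
  also have "(\<Sum>c<n. (\<Sum>b<n. a b * C b c) * D c j) = (\<Sum>b<n. a b * (\<Sum>c<n. C b c * D c j))"
    unfolding sum_distrib_left sum_distrib_right by (subst sum.swap) (simp add: mult.assoc)
  also have "\<dots> = (\<Sum>b<n. if b = j then d * a b else 0)"
    by (rule sum.cong) (use D j in \<open>auto simp: mult.commute\<close>)
  finally show ?thesis using j by simp
qed

context graded
begin

text \<open>Every \<open>m\<close> is a combination of monomial vectors, so their expansions
  suffice; comparing coefficients of the new variable reduces to the base ring.\<close>

lemma span_poly:
  assumes c: "\<And>\<mu>. \<mu> \<in> mons p r t \<Longrightarrow> scl f (cvec \<mu>) - (\<Sum>b<n. scl (c \<mu> b) (q b)) \<in> N t"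
    and m: "m \<in> part p r t"
  shows "scl [:f:] m - (\<Sum>b<n. scl (\<Sum>\<mu>\<in>mons p r t. m \<mu> * [:c \<mu> b:]) (emb (q b))) \<in> N0 t"
  unfolding N0_def mem_Collect_eq
proof
  fix k
  let ?S = "mons p r t"
  have "cf k (scl [:f:] m - (\<Sum>b<n. scl (\<Sum>\<mu>\<in>?S. m \<mu> * [:c \<mu> b:]) (emb (q b))))
    = scl f (cf k m) - (\<Sum>b<n. scl (\<Sum>\<mu>\<in>?S. cf k m \<mu> * c \<mu> b) (q b))"
    by (simp add: cf_diff cf_sum cf_scl_const cf_scl_emb coeff_sum) (simp add: cf_def mult.commute)
  also have "scl f (cf k m) = (\<Sum>\<mu>\<in>?S. scl (cf k m \<mu>) (scl f (cvec \<mu>)))"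
    by (subst part_cvec_sum[OF cf_part[OF m]]) (simp only: fm.scale_sum_right fm.scale_left_commute)
  also have "(\<Sum>b<n. scl (\<Sum>\<mu>\<in>?S. cf k m \<mu> * c \<mu> b) (q b)) = (\<Sum>\<mu>\<in>?S. scl (cf k m \<mu>) (\<Sum>b<n. scl (c \<mu> b) (q b)))"
    unfolding fm.scale_sum_left fm.scale_sum_right fm.scale_scale by (rule sum.swap)
  finally have eq: "cf k (scl [:f:] m - (\<Sum>b<n. scl (\<Sum>\<mu>\<in>?S. m \<mu> * [:c \<mu> b:]) (emb (q b))))
    = (\<Sum>\<mu>\<in>?S. scl (cf k m \<mu>) (scl f (cvec \<mu>) - (\<Sum>b<n. scl (c \<mu> b) (q b))))"
    by (simp only: fm.scale_right_diff_distrib sum_subtractf)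
  show "cf k (scl [:f:] m - (\<Sum>b<n. scl (\<Sum>\<mu>\<in>?S. m \<mu> * [:c \<mu> b:]) (emb (q b)))) \<in> N t"
    unfolding eq by (intro fm.subspace_sum[OF subspace_N] fm.subspace_scale[OF subspace_N] c)
qed

text \<open>Each coefficient in the new variable is a relation over the base ring, and one power of
  \<open>f\<close> serves the finitely many coefficients of \<open>g b\<close>.\<close>

lemma relation_poly:
  assumes P: "prm P" and f: "f \<notin> P"
    and indep: "\<And>a. (\<Sum>b<n. scl (a b) (q b)) \<in> N t \<Longrightarrow> \<exists>k. \<forall>b<n. f ^ k * a b \<in> I"
    and g: "(\<Sum>b<n. scl (g b) (emb (q b))) \<in> N0 t" and b: "b < n"
  shows "g b \<in> JJ P"
proof -
  have "(\<Sum>b<n. scl (coeff (g b) k) (q b)) \<in> N t" for k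
    using g by (auto simp: N0_def cf_sum cf_scl_emb)
  then have "\<exists>j. f ^ j * coeff (g b) k \<in> I" for k using indep[of "\<lambda>b. coeff (g b) k"] b by blast
  with power_common[OF I, of "{..degree (g b)}"] obtain K
    where K: "\<forall>k\<in>{..degree (g b)}. f ^ K * coeff (g b) k \<in> I" by blast
  have "f ^ K * coeff (g b) k \<in> I" for k
    by (cases "k \<le> degree (g b)") (use K in \<open>simp_all add: coeff_eq_0 idl_0[OF I]\<close>)
  then have "[:f ^ K:] * g b \<in> poly_ext I" by (simp add: poly_ext_def)
  moreover have "[:f ^ K:] \<notin> PP P"
    using const_poly_ext[OF prm_idl[OF P]] prm_power[OF P f] by (simp add: PP_def)
  ultimately show ?thesis unfolding JJ_def by blast
qed

text \<open>The monomial vectors are expanded in the basis with one common power of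
  \<open>f\<close>; extended linearly to the polynomial ring, the expansions form the coordinate
  map, with \<open>[:f ^ K:]\<close> as its unit.\<close>

lemma coord_of_basis:
  assumes P: "prm P" and IP: "I \<subseteq> P" and f: "f \<notin> P" and basis: "basis_at I n (part p r t) (N t) f"
  shows "coord (PP P) (JJ P) p r n t (NN P t)"
proof -
  interpret L: local_graded "PP P" "JJ P" p r "NN P" d0 by (rule local_graded[OF P IP])
  note prm_P = assms(1)
  obtain q where q: "\<And>b. b < n \<Longrightarrow> q b \<in> part p r t"
    and span: "\<forall>m\<in>part p r t. \<exists>k a. scl (f ^ k) m - (\<Sum>b<n. scl (a b) (q b)) \<in> N t"
    and indep: "\<And>a. (\<Sum>b<n. scl (a b) (q b)) \<in> N t \<Longrightarrow> \<exists>k. \<forall>b<n. f ^ k * a b \<in> I"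
    using basis unfolding basis_at_def by blast
  have "\<forall>\<mu>. \<exists>k a. \<mu> \<in> mons p r t \<longrightarrow> scl (f ^ k) (cvec \<mu>) - (\<Sum>b<n. scl (a b) (q b)) \<in> N t"
    using span cvec_part by blast
  from choice2[OF this] obtain k a where
    a: "\<And>\<mu>. \<mu> \<in> mons p r t \<Longrightarrow> scl (f ^ k \<mu>) (cvec \<mu>) - (\<Sum>b<n. scl (a \<mu> b) (q b)) \<in> N t" by blast
  define K where "K = (\<Sum>\<mu>\<in>mons p r t. k \<mu>)"
  define c where "c \<mu> b = f ^ (K - k \<mu>) * a \<mu> b" for \<mu> b
  have c: "scl (f ^ K) (cvec \<mu>) - (\<Sum>b<n. scl (c \<mu> b) (q b)) \<in> N t" if \<mu>: "\<mu> \<in> mons p r t" for \<mu>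
  proof -
    have "k \<mu> \<le> K" unfolding K_def using \<mu> by (intro member_le_sum) (auto simp: finite_mons)
    then have K: "f ^ K = f ^ (K - k \<mu>) * f ^ k \<mu>" by (simp flip: power_add)
    have "scl (f ^ (K - k \<mu>)) (scl (f ^ k \<mu>) (cvec \<mu>) - (\<Sum>b<n. scl (a \<mu> b) (q b))) \<in> N t"
      by (intro fm.subspace_scale[OF subspace_N] a \<mu>)
    then show ?thesis
      by (simp only: fm.scale_right_diff_distrib fm.scale_sum_right fm.scale_scale K c_def)
  qed
  define co :: "(nat \<times> nat multiset \<Rightarrow> 'r poly) \<Rightarrow> nat \<Rightarrow> 'r poly"
    where "co m = (\<lambda>b. \<Sum>\<mu>\<in>mons p r t. m \<mu> * [:c \<mu> b:])" for m
  have lin: "lin co"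
    by (rule linI) (simp_all add: co_def fun_eq_iff sum.distrib distrib_right sum_distrib_left mult.assoc
        del: mult_pCons_right)
  have A: "scl [:f ^ K:] m - (\<Sum>b<n. scl (co m b) (emb (q b))) \<in> N0 t" if "m \<in> part p r t" for m
    unfolding co_def by (rule span_poly[OF c that])
  have fK: "[:f ^ K:] \<notin> PP P"
    using const_poly_ext[OF prm_idl[OF prm_P]] prm_power[OF prm_P f] by (simp add: PP_def)
  have B: "g b \<in> JJ P" if "(\<Sum>b<n. scl (g b) (emb (q b))) \<in> N0 t" "b < n" for g b
    by (rule relation_poly[OF prm_P f _ that]) (rule indep)
  have "m \<in> NN P t \<longleftrightarrow> (\<forall>b<n. co m b \<in> JJ P)" if m: "m \<in> part p r t" for m
  proof
    assume "m \<in> NN P t"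
    then obtain s where s: "s \<notin> PP P" "scl s m \<in> N0 t" unfolding NN_def by blast
    have "scl [:f ^ K:] (scl s m) - (scl [:f ^ K:] (scl s m) - (\<Sum>b<n. scl (co (scl s m) b) (emb (q b)))) \<in> N0 t"
      by (intro fm.subspace_diff[OF subspace_N0] fm.subspace_scale[OF subspace_N0] s A
          fm.subspace_scale[OF subspace_part] m)
    then have "(\<Sum>b<n. scl (co (scl s m) b) (emb (q b))) \<in> N0 t" by simp
    then have "s * co m b \<in> JJ P" if "b < n" for b
      using B[OF _ that, of "co (scl s m)"] by (simp add: module_hom.scale[OF lin])
    then show "\<forall>b<n. co m b \<in> JJ P" using L.J_sat[OF s(1)] by blast
  next
    assume "\<forall>b<n. co m b \<in> JJ P"
    then have "(\<Sum>b<n. scl (co m b) (emb (q b))) \<in> NN P t"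
      by (intro fm.subspace_sum[OF L.subspace_N] L.N_J emb_part q) auto
    from fm.subspace_add[OF L.subspace_N N0_NN[OF prm_P A[OF m]] this]
    have "scl [:f ^ K:] m \<in> NN P t" by simp
    then show "m \<in> NN P t" using L.N_sat[OF m fK] by blast
  qed
  moreover have "co (emb (q b)) c - (if b = c then [:f ^ K:] else 0) \<in> JJ P" if b: "b < n" and c: "c < n" for b c
  proof -
    have "scl [:f ^ K:] (emb (q b)) = (\<Sum>c<n. scl (if b = c then [:f ^ K:] else 0) (emb (q c)))"
    proof -
      have "(\<Sum>c<n. scl (if b = c then [:f ^ K:] else 0) (emb (q c)))
        = (\<Sum>c<n. if b = c then scl [:f ^ K:] (emb (q c)) else 0)"
        by (rule sum.cong) auto
      then show ?thesis using b by simp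
    qed
    then have "(\<Sum>c<n. scl ((if b = c then [:f ^ K:] else 0) - co (emb (q b)) c) (emb (q c))) \<in> N0 t"
      using A[OF emb_part[OF q[OF b]]] by (simp only: fm.scale_left_diff_distrib sum_subtractf)
    from B[OF this c] have "- ((if b = c then [:f ^ K:] else 0) - co (emb (q b)) c) \<in> JJ P"
      by (intro idl_uminus[OF L.J]) simp
    then show ?thesis by simp
  qed
  ultimately show ?thesis
    unfolding coord_def is_coord_def using lin fK emb_part[OF q] by (intro exI[of _ co] exI[of _ "\<lambda>b. emb (q b)"] exI[of _ "[:f ^ K:]"]) blast
qed

lemma coord_all:
  assumes P: "prm P" and IP: "I \<subseteq> P" and "n \<le> d0"
    and "coord (PP P) (JJ P) p r n d0 (NN P d0)" "coord (PP P) (JJ P) p r n (Suc d0) (NN P (Suc d0))"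
    and "d0 \<le> t"
  shows "coord (PP P) (JJ P) p r n t (NN P t)"
proof -
  interpret L: local_graded_curve "PP P" "JJ P" p r "NN P" d0 "monom 1"
    by (rule local_graded_curve[OF P IP])
  \<comment> \<open>Two consecutive degrees are carried along, as \<open>coord_step\<close> consumes
    both.\<close>
  have "coord (PP P) (JJ P) p r n t (NN P t) \<and> coord (PP P) (JJ P) p r n (Suc t) (NN P (Suc t))"
    using \<open>d0 \<le> t\<close>
  proof (induction t rule: dec_induct)
    case (step t)
    then show ?case using L.coord_step[of n t] \<open>n \<le> d0\<close> by simp
  qed (use assms in blast)
  then show ?thesis ..
qed

text \<open>The invertible coordinate matrix kills \<open>[:a b:]\<close> up to a multiplier
  \<open>s\<close> over the polynomial ring; a coefficient of \<open>s\<close> outside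
  \<open>P\<close> is a multiplier over the base ring.\<close>

lemma descend_relation:
  fixes n :: nat
  assumes P: "prm P" and IP: "I \<subseteq> P" and co: "lin co"
    and coN: "\<And>m. m \<in> part p r t \<Longrightarrow> m \<in> NN P t \<longleftrightarrow> (\<forall>b<n. co m b \<in> JJ P)"
    and \<delta>: "\<delta> \<notin> PP P"
    and D: "\<And>i j. i < n \<Longrightarrow> j < n \<Longrightarrow> (\<Sum>c<n. co (emb (q i)) c * D c j) = (if i = j then \<delta> else 0)"
    and a: "(\<Sum>b<n. scl (a b) (q b)) \<in> N t" and b: "b < n"
  shows "\<exists>s. s \<notin> P \<and> s * a b \<in> I"
proof -
  interpret L: local_graded "PP P" "JJ P" p r "NN P" d0 by (rule local_graded[OF P IP])
  have "(\<Sum>b<n. scl [:a b:] (emb (q b))) \<in> NN P t"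
    using N0_NN[OF assms(1) emb_N0[OF a]] by (simp add: emb_sum emb_scl)
  then have rel: "(\<Sum>b<n. [:a b:] * co (emb (q b)) c) \<in> JJ P" if "c < n" for c
    using coN[of "\<Sum>b<n. scl [:a b:] (emb (q b))"] subsetD[OF L.N_part, of "\<Sum>b<n. scl [:a b:] (emb (q b))" t] that
    by (simp add: hom[OF co])
  have "\<delta> * [:a b:] \<in> JJ P"
    using matrix_relation[where C = "\<lambda>b. co (emb (q b))" and D = D and a = "\<lambda>b. [:a b:]" and j = b
        and J = "JJ P" and d = \<delta>, OF L.J _ _ b] D rel by blast
  then have "[:a b:] \<in> JJ P" by (rule L.J_sat[OF \<delta>])
  then obtain s where s: "s \<notin> PP P" "s * [:a b:] \<in> poly_ext I" unfolding JJ_def by blast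
  then obtain k where k: "coeff s k \<notin> P" unfolding PP_def poly_ext_def by blast
  have "coeff s k * a b \<in> I"
    using s(2) by (simp add: poly_ext_def mult.commute)
  with k show ?thesis by blast
qed

text \<open>Monomial vectors are constant in the new variable, so a basis selected among them makes
  sense over the base ring; comparing coefficients brings the spanning property down.\<close>

lemma descend_basis:
  assumes P: "prm P" and IP: "I \<subseteq> P" and "coord (PP P) (JJ P) p r n t (NN P t)"
  shows "\<exists>q. (\<forall>b<n. q b \<in> part p r t)
    \<and> (\<forall>m\<in>part p r t. \<exists>s a. s \<notin> P \<and> scl s m - (\<Sum>b<n. scl (a b) (q b)) \<in> N t)"
proof -
  interpret L: local_graded "PP P" "JJ P" p r "NN P" d0 by (rule local_graded[OF P IP])
  obtain co e \<sigma> where ic: "is_coord (PP P) (JJ P) p r n t (NN P t) co e \<sigma>" using assms(3) unfolding coord_def by blast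
  note co = is_coordD(1)[OF ic] and \<sigma> = is_coordD(2)[OF ic] and e = is_coordD(3)[OF ic]
    and coN = is_coordD(4)[OF ic] and coe = is_coordD(5)[OF ic]
  note PI = prm_idl[OF L.P]
  have "k \<le> n \<Longrightarrow> \<exists>q. (\<forall>b<k. q b \<in> part p r t) \<and> indep (PP P) n k (\<lambda>b. co (emb (q b)))" for k
  proof (induction k)
    case (Suc k)
    then obtain q where q: "\<forall>b<k. q b \<in> part p r t" and ind: "indep (PP P) n k (\<lambda>b. co (emb (q b)))" by auto
    obtain x c0 where c0: "c0 < n" "x c0 \<notin> PP P" and x: "\<And>i. i < k \<Longrightarrow> (\<Sum>c<n. co (emb (q i)) c * x c) = 0"
      using indep_annihilator[OF L.P ind] Suc.prems by auto
    \<comment> \<open>If all monomial vectors paired with \<open>x\<close> into \<open>P\<close>, so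
      would \<open>e c0\<close>, whose pairing is \<open>\<sigma> * x c0\<close> modulo
      \<open>P\<close>.\<close>
    have "\<exists>\<mu>\<in>mons p r t. (\<Sum>c<n. co (cvec \<mu>) c * x c) \<notin> PP P"
    proof (rule ccontr)
      assume none: "\<not> ?thesis"
      have "(\<Sum>c<n. co m c * x c) \<in> PP P" if m: "m \<in> part p r t" for m
      proof -
        have "co m c = (\<Sum>\<mu>\<in>mons p r t. m \<mu> * co (cvec \<mu>) c)" for c
          by (subst part_cvec_sum[OF m]) (simp add: hom[OF co])
        then have "(\<Sum>c<n. co m c * x c) = (\<Sum>\<mu>\<in>mons p r t. m \<mu> * (\<Sum>c<n. co (cvec \<mu>) c * x c))"
          unfolding sum_distrib_left sum_distrib_right by (subst sum.swap) (simp add: mult.assoc sum_distrib_right)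
        also have "\<dots> \<in> PP P"
          by (rule idl_sum[OF PI], rule idl_mult[OF PI]) (use none in blast)
        finally show ?thesis .
      qed
      from this[OF e[OF c0(1)]] have "(\<Sum>c<n. co (e c0) c * x c)
        - (\<Sum>c<n. (co (e c0) c - (if c0 = c then \<sigma> else 0)) * x c) \<in> PP P"
        by (rule idl_diff[OF PI], intro idl_sum[OF PI] idl_mult2[OF PI] subsetD[OF L.JP] coe c0) simp
      also have "(\<Sum>c<n. co (e c0) c * x c) - (\<Sum>c<n. (co (e c0) c - (if c0 = c then \<sigma> else 0)) * x c)
        = (\<Sum>c<n. if c = c0 then \<sigma> * x c else 0)"
        unfolding sum_subtractf[symmetric] by (rule sum.cong) (auto simp: algebra_simps)
      finally show False using c0 prm_mult[OF L.P \<sigma> c0(2)] by simp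
    qed
    then obtain \<mu> where \<mu>: "\<mu> \<in> mons p r t" and x\<mu>: "(\<Sum>c<n. co (emb (cvec \<mu>)) c * x c) \<notin> PP P"
      by (auto simp: emb_cvec)
    have "(\<lambda>b. co (emb ((q(k := cvec \<mu>)) b))) = (\<lambda>b. co (emb (q b)))(k := co (emb (cvec \<mu>)))" by auto
    then show ?case
      using indep_insert[OF L.P ind x x\<mu>] q cvec_part[OF \<mu>]
      by (intro exI[of _ "q(k := cvec \<mu>)"]) (auto simp: less_Suc_eq)
  qed (simp add: indep_def)
  then obtain q where q: "\<And>b. b < n \<Longrightarrow> q b \<in> part p r t" and ind: "indep (PP P) n n (\<lambda>b. co (emb (q b)))" by blast
  from indep_two_sided_inverse[OF L.P ind] obtain D \<delta> where \<delta>: "\<delta> \<notin> PP P"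
    and D: "diag_prod n n D (\<lambda>b. co (emb (q b))) \<delta>"
    by (elim exE conjE) (rule that)
  have "\<exists>s a. s \<notin> P \<and> scl s m - (\<Sum>b<n. scl (a b) (q b)) \<in> N t" if m: "m \<in> part p r t" for m
  proof -
    define g where "g b = (\<Sum>c<n. co (emb m) c * D c b)" for b
    let ?M = "scl \<delta> (emb m) - (\<Sum>b<n. scl (g b) (emb (q b)))"
    have "co ?M j = 0" if j: "j < n" for j
    proof -
      have "(\<Sum>b<n. g b * co (emb (q b)) j) = (\<Sum>c<n. co (emb m) c * (\<Sum>b<n. D c b * co (emb (q b)) j))"
        unfolding g_def sum_distrib_left sum_distrib_right by (subst sum.swap) (simp add: mult.assoc)
      also have "\<dots> = (\<Sum>c<n. if c = j then co (emb m) c * \<delta> else 0)"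
        by (rule sum.cong) (use D j in auto)
      finally show ?thesis
        using j by (simp add: hom[OF co] mult.commute)
    qed
    moreover have "?M \<in> part p r t"
      by (intro fm.subspace_diff fm.subspace_scale fm.subspace_sum subspace_part emb_part m q) auto
    ultimately have "?M \<in> NN P t" using coN[of ?M] idl_0[OF L.J] by simp
    then obtain s where s: "s \<notin> PP P" "scl s ?M \<in> N0 t" unfolding NN_def by blast
    have "s * \<delta> \<notin> PP P" using prm_mult[OF L.P s(1) \<delta>] .
    \<comment> \<open>The coefficient of \<open>s * \<delta>\<close> with this index is the
      denominator over the base ring.\<close>
    then obtain k where k: "coeff (s * \<delta>) k \<notin> P" unfolding PP_def poly_ext_def by blast
    have "cf k (scl s ?M) \<in> N t" using s(2) unfolding N0_def by blast
    also have "cf k (scl s ?M) = scl (coeff (s * \<delta>) k) m - (\<Sum>b<n. scl (coeff (s * g b) k) (q b))"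
      by (simp only: fm.scale_right_diff_distrib fm.scale_sum_right fm.scale_scale cf_diff cf_sum cf_scl_emb)
    finally show ?thesis using k by (intro exI conjI)
  qed
  then show ?thesis using q by blast
qed

text \<open>\<open>f\<close> is the product of the denominators for the finitely many monomial
  vectors. If no power of \<open>f\<close> annihilated a coefficient of a relation, the annihilator
  of that coefficient would lie in a prime avoiding \<open>f\<close>, at which the \<open>n\<close>
  spanning vectors form a basis.\<close>

lemma zariski_of_coord:
  assumes coord: "\<And>P. prm P \<Longrightarrow> I \<subseteq> P \<Longrightarrow> coord (PP P) (JJ P) p r n t (NN P t)"
  shows "zariski_free I n (part p r t) (N t)"
  unfolding zariski_free_def
proof (intro allI impI, elim conjE)
  fix P assume P: "prm P" and IP: "I \<subseteq> P"
  obtain q where q: "\<And>b. b < n \<Longrightarrow> q b \<in> part p r t"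
    and span: "\<forall>m\<in>part p r t. \<exists>s a. s \<notin> P \<and> scl s m - (\<Sum>b<n. scl (a b) (q b)) \<in> N t"
    using descend_basis[OF P IP coord[OF P IP]] by blast
  have "\<forall>\<mu>. \<exists>s a. \<mu> \<in> mons p r t \<longrightarrow> s \<notin> P \<and> scl s (cvec \<mu>) - (\<Sum>b<n. scl (a b) (q b)) \<in> N t"
    using span cvec_part by blast
  from choice2[OF this] obtain s a where s: "\<And>\<mu>. \<mu> \<in> mons p r t \<Longrightarrow> s \<mu> \<notin> P"
    and a: "\<And>\<mu>. \<mu> \<in> mons p r t \<Longrightarrow> scl (s \<mu>) (cvec \<mu>) - (\<Sum>b<n. scl (a \<mu> b) (q b)) \<in> N t" by blast
  define f where "f = (\<Prod>\<mu>\<in>mons p r t. s \<mu>)"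
  have f: "f \<notin> P" unfolding f_def by (rule prm_prod[OF P s])
  define c where "c \<mu> b = (\<Prod>\<nu>\<in>mons p r t - {\<mu>}. s \<nu>) * a \<mu> b" for \<mu> b
  have c: "scl f (cvec \<mu>) - (\<Sum>b<n. scl (c \<mu> b) (q b)) \<in> N t" if \<mu>: "\<mu> \<in> mons p r t" for \<mu>
  proof -
    have f_eq: "f = (\<Prod>\<nu>\<in>mons p r t - {\<mu>}. s \<nu>) * s \<mu>"
      unfolding f_def by (simp add: prod.remove[OF finite_mons \<mu>] mult.commute)
    have "scl (\<Prod>\<nu>\<in>mons p r t - {\<mu>}. s \<nu>) (scl (s \<mu>) (cvec \<mu>) - (\<Sum>b<n. scl (a \<mu> b) (q b))) \<in> N t"
      by (intro fm.subspace_scale[OF subspace_N] a \<mu>)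
    then show ?thesis
      by (simp only: fm.scale_right_diff_distrib fm.scale_sum_right fm.scale_scale f_eq c_def)
  qed
  have "\<exists>k a. scl (f ^ k) m - (\<Sum>b<n. scl (a b) (q b)) \<in> N t" if m: "m \<in> part p r t" for m
  proof -
    have "cf 0 (scl [:f:] (emb m) - (\<Sum>b<n. scl (\<Sum>\<mu>\<in>mons p r t. emb m \<mu> * [:c \<mu> b:]) (emb (q b)))) \<in> N t"
      using span_poly[OF c emb_part[OF m]] unfolding N0_def by blast
    then have "scl (f ^ 1) m - (\<Sum>b<n. scl (coeff (\<Sum>\<mu>\<in>mons p r t. emb m \<mu> * [:c \<mu> b:]) 0) (q b)) \<in> N t"
      by (simp only: cf_diff cf_sum cf_scl_const cf_scl_emb cf_emb power_one_right if_True simp_thms coeff_pCons_0)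
    then show ?thesis by (intro exI)
  qed
  moreover have "\<exists>k. \<forall>b<n. f ^ k * a b \<in> I" if rel: "(\<Sum>b<n. scl (a b) (q b)) \<in> N t" for a
  proof -
    have "\<exists>k. f ^ k * a b \<in> I" if b: "b < n" for b
    proof (rule ccontr)
      assume none: "\<not> ?thesis"
      let ?K = "{x. x * a b \<in> I}"
      have "idl ?K" using I unfolding idl_def by (auto simp: algebra_simps)
      from prime_avoiding[OF this, of f] none obtain P1 where P1: "prm P1" "?K \<subseteq> P1" and f1: "f \<notin> P1" by auto
      have IP1: "I \<subseteq> P1" using P1(2) idl_mult2[OF I] by blast
      interpret L: local_graded "PP P1" "JJ P1" p r "NN P1" d0 by (rule local_graded[OF P1(1) IP1])
      obtain co e \<sigma> where ic: "is_coord (PP P1) (JJ P1) p r n t (NN P1 t) co e \<sigma>"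
        using coord[OF P1(1) IP1] unfolding coord_def by blast
      note co = is_coordD(1)[OF ic] and \<sigma> = is_coordD(2)[OF ic] and e = is_coordD(3)[OF ic]
        and coN = is_coordD(4)[OF ic] and coe = is_coordD(5)[OF ic]
      have f1': "[:f:] \<notin> PP P1"
        using const_poly_ext[OF prm_idl[OF P1(1)]] f1 by (simp add: PP_def)
      \<comment> \<open>Since \<open>f\<close> lies outside \<open>P1\<close>, the
        \<open>q b\<close> span at \<open>P1\<close> as well, and the rank there is
        \<open>n\<close>.\<close>
      have "\<exists>D d. d \<notin> PP P1 \<and> diag_prod n n (\<lambda>b. co (emb (q b))) D d \<and> diag_prod n n D (\<lambda>b. co (emb (q b))) d"
      proof (rule spanning_two_sided_inverse[OF L.P f1' \<sigma>])
        show "co (e k) j - (if k = j then \<sigma> else 0) \<in> PP P1" if "k < n" "j < n" for k j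
          using subsetD[OF L.JP coe[OF that]] .
        fix k assume k: "k < n"
        define g where "g b = (\<Sum>\<mu>\<in>mons p r t. e k \<mu> * [:c \<mu> b:])" for b
        have "scl [:f:] (e k) - (\<Sum>b<n. scl (g b) (emb (q b))) \<in> NN P1 t"
          unfolding g_def by (intro N0_NN[OF P1(1)] span_poly c e k)
        then have "\<forall>j<n. [:f:] * co (e k) j - (\<Sum>b<n. g b * co (emb (q b)) j) \<in> PP P1"
          using coN[OF subsetD[OF L.N_part]] L.JP
          by (force simp: hom[OF co] simp del: mult_pCons_left)
        then show "\<exists>a. \<forall>j<n. [:f:] * co (e k) j - (\<Sum>b<n. a b * co (emb (q b)) j) \<in> PP P1" by (rule exI[of _ g])
      qed
      then obtain D \<delta> where \<delta>: "\<delta> \<notin> PP P1"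
        and D: "diag_prod n n (\<lambda>b. co (emb (q b))) D \<delta>"
        by (elim exE conjE) (rule that)
      have "\<exists>s. s \<notin> P1 \<and> s * a b \<in> I"
        by (rule descend_relation[where D = D, OF P1(1) IP1 co coN \<delta> _ rel b]) (use D in auto)
      then show False using P1(2) by blast
    qed
    then show ?thesis using power_common[OF I, of "{..<n}" f a] by auto
  qed
  ultimately have "basis_at I n (part p r t) (N t) f"
    unfolding basis_at_def using q by blast
  then show "\<exists>f. f \<notin> P \<and> basis_at I n (part p r t) (N t) f" using f by blast
qed

theorem zariski_free_persistence:
  assumes "n \<le> d0" "zariski_free I n (part p r d0) (N d0)" "zariski_free I n (part p r (Suc d0)) (N (Suc d0))" "d0 \<le> t"
  shows "zariski_free I n (part p r t) (N t)"
proof (rule zariski_of_coord)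
  fix P assume P: "prm P" "I \<subseteq> P"
  then have "coord (PP P) (JJ P) p r n d0 (NN P d0)" "coord (PP P) (JJ P) p r n (Suc d0) (NN P (Suc d0))"
    using assms(2,3) coord_of_basis[OF P] unfolding zariski_free_def by blast+
  then show "coord (PP P) (JJ P) p r n t (NN P t)"
    using coord_all[OF P assms(1)] assms(4) by blast
qed

end

section \<open>Commutative rings as quotients of a ring type\<close>

text \<open>The product of all commutative rings with carrier in a type; the factor of integers
  ensures \<open>0 \<noteq> 1\<close>.\<close>

typedef 'a uring = "{x :: int \<times> ('a ring \<Rightarrow> 'a). \<forall>B. (cring B \<longrightarrow> snd x B \<in> carrier B) \<and> (\<not> cring B \<longrightarrow> snd x B = undefined)}"
proof
  show "(0, \<lambda>B. if cring B then \<zero>\<^bsub>B\<^esub> else undefined) \<in> {x :: int \<times> ('a ring \<Rightarrow> 'a). \<forall>B. (cring B \<longrightarrow> snd x B \<in> carrier B) \<and> (\<not> cring B \<longrightarrow> snd x B = undefined)}"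
    by (auto intro: abelian_monoid.zero_closed cring.axioms(1) ring.axioms(1) abelian_group.axioms(1))
qed

setup_lifting type_definition_uring

instantiation uring :: (type) comm_ring_1
begin

lift_definition zero_uring :: "'a uring" is "(0, \<lambda>B. if cring B then \<zero>\<^bsub>B\<^esub> else undefined)"
  by (auto simp: cring.cring_simprules)

lift_definition one_uring :: "'a uring" is "(1, \<lambda>B. if cring B then \<one>\<^bsub>B\<^esub> else undefined)"
  by (auto simp: cring.cring_simprules)

lift_definition plus_uring :: "'a uring \<Rightarrow> 'a uring \<Rightarrow> 'a uring"
  is "\<lambda>(k, x) (l, y). (k + l, \<lambda>B. if cring B then x B \<oplus>\<^bsub>B\<^esub> y B else undefined)"
  by (auto simp: cring.cring_simprules)

lift_definition times_uring :: "'a uring \<Rightarrow> 'a uring \<Rightarrow> 'a uring"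
  is "\<lambda>(k, x) (l, y). (k * l, \<lambda>B. if cring B then x B \<otimes>\<^bsub>B\<^esub> y B else undefined)"
  by (auto simp: cring.cring_simprules)

lift_definition uminus_uring :: "'a uring \<Rightarrow> 'a uring"
  is "\<lambda>(k, x). (- k, \<lambda>B. if cring B then \<ominus>\<^bsub>B\<^esub> x B else undefined)"
  by (auto simp: cring.cring_simprules)

definition minus_uring :: "'a uring \<Rightarrow> 'a uring \<Rightarrow> 'a uring"
  where "minus_uring x y = x + - y"

instance
proof
  fix a b c :: "'a uring"
  show "a + b + c = a + (b + c)"
    by transfer (auto simp: fun_eq_iff cring.cring_simprules)
  show "a + b = b + a"
    by transfer (auto simp: fun_eq_iff cring.cring_simprules)
  show "0 + a = a"
    by transfer (auto simp: fun_eq_iff cring.cring_simprules split: if_splits)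
  show "- a + a = 0"
    by transfer (auto simp: fun_eq_iff cring.cring_simprules)
  show "a - b = a + - b" by (rule minus_uring_def)
  show "a * b * c = a * (b * c)"
    by transfer (auto simp: fun_eq_iff cring.cring_simprules)
  show "a * b = b * a"
    by transfer (auto simp: fun_eq_iff cring.cring_simprules)
  show "1 * a = a"
    by transfer (auto simp: fun_eq_iff monoid.l_one[OF ring.is_monoid[OF cring.axioms(1)]])
  show "(a + b) * c = a * c + b * c"
    by transfer (auto simp: fun_eq_iff cring.cring_simprules algebra_simps)
  show "0 \<noteq> (1 :: 'a uring)"
    by transfer auto
qed

end

lift_definition uring_proj :: "'a ring \<Rightarrow> 'a uring \<Rightarrow> 'a" is "\<lambda>B x. snd x B" .

lemma uring_proj_closed: "cring B \<Longrightarrow> uring_proj B x \<in> carrier B"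
  by transfer auto

text \<open>The factors of \<open>uring\<close> are indexed by plain ring records, so extra record
  fields have to be cut off first.\<close>

lemma cring_truncate:
  fixes A (structure)
  assumes "cring A"
  shows "cring (ring.truncate A)"
proof -
  interpret cring A by fact
  show ?thesis
    by (intro cringI abelian_groupI comm_monoidI)
      (use add.l_inv_ex in \<open>auto simp: ring.truncate_def m_ac a_ac r_distr\<close>)
qed

lemma
  fixes A (structure)
  assumes "cring A"
  shows uring_proj_add: "uring_proj (ring.truncate A) (x + y) = uring_proj (ring.truncate A) x \<oplus> uring_proj (ring.truncate A) y"
    and uring_proj_mult: "uring_proj (ring.truncate A) (x * y) = uring_proj (ring.truncate A) x \<otimes> uring_proj (ring.truncate A) y"
    and uring_proj_one: "uring_proj (ring.truncate A) 1 = \<one>"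
    and uring_proj_range: "range (uring_proj (ring.truncate A)) = carrier A"
proof -
  note A = cring_truncate[OF assms]
  show "uring_proj (ring.truncate A) (x + y) = uring_proj (ring.truncate A) x \<oplus> uring_proj (ring.truncate A) y"
    using A by transfer (auto simp: ring.truncate_def)
  show "uring_proj (ring.truncate A) (x * y) = uring_proj (ring.truncate A) x \<otimes> uring_proj (ring.truncate A) y"
    using A by transfer (auto simp: ring.truncate_def)
  show "uring_proj (ring.truncate A) 1 = \<one>"
    using A by transfer (auto simp: ring.truncate_def)
  show "range (uring_proj (ring.truncate A)) = carrier A"
  proof (intro equalityI subsetI)
    fix a assume "a \<in> range (uring_proj (ring.truncate A))"
    then show "a \<in> carrier A"
      using uring_proj_closed[OF A] by (auto simp: ring.truncate_def)
  next
    fix a assume a: "a \<in> carrier A"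
    \<comment> \<open>In a product any value can be prescribed in one factor, here with zeros in the
      others.\<close>
    define x where "x = (0 :: int, \<lambda>B. if B = ring.truncate A then a else if cring B then \<zero>\<^bsub>B\<^esub> else undefined)"
    have "uring_proj (ring.truncate A) (Abs_uring x) = a"
      unfolding uring_proj.rep_eq
      by (subst Abs_uring_inverse) (use A a in \<open>auto simp: x_def ring.truncate_def intro: cring.cring_simprules\<close>)
    then show "a \<in> range (uring_proj (ring.truncate A))" by blast
  qed
qed

section \<open>Rings presented as quotients, and their primes\<close>

locale cring_pres =
  fixes A :: "('a, 'b) ring_scheme" and \<phi> :: "'r::comm_ring_1 \<Rightarrow> 'a"
  assumes cring: "cring A" and phi_range: "range \<phi> = carrier A"
    and phi_add: "\<phi> (x + y) = \<phi> x \<oplus>\<^bsub>A\<^esub> \<phi> y" and phi_mult: "\<phi> (x * y) = \<phi> x \<otimes>\<^bsub>A\<^esub> \<phi> y"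
    and phi_one: "\<phi> 1 = \<one>\<^bsub>A\<^esub>"
begin

interpretation A: cring A by (rule cring)

lemma phi_closed: "\<phi> x \<in> carrier A"
  using phi_range by blast

lemma phi_zero: "\<phi> 0 = \<zero>\<^bsub>A\<^esub>"
  using phi_add[of 0 0] phi_closed[of 0] by (metis A.add.r_cancel_one add_0)

definition ker :: "'r set" where "ker = {x. \<phi> x = \<zero>\<^bsub>A\<^esub>}"

lemma phi_eq_iff: "\<phi> x = \<phi> y \<longleftrightarrow> x - y \<in> ker"
proof -
  have "\<phi> x = \<phi> (x - y) \<oplus>\<^bsub>A\<^esub> \<phi> y" by (simp flip: phi_add)
  then show ?thesis unfolding ker_def using phi_closed by auto
qed

lemma idl_ker: "idl ker"
  unfolding idl_def ker_def using phi_closed by (auto simp: phi_zero phi_add phi_mult)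

lemma phi_power: "\<phi> (x ^ k) = \<phi> x [^]\<^bsub>A\<^esub> k"
  by (induction k) (auto simp: phi_one phi_mult power_Suc2 simp del: power_Suc)

lemma powers_eq: "powers A (\<phi> f) = range (\<lambda>k. \<phi> (f ^ k))"
  by (simp add: powers_def phi_power)

lemma prm_vimage:
  assumes "primeideal P A"
  shows "prm (\<phi> -` P)" "ker \<subseteq> \<phi> -` P"
proof -
  interpret P: primeideal P A by fact
  show "prm (\<phi> -` P)"
    unfolding prm_def idl_def
  proof (intro conjI allI ballI impI)
    show "1 \<notin> \<phi> -` P" using P.I_notcarr P.one_imp_carrier by (auto simp: phi_one)
    fix a b assume "a * b \<in> \<phi> -` P"
    then show "a \<in> \<phi> -` P \<or> b \<in> \<phi> -` P" using P.I_prime phi_closed by (auto simp: phi_mult)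
  qed (use phi_closed in \<open>auto simp: phi_zero phi_add phi_mult P.I_l_closed\<close>)
  show "ker \<subseteq> \<phi> -` P" by (auto simp: ker_def)
qed

lemma phi_image_iff:
  assumes "idl P" "ker \<subseteq> P"
  shows "\<phi> x \<in> \<phi> ` P \<longleftrightarrow> x \<in> P"
proof
  assume "\<phi> x \<in> \<phi> ` P"
  then obtain y where "y \<in> P" "x - y \<in> ker" by (auto simp: phi_eq_iff)
  then show "x \<in> P" using idl_add[OF assms(1), of "x - y" y] assms(2) by auto
qed blast

text \<open>With \<open>prm_vimage\<close> this matches the primes of \<open>A\<close> with the
  primes containing \<open>ker\<close>, over which \<open>zariski_free\<close> quantifies.\<close>

lemma primeideal_image:
  assumes P: "prm P" "ker \<subseteq> P"
  shows "primeideal (\<phi> ` P) A"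
proof (rule primeidealI)
  note mem = phi_image_iff[OF prm_idl[OF P(1)] P(2)]
  have P_: "idl P" by (rule prm_idl[OF P(1)])
  have lift: "\<exists>y. x = \<phi> y" if "x \<in> carrier A" for x using phi_range that by blast
  show "ideal (\<phi> ` P) A"
  proof (rule idealI)
    show "ring A" by (rule A.ring_axioms)
    show "subgroup (\<phi> ` P) (add_monoid A)"
    proof (rule A.add.subgroupI)
      fix a assume "a \<in> \<phi> ` P"
      then obtain x where x: "a = \<phi> x" "x \<in> P" by blast
      have "\<phi> (- x) \<oplus>\<^bsub>A\<^esub> \<phi> x = \<zero>\<^bsub>A\<^esub>" by (simp add: phi_zero flip: phi_add)
      then have "\<ominus>\<^bsub>A\<^esub> a = \<phi> (- x)" unfolding x(1) by (rule A.minus_equality) (auto simp: phi_closed)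
      then show "\<ominus>\<^bsub>A\<^esub> a \<in> \<phi> ` P" using idl_uminus[OF P_ x(2)] by (simp add: mem)
    next
      fix a b assume "a \<in> \<phi> ` P" "b \<in> \<phi> ` P"
      then show "a \<oplus>\<^bsub>A\<^esub> b \<in> \<phi> ` P" using idl_add[OF P_] by (auto simp flip: phi_add)
    qed (use phi_closed idl_0[OF P_] in auto)
    fix a x assume "a \<in> \<phi> ` P" "x \<in> carrier A"
    then obtain y z where "a = \<phi> y" "y \<in> P" "x = \<phi> z" using lift by blast
    then show "x \<otimes>\<^bsub>A\<^esub> a \<in> \<phi> ` P" "a \<otimes>\<^bsub>A\<^esub> x \<in> \<phi> ` P"
      using idl_mult[OF P_] idl_mult2[OF P_] by (auto simp: mem simp flip: phi_mult)
  qed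
  show "cring A" by (rule cring)
  show "carrier A \<noteq> \<phi> ` P"
    using prm_1[OF P(1)] mem[of 1] phi_closed[of 1] by blast
  fix a b assume "a \<in> carrier A" "b \<in> carrier A" "a \<otimes>\<^bsub>A\<^esub> b \<in> \<phi> ` P"
  then obtain x y where "a = \<phi> x" "b = \<phi> y" "x * y \<in> P" using lift by (metis mem phi_mult)
  then show "a \<in> \<phi> ` P \<or> b \<in> \<phi> ` P" using P(1) unfolding prm_def by blast
qed

end

section \<open>Localizations of presented modules\<close>

text \<open>The \<open>A\<close>-module \<open>Q\<close> is identified with \<open>V / K\<close>, and \<open>fr x k\<close> below is the fraction \<open>x / f\<^sup>k\<close>.\<close>

locale module_pres = cring_pres A \<phi> + sm: Modules.module s
  for A :: "('a, 'b) ring_scheme" and \<phi> :: "'r::comm_ring_1 \<Rightarrow> 'a" and s :: "'r \<Rightarrow> 'v::ab_group_add \<Rightarrow> 'v" +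
  fixes V K :: "'v set" and \<kappa> :: "'v \<Rightarrow> 'c" and Q :: "('a, 'c, 'd) module_scheme" and f :: 'r
  assumes subspace_V: "sm.subspace V" and subspace_K: "sm.subspace K"
    and kappa_image: "\<kappa> ` V = carrier Q"
    and kappa_eq_iff: "x \<in> V \<Longrightarrow> y \<in> V \<Longrightarrow> \<kappa> x = \<kappa> y \<longleftrightarrow> x - y \<in> K"
    and kappa_add: "x \<in> V \<Longrightarrow> y \<in> V \<Longrightarrow> \<kappa> (x + y) = \<kappa> x \<oplus>\<^bsub>Q\<^esub> \<kappa> y"
    and kappa_scale: "x \<in> V \<Longrightarrow> \<kappa> (s a x) = \<phi> a \<odot>\<^bsub>Q\<^esub> \<kappa> x"
begin

lemma kappa_closed: "x \<in> V \<Longrightarrow> \<kappa> x \<in> carrier Q"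
  using kappa_image by blast

lemmas V_closed = sm.subspace_add[OF subspace_V] sm.subspace_scale[OF subspace_V] sm.subspace_0[OF subspace_V]
  sm.subspace_sum[OF subspace_V]

lemma ker_K:
  assumes "a \<in> ker" "x \<in> V"
  shows "s a x \<in> K"
proof -
  have "\<phi> a = \<phi> 0" using assms(1) by (simp add: ker_def phi_zero)
  then have "\<kappa> (s a x) = \<kappa> (s 0 x)" using assms(2) by (simp only: kappa_scale)
  then show ?thesis using kappa_eq_iff[of "s a x" "s 0 x"] assms(2) V_closed by auto
qed

abbreviation pw :: "'a set" where "pw \<equiv> powers A (\<phi> f)"

definition rel :: "'v \<Rightarrow> nat \<Rightarrow> 'v \<Rightarrow> nat \<Rightarrow> bool"
  where "rel x k y l \<longleftrightarrow> (\<exists>j. s (f ^ j) (s (f ^ l) x - s (f ^ k) y) \<in> K)"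

definition fr :: "'v \<Rightarrow> nat \<Rightarrow> ('c \<times> 'a) set"
  where "fr x k = fraction pw Q (\<kappa> x) (\<phi> (f ^ k))"

lemma frac_rel_iff:
  assumes "x \<in> V" "y \<in> V"
  shows "((\<kappa> x, \<phi> (f ^ k)), (\<kappa> y, \<phi> (f ^ l))) \<in> frac_rel pw Q \<longleftrightarrow> rel x k y l"
proof -
  have "\<phi> (f ^ j) \<odot>\<^bsub>Q\<^esub> (\<phi> (f ^ l) \<odot>\<^bsub>Q\<^esub> \<kappa> x) = \<phi> (f ^ j) \<odot>\<^bsub>Q\<^esub> (\<phi> (f ^ k) \<odot>\<^bsub>Q\<^esub> \<kappa> y)
      \<longleftrightarrow> s (f ^ j) (s (f ^ l) x - s (f ^ k) y) \<in> K" for j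
  proof -
    have "\<phi> (f ^ j) \<odot>\<^bsub>Q\<^esub> (\<phi> (f ^ l) \<odot>\<^bsub>Q\<^esub> \<kappa> x) = \<kappa> (s (f ^ j) (s (f ^ l) x))"
      "\<phi> (f ^ j) \<odot>\<^bsub>Q\<^esub> (\<phi> (f ^ k) \<odot>\<^bsub>Q\<^esub> \<kappa> y) = \<kappa> (s (f ^ j) (s (f ^ k) y))"
      using assms V_closed(2) by (simp_all only: kappa_scale)
    then show ?thesis
      using assms V_closed(2) by (simp only: kappa_eq_iff sm.scale_right_diff_distrib)
  qed
  then show ?thesis
    using assms kappa_closed by (auto simp: frac_rel_def rel_def powers_eq)
qed

lemma rel_refl: "rel x k x k"
  unfolding rel_def using sm.subspace_0[OF subspace_K] by simp

lemma rel_sym: "rel x k y l \<Longrightarrow> rel y l x k"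
  unfolding rel_def using sm.subspace_neg[OF subspace_K]
  by (metis minus_diff_eq sm.scale_minus_right)

lemma rel_trans:
  assumes "rel x k y l" "rel y l z m"
  shows "rel x k z m"
proof -
  obtain i j where 1: "s (f ^ i) (s (f ^ l) x - s (f ^ k) y) \<in> K" and 2: "s (f ^ j) (s (f ^ m) y - s (f ^ l) z) \<in> K"
    using assms unfolding rel_def by blast
  have "s (f ^ (j + m)) (s (f ^ i) (s (f ^ l) x - s (f ^ k) y)) + s (f ^ (i + k)) (s (f ^ j) (s (f ^ m) y - s (f ^ l) z)) \<in> K"
    by (intro sm.subspace_add[OF subspace_K] sm.subspace_scale[OF subspace_K] 1 2)
  also have "s (f ^ (j + m)) (s (f ^ i) (s (f ^ l) x - s (f ^ k) y)) + s (f ^ (i + k)) (s (f ^ j) (s (f ^ m) y - s (f ^ l) z))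
    = s (f ^ (i + j + l)) (s (f ^ m) x - s (f ^ k) z)"
    by (simp add: sm.scale_right_diff_distrib power_add mult_ac)
  finally show ?thesis unfolding rel_def by blast
qed

lemma fr_alt:
  assumes "x \<in> V"
  shows "fr x k = {(\<kappa> y, \<phi> (f ^ l)) | y l. y \<in> V \<and> rel x k y l}"
proof (intro equalityI subsetI)
  fix z assume "z \<in> fr x k"
  then have z: "((\<kappa> x, \<phi> (f ^ k)), z) \<in> frac_rel pw Q" by (simp add: fr_def fraction_def)
  then obtain y l where "y \<in> V" "z = (\<kappa> y, \<phi> (f ^ l))"
    by (auto simp: frac_rel_def powers_eq simp flip: kappa_image)
  with z show "z \<in> {(\<kappa> y, \<phi> (f ^ l)) | y l. y \<in> V \<and> rel x k y l}"
    using frac_rel_iff[OF assms] by blast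
qed (use frac_rel_iff[OF assms] in \<open>auto simp: fr_def fraction_def\<close>)

lemma fr_eq_iff:
  assumes "x \<in> V" "y \<in> V"
  shows "fr x k = fr y l \<longleftrightarrow> rel x k y l"
proof
  assume eq: "fr x k = fr y l"
  have "(\<kappa> y, \<phi> (f ^ l)) \<in> fr y l" using assms(2) rel_refl by (auto simp: fr_alt)
  then have "((\<kappa> x, \<phi> (f ^ k)), (\<kappa> y, \<phi> (f ^ l))) \<in> frac_rel pw Q"
    unfolding eq[symmetric] by (simp add: fr_def fraction_def)
  then show "rel x k y l" using frac_rel_iff[OF assms] by blast
next
  assume "rel x k y l"
  then have "rel x k z m \<longleftrightarrow> rel y l z m" for z m using rel_trans rel_sym by blast
  then show "fr x k = fr y l" using assms by (simp add: fr_alt)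
qed

lemma carrier_loc: "carrier (loc_module A pw Q) = {fr x k | x k. x \<in> V}"
proof -
  have "carrier (loc_module A pw Q) = (\<lambda>z. frac_rel pw Q `` {z}) ` (carrier Q \<times> pw)"
    by (auto simp: loc_module_def quotient_def)
  also have "\<dots> = {fr x k | x k. x \<in> V}"
    unfolding powers_eq fr_def fraction_def kappa_image[symmetric] by auto
  finally show ?thesis .
qed

text \<open>Operations on fractions are unions over all representatives; they collapse when the
  value is the same for each.\<close>

lemma loc_UN:
  assumes x: "x \<in> V"
    and F: "\<And>y l. y \<in> V \<Longrightarrow> rel x k y l \<Longrightarrow> F (\<kappa> y) (\<phi> (f ^ l)) = c"
  shows "(\<Union>(z, t)\<in>fr x k. F z t) = c"
proof -
  have "(\<kappa> x, \<phi> (f ^ k)) \<in> fr x k" using x rel_refl by (auto simp: fr_alt)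
  moreover have "F z t = c" if "(z, t) \<in> fr x k" for z t using that F x by (auto simp: fr_alt)
  ultimately show ?thesis by (force split: prod.splits)
qed

lemma add_loc:
  assumes x: "x \<in> V" and y: "y \<in> V"
  shows "fr x k \<oplus>\<^bsub>loc_module A pw Q\<^esub> fr y l = fr (s (f ^ l) x + s (f ^ k) y) (k + l)"
proof -
  have "(\<Union>(z, t)\<in>fr x k. \<Union>(w, u)\<in>fr y l. fraction pw Q (u \<odot>\<^bsub>Q\<^esub> z \<oplus>\<^bsub>Q\<^esub> t \<odot>\<^bsub>Q\<^esub> w) (t \<otimes>\<^bsub>A\<^esub> u))
    = fr (s (f ^ l) x + s (f ^ k) y) (k + l)"
  proof (rule loc_UN[OF x], rule loc_UN[OF y])
    fix z m w n assume z: "z \<in> V" "rel x k z m" and w: "w \<in> V" "rel y l w n"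
    obtain i j where 1: "s (f ^ i) (s (f ^ m) x - s (f ^ k) z) \<in> K" and 2: "s (f ^ j) (s (f ^ n) y - s (f ^ l) w) \<in> K"
      using z w unfolding rel_def by blast
    have "fraction pw Q (\<phi> (f ^ n) \<odot>\<^bsub>Q\<^esub> \<kappa> z \<oplus>\<^bsub>Q\<^esub> \<phi> (f ^ m) \<odot>\<^bsub>Q\<^esub> \<kappa> w) (\<phi> (f ^ m) \<otimes>\<^bsub>A\<^esub> \<phi> (f ^ n))
      = fr (s (f ^ n) z + s (f ^ m) w) (m + n)"
      using z w V_closed by (simp add: fr_def kappa_add kappa_scale phi_mult power_add)
    also have "\<dots> = fr (s (f ^ l) x + s (f ^ k) y) (k + l)"
    proof (subst fr_eq_iff)
      \<comment> \<open>Each equality of fractions is multiplied by the denominators of the other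
        summand; the sum is the cross-multiplied difference with exponent
        \<open>i + j\<close>.\<close>
      have "s (f ^ (j + n + l)) (s (f ^ i) (s (f ^ m) x - s (f ^ k) z)) + s (f ^ (i + m + k)) (s (f ^ j) (s (f ^ n) y - s (f ^ l) w)) \<in> K"
        by (intro sm.subspace_add[OF subspace_K] sm.subspace_scale[OF subspace_K] 1 2)
      also have "s (f ^ (j + n + l)) (s (f ^ i) (s (f ^ m) x - s (f ^ k) z)) + s (f ^ (i + m + k)) (s (f ^ j) (s (f ^ n) y - s (f ^ l) w))
        = s (f ^ (i + j)) (s (f ^ (m + n)) (s (f ^ l) x + s (f ^ k) y) - s (f ^ (k + l)) (s (f ^ n) z + s (f ^ m) w))"
        by (simp add: sm.scale_right_diff_distrib sm.scale_right_distrib power_add mult_ac)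
      finally have "rel (s (f ^ l) x + s (f ^ k) y) (k + l) (s (f ^ n) z + s (f ^ m) w) (m + n)"
        unfolding rel_def by blast
      then show "rel (s (f ^ n) z + s (f ^ m) w) (m + n) (s (f ^ l) x + s (f ^ k) y) (k + l)" by (rule rel_sym)
    qed (use x y z w V_closed in auto)
    finally show "fraction pw Q (\<phi> (f ^ n) \<odot>\<^bsub>Q\<^esub> \<kappa> z \<oplus>\<^bsub>Q\<^esub> \<phi> (f ^ m) \<odot>\<^bsub>Q\<^esub> \<kappa> w) (\<phi> (f ^ m) \<otimes>\<^bsub>A\<^esub> \<phi> (f ^ n))
      = fr (s (f ^ l) x + s (f ^ k) y) (k + l)" .
  qed
  then show ?thesis by (simp add: loc_module_def)
qed

lemma add_loc_same:
  assumes "x \<in> V" "y \<in> V"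
  shows "fr x k \<oplus>\<^bsub>loc_module A pw Q\<^esub> fr y k = fr (x + y) k"
proof -
  have "rel (s (f ^ k) x + s (f ^ k) y) (k + k) (x + y) k"
    unfolding rel_def using sm.subspace_0[OF subspace_K]
    by (intro exI[of _ 0]) (simp add: sm.scale_right_distrib power_add)
  then show ?thesis using assms V_closed by (simp add: add_loc fr_eq_iff)
qed

lemma fr_scale: "x \<in> V \<Longrightarrow> fr (s (f ^ j) x) (j + k) = fr x k"
  using V_closed sm.subspace_0[OF subspace_K]
  by (simp add: fr_eq_iff) (auto simp: rel_def power_add mult_ac intro!: exI[of _ 0])

end

text \<open>Makes the localized ring an instance of the localized modules, so one calculus of
  fractions covers both.\<close>

lemma (in cring_pres) self_pres: "module_pres A \<phi> (*) UNIV ker \<phi> (self_module A)"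
proof -
  interpret m: Modules.module "(*) :: 'r \<Rightarrow> 'r \<Rightarrow> 'r"
    by standard (auto simp: algebra_simps)
  show ?thesis
  proof
    show "m.subspace ker" using idl_ker by (auto simp: m.subspace_def idl_def)
  qed (auto simp: self_module_def phi_range phi_eq_iff phi_add phi_mult phi_zero)
qed

context module_pres
begin

interpretation self: module_pres A \<phi> "(*)" UNIV ker \<phi> "self_module A" f
  by (rule self_pres)

lemma smult_loc:
  assumes y: "y \<in> V"
  shows "self.fr a k \<odot>\<^bsub>loc_module A pw Q\<^esub> fr y l = fr (s a y) (k + l)"
proof -
  have "(\<Union>(z, t)\<in>self.fr a k. \<Union>(w, u)\<in>fr y l. fraction pw Q (z \<odot>\<^bsub>Q\<^esub> w) (t \<otimes>\<^bsub>A\<^esub> u)) = fr (s a y) (k + l)"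
  proof (rule self.loc_UN[OF UNIV_I], rule loc_UN[OF y])
    fix z m w n assume z: "self.rel a k z m" and w: "w \<in> V" "rel y l w n"
    obtain i j where 1: "f ^ i * (f ^ m * a - f ^ k * z) \<in> ker" and 2: "s (f ^ j) (s (f ^ n) y - s (f ^ l) w) \<in> K"
      using z w unfolding self.rel_def rel_def by blast
    have "fraction pw Q (\<phi> z \<odot>\<^bsub>Q\<^esub> \<kappa> w) (\<phi> (f ^ m) \<otimes>\<^bsub>A\<^esub> \<phi> (f ^ n)) = fr (s z w) (m + n)"
      using w by (simp add: fr_def kappa_scale phi_mult power_add)
    also have "\<dots> = fr (s a y) (k + l)"
    proof (subst fr_eq_iff)
      have "s (f ^ (j + n)) (s (f ^ i * (f ^ m * a - f ^ k * z)) y) + s (f ^ (i + k) * z) (s (f ^ j) (s (f ^ n) y - s (f ^ l) w)) \<in> K"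
        by (intro sm.subspace_add[OF subspace_K] sm.subspace_scale[OF subspace_K] ker_K 1 2 y)
      also have "s (f ^ (j + n)) (s (f ^ i * (f ^ m * a - f ^ k * z)) y) + s (f ^ (i + k) * z) (s (f ^ j) (s (f ^ n) y - s (f ^ l) w))
        = s (f ^ (i + j)) (s (f ^ (m + n)) (s a y) - s (f ^ (k + l)) (s z w))"
      proof -
        have c1: "f ^ (i + j) * (f ^ (m + n) * a) = f ^ (j + n) * (f ^ i * (f ^ m * a - f ^ k * z)) + f ^ (i + k) * (z * (f ^ j * f ^ n))"
        proof -
          have "I * J * (M * N * a) = J * N * (I * (M * a - k' * z)) + I * k' * (z * (J * N))" for I J M N k'
            by (simp only: right_diff_distrib mult_ac diff_add_cancel)
          then show ?thesis by (simp only: power_add)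
        qed
        have c2: "f ^ (i + j) * (f ^ (k + l) * z) = f ^ (i + k) * (z * (f ^ j * f ^ l))"
          by (simp only: power_add mult_ac)
        show ?thesis
          by (simp only: sm.scale_right_diff_distrib sm.scale_scale mult.assoc c1 c2 sm.scale_left_distrib add_diff_eq)
      qed
      finally have "rel (s a y) (k + l) (s z w) (m + n)" unfolding rel_def by blast
      then show "rel (s z w) (m + n) (s a y) (k + l)" by (rule rel_sym)
    qed (use y w V_closed in auto)
    finally show "fraction pw Q (\<phi> z \<odot>\<^bsub>Q\<^esub> \<kappa> w) (\<phi> (f ^ m) \<otimes>\<^bsub>A\<^esub> \<phi> (f ^ n)) = fr (s a y) (k + l)" .
  qed
  then show ?thesis by (simp add: loc_module_def)
qed

end

context module_pres
begin

interpretation self: module_pres A \<phi> "(*)" UNIV ker \<phi> "self_module A" f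
  by (rule self_pres)

section \<open>Free modules over a localization\<close>

abbreviation LR :: "('a \<times> 'a) set ring" where "LR \<equiv> loc_ring A pw"
abbreviation LM :: "(('a \<times> 'a) set, ('c \<times> 'a) set) module" where "LM \<equiv> loc_module A pw Q"

definition vec :: "nat \<Rightarrow> (nat \<Rightarrow> 'r) \<Rightarrow> nat \<Rightarrow> nat \<Rightarrow> ('a \<times> 'a) set"
  where "vec n a k = (\<lambda>i\<in>{1..n}. self.fr (a i) k)"

lemma vec_eq_iff: "vec n a k = vec n b l \<longleftrightarrow> (\<forall>i\<in>{1..n}. self.rel (a i) k (b i) l)"
proof -
  have "vec n a k = vec n b l \<longleftrightarrow> (\<forall>i\<in>{1..n}. self.fr (a i) k = self.fr (b i) l)"
    by (auto simp: vec_def fun_eq_iff restrict_def)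
  then show ?thesis by (simp add: self.fr_eq_iff)
qed

lemma vec_rel_common:
  assumes "vec n a k = vec n b l"
  obtains j where "\<And>i. i \<in> {1..n} \<Longrightarrow> f ^ j * (f ^ l * a i - f ^ k * b i) \<in> ker"
proof -
  have "\<And>i. i \<in> {1..n} \<Longrightarrow> \<exists>j. f ^ j * (f ^ l * a i - f ^ k * b i) \<in> ker"
    using assms unfolding vec_eq_iff self.rel_def by blast
  then have "\<exists>j. \<forall>i\<in>{1..n}. f ^ j * (f ^ l * a i - f ^ k * b i) \<in> ker"
    by (intro power_common[OF idl_ker]) auto
  then show thesis using that by blast
qed

lemma carrier_LR: "carrier LR = {self.fr a k | a k. True}"
  using self.carrier_loc by (simp add: loc_ring_def Let_def)

text \<open>The finitely many entries are brought to a common denominator.\<close>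

lemma carrier_free: "carrier (free_module LR n) = {vec n a k | a k. True}"
proof (intro equalityI subsetI)
  fix v assume "v \<in> carrier (free_module LR n)"
  then have v: "v \<in> extensional {1..n}" "\<And>i. i \<in> {1..n} \<Longrightarrow> v i \<in> carrier LR"
    by (auto simp: free_module_def PiE_def)
  then have "\<forall>i. \<exists>a k. i \<in> {1..n} \<longrightarrow> v i = self.fr a k" unfolding carrier_LR by blast
  from choice2[OF this] obtain a k where a: "\<And>i. i \<in> {1..n} \<Longrightarrow> v i = self.fr (a i) (k i)" by blast
  define S where "S = (\<Sum>i\<in>{1..n}. k i)"
  have "v = vec n (\<lambda>i. f ^ (S - k i) * a i) S"
  proof (rule extensionalityI[OF v(1)])
    fix i assume i: "i \<in> {1..n}"
    have "k i \<le> S" unfolding S_def using i by (intro member_le_sum) auto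
    then show "v i = vec n (\<lambda>i. f ^ (S - k i) * a i) S i"
      using self.fr_scale[of "a i" "S - k i" "k i"] i a by (simp add: vec_def)
  qed (simp add: vec_def)
  then show "v \<in> {vec n a k | a k. True}" by blast
next
  fix v assume "v \<in> {vec n a k | a k. True}"
  then obtain a k where v: "v = vec n a k" by blast
  have "self.fr (a i) k \<in> carrier LR" for i unfolding carrier_LR by blast
  then show "v \<in> carrier (free_module LR n)" by (simp add: v free_module_def vec_def)
qed

lemma add_free: "vec n a k \<oplus>\<^bsub>free_module LR n\<^esub> vec n b l = vec n (\<lambda>i. f ^ l * a i + f ^ k * b i) (k + l)"
  using self.add_loc[OF UNIV_I UNIV_I]
  by (auto simp: free_module_def vec_def loc_ring_def Let_def restrict_def fun_eq_iff)

lemma smult_free: "self.fr c l \<odot>\<^bsub>free_module LR n\<^esub> vec n a k = vec n (\<lambda>i. c * a i) (l + k)"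
  using self.smult_loc[OF UNIV_I]
  by (auto simp: free_module_def vec_def loc_ring_def Let_def restrict_def fun_eq_iff)

definition free_basis :: "nat \<Rightarrow> bool"
  where "free_basis n \<longleftrightarrow> (\<exists>q. (\<forall>b<n. q b \<in> V)
    \<and> (\<forall>m\<in>V. \<exists>k a. s (f ^ k) m - (\<Sum>b<n. s (a b) (q b)) \<in> K)
    \<and> (\<forall>a. (\<Sum>b<n. s (a b) (q b)) \<in> K \<longrightarrow> (\<exists>k. \<forall>b<n. f ^ k * a b \<in> ker)))"

lemma sum_from_1: "(\<Sum>i\<in>{1..n}. g i) = (\<Sum>b<n. g (Suc b))" for g :: "nat \<Rightarrow> 'v"
  by (rule sum.reindex_bij_witness[of _ Suc "\<lambda>i. i - 1"]) auto

lemma free_of_rank_imp_basis: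
  assumes "free_of_rank LR LM n"
  shows "free_basis n"
proof -
  obtain h where bij: "bij_betw h (carrier (free_module LR n)) (carrier LM)"
    and h_add: "\<And>x y. x \<in> carrier (free_module LR n) \<Longrightarrow> y \<in> carrier (free_module LR n) \<Longrightarrow>
      h (x \<oplus>\<^bsub>free_module LR n\<^esub> y) = h x \<oplus>\<^bsub>LM\<^esub> h y"
    and h_smult: "\<And>a x. a \<in> carrier LR \<Longrightarrow> x \<in> carrier (free_module LR n) \<Longrightarrow>
      h (a \<odot>\<^bsub>free_module LR n\<^esub> x) = a \<odot>\<^bsub>LM\<^esub> h x"
    using assms unfolding free_of_rank_def module_iso_def by blast
  have vec: "vec n a k \<in> carrier (free_module LR n)" for a k by (auto simp: carrier_free)
  have fr_LR: "self.fr a k \<in> carrier LR" for a k by (auto simp: carrier_LR)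
  define \<epsilon> where "\<epsilon> i = vec n (\<lambda>j. if j = i then 1 else 0) 0" for i
  have "\<exists>x k. x \<in> V \<and> h (\<epsilon> i) = fr x k" for i
    using bij_betwE[OF bij] vec[of "\<lambda>j. if j = i then 1 else 0" 0] unfolding \<epsilon>_def carrier_loc by blast
  then obtain x k where x: "\<And>i. x i \<in> V" and hx: "\<And>i. h (\<epsilon> i) = fr (x i) (k i)" by metis
  define S where "S = (\<Sum>i\<in>{1..n}. k i)"
  define y where "y i = s (f ^ (S - k i)) (x i)" for i
  have y: "y i \<in> V" for i unfolding y_def by (intro V_closed x)
  have hy: "h (\<epsilon> i) = fr (y i) S" if "i \<in> {1..n}" for i
  proof -
    have "k i \<le> S" unfolding S_def using that by (intro member_le_sum) auto
    then show ?thesis using fr_scale[OF x, of "S - k i" i "k i"] by (simp add: hx y_def)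
  qed
  \<comment> \<open>\<open>module_iso\<close> does not mention zero; that zero goes to zero follows
    by scaling with 0.\<close>
  have h0: "h (vec n (\<lambda>_. 0) l) = fr 0 m" for l m
  proof -
    obtain z o' where z: "z \<in> V" "h (vec n (\<lambda>_. 0) l) = fr z o'"
      using bij_betwE[OF bij] vec[of "\<lambda>_. 0" l] unfolding carrier_loc by blast
    have "h (vec n (\<lambda>_. 0) l) = h (self.fr 0 0 \<odot>\<^bsub>free_module LR n\<^esub> vec n (\<lambda>_. 0) l)"
      by (simp add: smult_free)
    also have "\<dots> = fr (s 0 z) (0 + o')"
      by (simp only: h_smult fr_LR vec z(2) smult_loc[OF z(1)])
    also have "\<dots> = fr 0 m"
      using V_closed by (simp add: fr_eq_iff) (auto simp: rel_def sm.subspace_0[OF subspace_K])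
    finally show ?thesis .
  qed
  have h_vec: "h (vec n a l) = fr (\<Sum>i\<in>{1..n}. s (a i) (y i)) (l + S)" for a l
  proof -
    have "h (vec n (\<lambda>i. if i \<le> j then a i else 0) l) = fr (\<Sum>i\<in>{1..j}. s (a i) (y i)) (l + S)" if "j \<le> n" for j
      using that
    proof (induction j)
      case 0
      have "vec n (\<lambda>i. if i \<le> 0 then a i else 0) l = vec n (\<lambda>_. 0) l" by (auto simp: vec_def fun_eq_iff)
      then show ?case using h0 by simp
    next
      case (Suc j)
      let ?u = "vec n (\<lambda>i. if i \<le> j then a i else 0) l" and ?w = "self.fr (a (Suc j)) l \<odot>\<^bsub>free_module LR n\<^esub> \<epsilon> (Suc j)"
      have w: "?w = vec n (\<lambda>i. if i = Suc j then a i else 0) l"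
        unfolding \<epsilon>_def smult_free by (auto simp: vec_def fun_eq_iff)
      have "?u \<oplus>\<^bsub>free_module LR n\<^esub> ?w = vec n (\<lambda>i. if i \<le> Suc j then a i else 0) l"
        unfolding w add_free vec_eq_iff self.rel_def
      proof (intro ballI exI[of _ 0])
        fix i
        have e: "(if i \<le> Suc j then a i else 0) = (if i \<le> j then a i else 0) + (if i = Suc j then a i else 0)"
          by auto
        show "f ^ 0 * (f ^ l * (f ^ l * (if i \<le> j then a i else 0) + f ^ l * (if i = Suc j then a i else 0))
          - f ^ (l + l) * (if i \<le> Suc j then a i else 0)) \<in> ker"
          unfolding e by (simp only: power_add distrib_left mult.assoc power_0 mult_1_left diff_self idl_0[OF idl_ker])
      qed
      then have "h (vec n (\<lambda>i. if i \<le> Suc j then a i else 0) l) = h ?u \<oplus>\<^bsub>LM\<^esub> h ?w"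
        using h_add[of ?u ?w] vec unfolding w by simp
      also have "h ?w = self.fr (a (Suc j)) l \<odot>\<^bsub>LM\<^esub> h (\<epsilon> (Suc j))"
        unfolding \<epsilon>_def by (rule h_smult[OF fr_LR vec])
      also have "\<dots> = fr (s (a (Suc j)) (y (Suc j))) (l + S)"
        using Suc.prems by (simp add: hy smult_loc y)
      also have "h ?u = fr (\<Sum>i\<in>{1..j}. s (a i) (y i)) (l + S)" using Suc by simp
      also have "fr (\<Sum>i\<in>{1..j}. s (a i) (y i)) (l + S) \<oplus>\<^bsub>LM\<^esub> fr (s (a (Suc j)) (y (Suc j))) (l + S)
        = fr ((\<Sum>i\<in>{1..j}. s (a i) (y i)) + s (a (Suc j)) (y (Suc j))) (l + S)"
        by (intro add_loc_same V_closed y)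
      finally show ?case by simp
    qed
    moreover have "vec n (\<lambda>i. if i \<le> n then a i else 0) l = vec n a l"
      by (auto simp: vec_def fun_eq_iff)
    ultimately show ?thesis by (metis order_refl)
  qed
  have sum_V: "(\<Sum>i\<in>{1..n}. s (a i) (y i)) \<in> V" for a by (intro V_closed y)
  show ?thesis
    unfolding free_basis_def
  proof (intro exI[of _ "\<lambda>b. y (Suc b)"] conjI allI impI ballI)
    fix m assume m: "m \<in> V"
    then have "fr m 0 \<in> carrier LM" by (auto simp: carrier_loc)
    then obtain a l where "fr m 0 = h (vec n a l)"
      using bij_betw_imp_surj_on[OF bij] unfolding carrier_free by blast
    then have "rel m 0 (\<Sum>i\<in>{1..n}. s (a i) (y i)) (l + S)"
      unfolding h_vec fr_eq_iff[OF m sum_V] .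
    then obtain j where "s (f ^ j) (s (f ^ (l + S)) m - s (f ^ 0) (\<Sum>i\<in>{1..n}. s (a i) (y i))) \<in> K"
      unfolding rel_def by blast
    then have "s (f ^ (j + (l + S))) m - (\<Sum>b<n. s (f ^ j * a (Suc b)) (y (Suc b))) \<in> K"
      unfolding sum_from_1 by (simp add: sm.scale_right_diff_distrib sm.scale_sum_right power_add)
    then show "\<exists>k a. s (f ^ k) m - (\<Sum>b<n. s (a b) (y (Suc b))) \<in> K" by (intro exI)
  next
    fix a assume a: "(\<Sum>b<n. s (a b) (y (Suc b))) \<in> K"
    let ?a = "\<lambda>i. a (i - 1)"
    have "(\<Sum>i\<in>{1..n}. s (?a i) (y i)) \<in> K" unfolding sum_from_1 using a by simp
    then have "fr (\<Sum>i\<in>{1..n}. s (?a i) (y i)) (0 + S) = fr 0 (0 + S)"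
      unfolding fr_eq_iff[OF sum_V V_closed(3)] rel_def
      by (intro exI[of _ 0]) (simp add: sm.subspace_scale[OF subspace_K])
    then have "h (vec n ?a 0) = h (vec n (\<lambda>_. 0) 0)" by (simp only: h_vec[of ?a 0] h0[of 0 "0 + S"])
    then have "vec n ?a 0 = vec n (\<lambda>_. 0) 0"
      using bij_betw_imp_inj_on[OF bij] vec by (auto dest: inj_onD)
    then obtain j where "\<And>i. i \<in> {1..n} \<Longrightarrow> f ^ j * (f ^ 0 * ?a i - f ^ 0 * 0) \<in> ker"
      by (rule vec_rel_common) blast
    from this[of "Suc _"] have "\<forall>b<n. f ^ j * a b \<in> ker" by simp
    then show "\<exists>k. \<forall>b<n. f ^ k * a b \<in> ker" by blast
  qed (rule y)
qed

text \<open>A vector with entries \<open>a i / f^k\<close> is sent to the combination of the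
  \<open>q b\<close> divided by \<open>f^k\<close>. Independence makes this injective, spanning
  makes it surjective.\<close>

lemma basis_imp_free_of_rank:
  assumes "free_basis n"
  shows "free_of_rank LR LM n"
proof -
  obtain q where q: "\<And>b. b < n \<Longrightarrow> q b \<in> V"
    and span: "\<And>m. m \<in> V \<Longrightarrow> \<exists>k a. s (f ^ k) m - (\<Sum>b<n. s (a b) (q b)) \<in> K"
    and indep: "\<And>a. (\<Sum>b<n. s (a b) (q b)) \<in> K \<Longrightarrow> \<exists>k. \<forall>b<n. f ^ k * a b \<in> ker"
    using assms unfolding free_basis_def by blast
  define val where "val a = (\<Sum>b<n. s (a (Suc b)) (q b))" for a
  have val: "val a \<in> V" for a unfolding val_def by (intro V_closed q) auto
  have val_lin: "s c (val a) - s c' (val b) = val (\<lambda>i. c * a i - c' * b i)"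
    "s c (val a) + s c' (val b) = val (\<lambda>i. c * a i + c' * b i)" "s c (val a) = val (\<lambda>i. c * a i)" for c c' a b
    by (simp_all add: val_def sm.scale_sum_right sm.scale_left_diff_distrib sm.scale_left_distrib
        sum_subtractf sum.distrib)
  have val_rel: "s (f ^ j) (s (f ^ l) (val a) - s (f ^ k) (val b)) = val (\<lambda>i. f ^ j * (f ^ l * a i - f ^ k * b i))" for a b j k l
    by (simp only: val_lin(1)) (simp only: val_lin(3))
  \<comment> \<open>One direction is well-definedness of the map, the other its injectivity.\<close>
  have wd: "fr (val a) k = fr (val b) l \<longleftrightarrow> vec n a k = vec n b l" for a b k l
  proof
    assume "vec n a k = vec n b l"
    then obtain j where j: "\<And>i. i \<in> {1..n} \<Longrightarrow> f ^ j * (f ^ l * a i - f ^ k * b i) \<in> ker"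
      by (rule vec_rel_common) blast
    have "s (f ^ j) (s (f ^ l) (val a) - s (f ^ k) (val b)) \<in> K"
      unfolding val_rel unfolding val_def by (intro sm.subspace_sum[OF subspace_K] ker_K q j) auto
    then show "fr (val a) k = fr (val b) l" using val by (auto simp: fr_eq_iff rel_def)
  next
    assume "fr (val a) k = fr (val b) l"
    then obtain j where "s (f ^ j) (s (f ^ l) (val a) - s (f ^ k) (val b)) \<in> K"
      using val by (auto simp: fr_eq_iff rel_def)
    then obtain i where i: "\<And>b'. b' < n \<Longrightarrow> f ^ i * (f ^ j * (f ^ l * a (Suc b') - f ^ k * b (Suc b'))) \<in> ker"
      using indep[of "\<lambda>b'. f ^ j * (f ^ l * a (Suc b') - f ^ k * b (Suc b'))"]
      unfolding val_rel unfolding val_def by blast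
    have "self.rel (a i') k (b i') l" if "i' \<in> {1..n}" for i'
    proof -
      obtain b' where b': "i' = Suc b'" "b' < n" using \<open>i' \<in> {1..n}\<close> by (cases i') auto
      have "f ^ (i + j) * (f ^ l * a i' - f ^ k * b i') \<in> ker"
        unfolding b'(1) power_add mult.assoc[of "f ^ i"] by (rule i[OF b'(2)])
      then show ?thesis unfolding self.rel_def by blast
    qed
    then show "vec n a k = vec n b l" by (simp add: vec_eq_iff)
  qed
  define h where "h v = (THE w. \<exists>a k. v = vec n a k \<and> w = fr (val a) k)" for v
  have h: "h (vec n a k) = fr (val a) k" for a k
    unfolding h_def by (rule the_equality) (use wd in blast)+
  have "bij_betw h (carrier (free_module LR n)) (carrier LM)"
    unfolding bij_betw_def
  proof
    show "inj_on h (carrier (free_module LR n))"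
      by (rule inj_onI) (auto simp: carrier_free h wd)
    show "h ` carrier (free_module LR n) = carrier LM"
    proof (intro equalityI subsetI)
      fix w assume "w \<in> h ` carrier (free_module LR n)"
      then obtain a k where "w = fr (val a) k" by (auto simp: carrier_free h)
      then show "w \<in> carrier LM" using val unfolding carrier_loc by blast
    next
      fix w assume "w \<in> carrier LM"
      then obtain m k where m: "m \<in> V" "w = fr m k" by (auto simp: carrier_loc)
      obtain l a where a: "s (f ^ l) m - (\<Sum>b<n. s (a b) (q b)) \<in> K" using span[OF m(1)] by blast
      have va: "val (\<lambda>i. a (i - 1)) = (\<Sum>b<n. s (a b) (q b))" by (simp add: val_def)
      have "s (f ^ k) (s (f ^ l) m - val (\<lambda>i. a (i - 1))) \<in> K"
        unfolding va by (rule sm.subspace_scale[OF subspace_K a])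
      then have "rel m k (val (\<lambda>i. a (i - 1))) (l + k)"
        unfolding rel_def by (intro exI[of _ 0]) (simp add: sm.scale_right_diff_distrib power_add mult.commute)
      then have "w = fr (val (\<lambda>i. a (i - 1))) (l + k)"
        using m val by (simp add: fr_eq_iff)
      then have "w = h (vec n (\<lambda>i. a (i - 1)) (l + k))" by (simp add: h)
      then show "w \<in> h ` carrier (free_module LR n)" unfolding carrier_free by blast
    qed
  qed
  moreover have "h (x \<oplus>\<^bsub>free_module LR n\<^esub> y) = h x \<oplus>\<^bsub>LM\<^esub> h y"
    if xy: "x \<in> carrier (free_module LR n)" "y \<in> carrier (free_module LR n)" for x y
  proof -
    obtain a k b l where "x = vec n a k" "y = vec n b l" using xy unfolding carrier_free by blast
    then show ?thesis by (simp only: add_free h add_loc val val_lin(2))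
  qed
  moreover have "h (c \<odot>\<^bsub>free_module LR n\<^esub> x) = c \<odot>\<^bsub>LM\<^esub> h x"
    if cx: "c \<in> carrier LR" "x \<in> carrier (free_module LR n)" for c x
  proof -
    obtain a k b l where "x = vec n a k" "c = self.fr b l" using cx unfolding carrier_free carrier_LR by blast
    then show ?thesis by (simp only: smult_free h smult_loc val val_lin(3))
  qed
  ultimately have "h \<in> module_iso LR (free_module LR n) LM" unfolding module_iso_def by blast
  then show ?thesis unfolding free_of_rank_def by blast
qed

lemma free_of_rank_iff: "free_of_rank LR LM n \<longleftrightarrow> free_basis n"
  using free_of_rank_imp_basis basis_imp_free_of_rank by blast

end

section \<open>Presenting the polynomial ring\<close>

lemma finite_submultisets: "finite {u. u \<subseteq># (m :: 'b multiset)}"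
proof (induction m)
  case (add x m)
  have "{u. u \<subseteq># add_mset x m} \<subseteq> {u. u \<subseteq># m} \<union> add_mset x ` {u. u \<subseteq># m}"
  proof
    fix u assume u: "u \<in> {u. u \<subseteq># add_mset x m}"
    show "u \<in> {u. u \<subseteq># m} \<union> add_mset x ` {u. u \<subseteq># m}"
    proof (cases "x \<in># u")
      case True
      then obtain v where "u = add_mset x v" by (metis insert_DiffM)
      then show ?thesis using u by auto
    next
      case False
      then have "u - {#x#} = u" by simp
      then show ?thesis using u subset_eq_diff_conv[of u "{#x#}" m] by simp
    qed
  qed
  then show ?case using add.IH by (auto intro: finite_subset)
qed simp

definition mvars :: "nat \<Rightarrow> (nat multiset \<Rightarrow> 'r::comm_ring_1) set"
  where "mvars r = fm.span (cvec ` {u. set_mset u \<subseteq> {..r}})"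

definition allparts :: "nat \<Rightarrow> nat \<Rightarrow> ('r::comm_ring_1) vect set"
  where "allparts p r = fm.span (cvec ` ({1..p} \<times> {u. set_mset u \<subseteq> {..r}}))"

lemma cvec_mvars: "set_mset u \<subseteq> {..r} \<Longrightarrow> cvec u \<in> mvars r"
  unfolding mvars_def by (intro fm.span_base) blast

lemma cvec_allparts: "j \<in> {1..p} \<Longrightarrow> set_mset u \<subseteq> {..r} \<Longrightarrow> cvec (j, u) \<in> allparts p r"
  unfolding allparts_def by (intro fm.span_base) blast

lemma subspace_mvars: "fm.subspace (mvars r)" and subspace_allparts: "fm.subspace (allparts p r)"
  by (simp_all add: mvars_def allparts_def)

lemma lin_allparts:
  assumes "lin f" "fm.subspace H" "\<And>j u. j \<in> {1..p} \<Longrightarrow> set_mset u \<subseteq> {..r} \<Longrightarrow> f (cvec (j, u)) \<in> H"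
    and "m \<in> allparts p r"
  shows "f m \<in> H"
  by (rule lin_span_into[OF assms(1,2) _ assms(4)[unfolded allparts_def]]) (use assms(3) in auto)

lemma lin_mvars:
  assumes "lin f" "fm.subspace H" "\<And>u. set_mset u \<subseteq> {..r} \<Longrightarrow> f (cvec u) \<in> H" and "g \<in> mvars r"
  shows "f g \<in> H"
  by (rule lin_span_into[OF assms(1,2) _ assms(4)[unfolded mvars_def]]) (use assms(3) in auto)

lemma part_allparts: "m \<in> part p r t \<Longrightarrow> m \<in> allparts p r"
  by (subst part_cvec_sum, assumption, intro fm.subspace_sum fm.subspace_scale subspace_allparts)
    (auto simp: mons_def intro: cvec_allparts)

lemma shift_allparts:
  assumes "i \<le> r" "m \<in> allparts p r"
  shows "shift i m \<in> allparts p r"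
proof (rule lin_allparts[OF lin_shift subspace_allparts _ assms(2)])
  fix j u assume ju: "j \<in> {1..p}" "set_mset u \<subseteq> {..r}"
  have "shift i (cvec (j, u)) = (cvec (j, add_mset i u) :: _ \<Rightarrow> 'a)"
    by (auto simp: shift_def cvec_def fun_eq_iff)
  then show "shift i (cvec (j, u)) \<in> (allparts p r :: (_ \<Rightarrow> 'a) set)"
    by (simp only:) (rule cvec_allparts[OF ju(1)], use ju assms(1) in simp)
qed

section \<open>Products and homogeneous components of polynomial vectors\<close>

definition conv :: "(nat multiset \<Rightarrow> 'r::comm_ring_1) \<Rightarrow> 'r vect \<Rightarrow> nat \<times> nat multiset \<Rightarrow> 'r"
  where "conv g m = (\<lambda>(j, w). \<Sum>u\<in>{u. u \<subseteq># w}. g u * m (j, w - u))"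

lemma lin_conv: "lin (\<lambda>g. conv g m)"
  by (rule linI) (auto simp: conv_def fun_eq_iff distrib_right sum.distrib sum_distrib_left mult.assoc)

lemma conv_cvec: "conv (cvec v) m = (\<lambda>(j, w). if v \<subseteq># w then m (j, w - v) else 0)"
proof
  fix x :: "nat \<times> nat multiset"
  obtain j w where x: "x = (j, w)" by (cases x)
  have "(\<Sum>u\<in>{u. u \<subseteq># w}. cvec v u * m (j, w - u)) = (\<Sum>u\<in>{u. u \<subseteq># w}. if u = v then m (j, w - v) else 0)"
    by (rule sum.cong) (auto simp: cvec_def)
  then show "conv (cvec v) m x = (case x of (j, w) \<Rightarrow> if v \<subseteq># w then m (j, w - v) else 0)"
    by (simp add: conv_def x finite_submultisets)
qed

lemma conv_const: "conv (scl a (cvec {#})) m = scl a m"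
  by (simp add: module_hom.scale[OF lin_conv] conv_cvec)

lemma conv_var: "conv (cvec {#i#}) m = shift i m"
  by (auto simp: conv_cvec shift_def)

text \<open>Multiplication by a monomial is iterated multiplication by variables, so closure under
  these extends linearly to all polynomials.\<close>

lemma conv_closed:
  assumes H: "fm.subspace H" and shift: "\<And>i m. i \<le> r \<Longrightarrow> m \<in> H \<Longrightarrow> shift i m \<in> H"
    and g: "g \<in> mvars r" and m: "m \<in> H"
  shows "conv g m \<in> H"
proof (rule lin_mvars[OF lin_conv H _ g])
  fix u :: "nat multiset" assume "set_mset u \<subseteq> {..r}"
  then show "conv (cvec u) m \<in> H"
  proof (induction u)
    case empty
    then show ?case using m by (simp add: conv_cvec)
  next
    case (add i u)
    have "conv (cvec (add_mset i u)) m = shift i (conv (cvec u) m)"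
      by (auto simp: conv_cvec shift_def fun_eq_iff insert_subset_eq_iff)
    then show ?case using add shift by simp
  qed
qed

definition comp :: "nat \<Rightarrow> ('r::comm_ring_1) vect \<Rightarrow> nat \<times> nat multiset \<Rightarrow> 'r"
  where "comp t m = (\<lambda>(j, u). if size u = t then m (j, u) else 0)"

lemma lin_comp: "lin (comp t)"
  by (rule linI) (auto simp: comp_def fun_eq_iff)

lemma comp_part: "m \<in> allparts p r \<Longrightarrow> comp t m \<in> part p r t"
  by (erule lin_allparts[OF lin_comp subspace_part, rotated]) (auto simp: comp_def cvec_def part_def mons_def)

lemma comp_same: "m \<in> part p r t \<Longrightarrow> comp t m = m"
  and comp_other: "m \<in> part p r t \<Longrightarrow> t' \<noteq> t \<Longrightarrow> comp t' m = 0"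
  using partD by (fastforce simp: comp_def fun_eq_iff)+

lemma comp_shift: "comp (Suc t) (shift i m) = shift i (comp t m)" "comp 0 (shift i m) = 0"
  by (auto simp: comp_def shift_def fun_eq_iff dest!: multi_member_split)

context cring_pres
begin

interpretation A: cring A by (rule cring)

lemma phi_sum: "\<phi> (\<Sum>x\<in>S. g x) = (\<Oplus>\<^bsub>A\<^esub>x\<in>S. \<phi> (g x))"
proof (induction S rule: infinite_finite_induct)
  case (infinite S)
  then show ?case by (simp add: phi_zero finsum_def finprod_def)
qed (auto simp: phi_zero phi_add phi_closed)

lemma const_phi: "A.indexed_const (\<phi> a) = (\<lambda>u. \<phi> (scl a (cvec {#}) u))"
  by (auto simp: A.indexed_const_def cvec_def phi_zero)

lemma pmult_phi: "A.indexed_pmult (\<lambda>u. \<phi> (g u)) i = (\<lambda>u. \<phi> (if i \<in># u then g (u - {#i#}) else 0))"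
  by (auto simp: A.indexed_pmult_def phi_zero)

lemma padd_phi: "A.indexed_padd (\<lambda>u. \<phi> (g u)) (\<lambda>u. \<phi> (h u)) = (\<lambda>u. \<phi> (g u + h u))"
  by (auto simp: A.indexed_padd_def phi_add)

text \<open>\<open>indexed_pset\<close> is generated from constants by sums and multiplication by
  variables; each of these lifts along \<open>\<phi>\<close>, and conversely they reach every term
  and hence every finite sum.\<close>

lemma carrier_mpoly: "carrier (mpoly_ring A r) = (\<lambda>g u. \<phi> (g u)) ` mvars r"
proof (intro equalityI subsetI)
  fix P assume "P \<in> carrier (mpoly_ring A r)"
  then have "P \<in> A.indexed_pset {..r} (carrier A)" by (simp add: mpoly_ring_def)
  then show "P \<in> (\<lambda>g u. \<phi> (g u)) ` mvars r"
  proof (induction rule: A.indexed_pset.induct)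
    case (indexed_const k)
    then obtain a where a: "k = \<phi> a" using phi_range by blast
    show ?case
      unfolding a const_phi
      by (rule image_eqI, rule refl, rule fm.subspace_scale[OF subspace_mvars cvec_mvars]) simp
  next
    case (indexed_padd P P')
    then obtain g h where *: "P = (\<lambda>u. \<phi> (g u))" "g \<in> mvars r" "P' = (\<lambda>u. \<phi> (h u))" "h \<in> mvars r" by blast
    show ?case
      unfolding *(1,3) padd_phi
      by (rule image_eqI[of _ _ "g + h"], simp, rule fm.subspace_add[OF subspace_mvars *(2,4)])
  next
    case (indexed_pmult P i)
    then obtain g where *: "P = (\<lambda>u. \<phi> (g u))" "g \<in> mvars r" by blast
    let ?f = "\<lambda>g u. if i \<in># u then g (u - {#i#}) else (0 :: 'r)"
    have lin: "lin ?f" by (rule linI) (auto simp: fun_eq_iff)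
    have "?f (cvec u) = cvec (add_mset i u)" for u by (auto simp: cvec_def fun_eq_iff)
    then have "?f (cvec u) \<in> mvars r" if "set_mset u \<subseteq> {..r}" for u
      by (simp only:) (rule cvec_mvars, use that indexed_pmult(2) in simp)
    from lin_mvars[OF lin subspace_mvars this *(2)] have "?f g \<in> mvars r" .
    then show ?case unfolding *(1) pmult_phi by (intro image_eqI) auto
  qed
next
  fix P assume "P \<in> (\<lambda>g u. \<phi> (g u)) ` mvars r"
  then obtain g where P: "P = (\<lambda>u. \<phi> (g u))" and g: "g \<in> mvars r" by blast
  let ?S = "A.indexed_pset {..r} (carrier A)"
  have mono: "(\<lambda>u. \<phi> (if u = v then a else 0)) \<in> ?S" if "set_mset v \<subseteq> {..r}" for v :: "nat multiset" and a
    using that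
  proof (induction v)
    case empty
    have "A.indexed_const (\<phi> a) = (\<lambda>u :: nat multiset. \<phi> (if u = {#} then a else 0))"
      by (auto simp: A.indexed_const_def phi_zero)
    then show ?case using A.indexed_pset.indexed_const[OF phi_closed[of a], of "{..r}"] by simp
  next
    case (add i v)
    have "(\<lambda>u. \<phi> (if u = add_mset i v then a else 0)) = A.indexed_pmult (\<lambda>u. \<phi> (if u = v then a else 0)) i"
      unfolding pmult_phi by (rule ext, rule arg_cong[where f = \<phi>]) auto
    then show ?case using add by (auto intro: A.indexed_pset.indexed_pmult)
  qed
  from g have "(\<lambda>u. \<phi> (g u)) \<in> ?S"
    unfolding mvars_def
  proof (induction rule: fm.span_induct_alt)
    case base
    then show ?case using mono[of "{#}" 0] by simp
  next
    case (step c x y)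
    then obtain v where v: "x = cvec v" "set_mset v \<subseteq> {..r}" by blast
    have "(\<lambda>u. \<phi> ((scl c x + y) u)) = A.indexed_padd (\<lambda>u. \<phi> (if u = v then c else 0)) (\<lambda>u. \<phi> (y u))"
      unfolding padd_phi v(1) by (rule ext, rule arg_cong[where f = \<phi>]) (simp add: cvec_def)
    then show ?case using A.indexed_pset.indexed_padd[OF mono[OF v(2)] step(2)] by simp
  qed
  then show "P \<in> carrier (mpoly_ring A r)" by (simp add: mpoly_ring_def P)
qed

definition pi :: "nat \<Rightarrow> 'r vect \<Rightarrow> nat \<Rightarrow> nat multiset \<Rightarrow> 'a"
  where "pi p m = (\<lambda>j\<in>{1..p}. \<lambda>u. \<phi> (m (j, u)))"

lemma pi_eq_iff: "pi p m = pi p m' \<longleftrightarrow> (\<forall>j\<in>{1..p}. \<forall>u. m (j, u) - m' (j, u) \<in> ker)"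
proof -
  have "pi p m = pi p m' \<longleftrightarrow> (\<forall>j\<in>{1..p}. \<forall>u. \<phi> (m (j, u)) = \<phi> (m' (j, u)))"
    by (auto simp: pi_def restrict_def fun_eq_iff)
  then show ?thesis by (simp add: phi_eq_iff)
qed

lemma carrier_free_module: "carrier (free_module (mpoly_ring A r) p) = pi p ` allparts p r"
proof (intro equalityI subsetI)
  fix x assume "x \<in> carrier (free_module (mpoly_ring A r) p)"
  then have x: "x \<in> {1..p} \<rightarrow>\<^sub>E carrier (mpoly_ring A r)" by (simp add: free_module_def)
  have "\<forall>j. \<exists>g. j \<in> {1..p} \<longrightarrow> g \<in> mvars r \<and> x j = (\<lambda>u. \<phi> (g u))"
    using PiE_mem[OF x] unfolding carrier_mpoly by blast
  from choice[OF this] obtain g where g: "\<And>j. j \<in> {1..p} \<Longrightarrow> g j \<in> mvars r"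
    and gx: "\<And>j. j \<in> {1..p} \<Longrightarrow> x j = (\<lambda>u. \<phi> (g j u))" by blast
  define inj where "inj j h = (\<lambda>(j', u). if j' = j then h u else (0 :: 'r))" for j :: nat and h :: "nat multiset \<Rightarrow> 'r"
  define m where "m = (\<Sum>j\<in>{1..p}. inj j (g j))"
  have "inj j (g j) \<in> allparts p r" if j: "j \<in> {1..p}" for j
  proof (rule lin_mvars[OF _ subspace_allparts _ g[OF j]])
    show "lin (inj j)" by (rule linI) (auto simp: inj_def fun_eq_iff)
    fix u :: "nat multiset" assume u: "set_mset u \<subseteq> {..r}"
    have "inj j (cvec u) = cvec (j, u)" by (auto simp: inj_def cvec_def fun_eq_iff)
    then show "inj j (cvec u) \<in> allparts p r" using cvec_allparts[OF j u] by simp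
  qed
  then have "m \<in> allparts p r" unfolding m_def by (intro fm.subspace_sum[OF subspace_allparts])
  moreover have "x = pi p m"
    by (rule extensionalityI[of _ "{1..p}"]) (use x in \<open>auto simp: pi_def m_def inj_def PiE_def gx\<close>)
  ultimately show "x \<in> pi p ` allparts p r" by blast
next
  fix x assume "x \<in> pi p ` allparts p r"
  then obtain m where m: "m \<in> allparts p r" "x = pi p m" by blast
  have "(\<lambda>u. m (j, u)) \<in> mvars r" for j
  proof (rule lin_allparts[OF _ subspace_mvars _ m(1), of "\<lambda>m u. m (j, u)"])
    show "lin (\<lambda>m u. m (j, u) :: 'r)" by (rule linI) (auto simp: fun_eq_iff)
    fix j' and u :: "nat multiset" assume u: "set_mset u \<subseteq> {..r}"
    have "(\<lambda>v. cvec (j', u) (j, v)) = (if j' = j then cvec u else (0 :: _ \<Rightarrow> 'r))"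
      by (auto simp: cvec_def fun_eq_iff)
    then show "(\<lambda>v. cvec (j', u) (j, v)) \<in> (mvars r :: (_ \<Rightarrow> 'r) set)"
      by (simp add: fm.subspace_0[OF subspace_mvars] cvec_mvars[OF u])
  qed
  then have "(\<lambda>u. \<phi> (m (j, u))) \<in> carrier (mpoly_ring A r)" for j unfolding carrier_mpoly by (intro image_eqI) auto
  then show "x \<in> carrier (free_module (mpoly_ring A r) p)"
    by (simp add: m(2) free_module_def pi_def)
qed

text \<open>A lift of a homogeneous vector may have terms of other degrees, but their coefficients
  lie in \<open>ker\<close>, so \<open>comp t\<close> may discard them.\<close>

lemma free_part_eq: "free_part A r p t = pi p ` part p r t"
proof (intro equalityI subsetI)
  fix x assume "x \<in> free_part A r p t"
  then have x: "x \<in> {1..p} \<rightarrow>\<^sub>E mpoly_part A r t" by (simp add: free_part_def)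
  then have "x \<in> carrier (free_module (mpoly_ring A r) p)"
    by (auto simp: free_module_def mpoly_part_def PiE_iff)
  then obtain m where m: "m \<in> allparts p r" "x = pi p m" unfolding carrier_free_module by blast
  have "m (j, u) - comp t m (j, u) \<in> ker" if j: "j \<in> {1..p}" for j u
  proof (cases "size u = t")
    case True
    then show ?thesis by (simp add: comp_def idl_0[OF idl_ker])
  next
    case False
    have "x j \<in> mpoly_part A r t" using PiE_mem[OF x j] .
    then have "x j u = \<zero>\<^bsub>A\<^esub>" using False by (auto simp: mpoly_part_def)
    then show ?thesis using False j by (simp add: comp_def ker_def m(2) pi_def)
  qed
  then have "x = pi p (comp t m)" unfolding m(2) pi_eq_iff by blast
  then show "x \<in> pi p ` part p r t" using comp_part[OF m(1)] by blast
next
  fix x assume "x \<in> pi p ` part p r t"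
  then obtain m where m: "m \<in> part p r t" "x = pi p m" by blast
  have "x \<in> carrier (free_module (mpoly_ring A r) p)"
    unfolding carrier_free_module using m part_allparts by blast
  then have x: "x \<in> {1..p} \<rightarrow>\<^sub>E carrier (mpoly_ring A r)" by (simp add: free_module_def)
  have "size u = t" if "j \<in> {1..p}" "x j u \<noteq> \<zero>\<^bsub>A\<^esub>" for j u
  proof -
    have "m (j, u) \<noteq> 0" using that by (auto simp: m(2) pi_def phi_zero)
    then show ?thesis using partD[OF m(1)] by blast
  qed
  then show "x \<in> free_part A r p t"
    using x by (auto simp: free_part_def mpoly_part_def PiE_iff)
qed

lemma add_free_module: "pi p m \<oplus>\<^bsub>free_module (mpoly_ring A r) p\<^esub> pi p m' = pi p (m + m')"
  by (auto simp: free_module_def pi_def mpoly_ring_def padd_phi fun_eq_iff)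

lemma zero_free_module: "\<zero>\<^bsub>free_module (mpoly_ring A r) p\<^esub> = pi p 0"
  by (auto simp: free_module_def pi_def mpoly_ring_def A.indexed_const_def phi_zero fun_eq_iff)

lemma smult_free_module: "(\<lambda>u. \<phi> (g u)) \<odot>\<^bsub>free_module (mpoly_ring A r) p\<^esub> pi p m = pi p (conv g m)"
  by (auto simp: free_module_def pi_def mpoly_ring_def conv_def phi_sum phi_mult fun_eq_iff)

lemma smult_const_free_module:
  "A.indexed_const (\<phi> a) \<odot>\<^bsub>free_module (mpoly_ring A r) p\<^esub> pi p m = pi p (scl a m)"
  unfolding const_phi smult_free_module conv_const ..

end

section \<open>Graded submodules\<close>

lemma set_add_alt: "set_add G C D = (\<Union>c\<in>C. \<Union>d\<in>D. {c \<oplus>\<^bsub>G\<^esub> d})"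
  by (simp add: set_add_def set_mult_def)

lemma a_r_coset_alt: "C +>\<^bsub>G\<^esub> x = (\<Union>c\<in>C. {c \<oplus>\<^bsub>G\<^esub> x})"
  by (simp add: a_r_coset_def r_coset_def)

locale submodule_pres = cring_pres A \<phi> for A :: "('a, 'b) ring_scheme" and \<phi> :: "'r::comm_ring_1 \<Rightarrow> 'a" +
  fixes r p :: nat and N :: "(nat \<Rightarrow> nat multiset \<Rightarrow> 'a) set"
  assumes submodule: "submodule N (mpoly_ring A r) (free_module (mpoly_ring A r) p)"
begin

abbreviation S where "S \<equiv> mpoly_ring A r"
abbreviation M where "M \<equiv> free_module S p"
abbreviation pr where "pr \<equiv> pi p"

text \<open>A full preimage: it contains the vectors with coefficients in \<open>ker\<close>, so
  passing to the ring type does not change the quotient.\<close>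

definition Nall :: "'r vect set" where "Nall = {m \<in> allparts p r. pr m \<in> N}"
definition Nt :: "nat \<Rightarrow> 'r vect set" where "Nt t = {m \<in> part p r t. pr m \<in> N}"

lemma smult_N: "g \<in> mvars r \<Longrightarrow> pr m \<in> N \<Longrightarrow> pr (conv g m) \<in> N"
  using submodule.smult_closed[OF submodule, of "\<lambda>u. \<phi> (g u)" "pr m"] by (auto simp: carrier_mpoly smult_free_module)

lemma scl_N: "pr m \<in> N \<Longrightarrow> pr (scl a m) \<in> N"
  using smult_N[OF fm.subspace_scale[OF subspace_mvars cvec_mvars[of "{#}"]]] by (simp add: conv_const)

lemma shift_N: "i \<le> r \<Longrightarrow> pr m \<in> N \<Longrightarrow> pr (shift i m) \<in> N"
  using smult_N[OF cvec_mvars[of "{#i#}"]] by (simp add: conv_var)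

lemma add_N: "pr m \<in> N \<Longrightarrow> pr m' \<in> N \<Longrightarrow> pr (m + m') \<in> N"
  using subgroup.m_closed[OF submodule.axioms(1)[OF submodule], of "pr m" "pr m'"] by (simp add: add_free_module)

lemma zero_N: "pr 0 \<in> N"
  using subgroup.one_closed[OF submodule.axioms(1)[OF submodule]] by (simp add: zero_free_module)

lemma N_image: "N = pr ` Nall"
proof -
  have "N \<subseteq> pr ` allparts p r"
    using subgroup.subset[OF submodule.axioms(1)[OF submodule]] by (simp add: carrier_free_module)
  then show ?thesis by (auto simp: Nall_def)
qed

lemma subspace_Nall: "fm.subspace Nall"
  by (rule fm.subspaceI)
    (auto simp: Nall_def zero_N add_N scl_N fm.subspace_0[OF subspace_allparts]
      fm.subspace_add[OF subspace_allparts] fm.subspace_scale[OF subspace_allparts])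

lemma subspace_Nt: "fm.subspace (Nt t)"
  by (rule fm.subspaceI)
    (auto simp: Nt_def zero_N add_N scl_N fm.subspace_0[OF subspace_part]
      fm.subspace_add[OF subspace_part] fm.subspace_scale[OF subspace_part])

lemma Nt_part: "Nt t \<subseteq> part p r t"
  by (auto simp: Nt_def)

lemma ker_N:
  assumes "\<And>x. m x \<in> ker"
  shows "pr m \<in> N"
proof -
  have "pr m = pr 0" unfolding pi_eq_iff using assms by simp
  then show ?thesis using zero_N by simp
qed

lemma coset: "N +>\<^bsub>M\<^esub> pr x = {pr (y + x) | y. y \<in> Nall}"
  by (subst N_image) (auto simp: a_r_coset_alt add_free_module)

lemma coset_eq_iff:
  assumes x: "x \<in> allparts p r" and y: "y \<in> allparts p r"
  shows "N +>\<^bsub>M\<^esub> pr x = N +>\<^bsub>M\<^esub> pr y \<longleftrightarrow> x - y \<in> Nall"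
proof
  assume eq: "N +>\<^bsub>M\<^esub> pr x = N +>\<^bsub>M\<^esub> pr y"
  have "pr (0 + x) \<in> N +>\<^bsub>M\<^esub> pr x" unfolding coset using fm.subspace_0[OF subspace_Nall] by blast
  then have "pr (0 + x) \<in> N +>\<^bsub>M\<^esub> pr y" unfolding eq .
  then obtain z where z: "z \<in> Nall" "pr (0 + x) = pr (z + y)" unfolding coset by blast
  then have "pr (x - y) = pr z" unfolding pi_eq_iff by (simp add: algebra_simps)
  then show "x - y \<in> Nall" using z(1) fm.subspace_diff[OF subspace_allparts x y] by (simp add: Nall_def)
next
  have sub: "N +>\<^bsub>M\<^esub> pr x \<subseteq> N +>\<^bsub>M\<^esub> pr y" if "x - y \<in> Nall" for x y
  proof
    fix c assume "c \<in> N +>\<^bsub>M\<^esub> pr x"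
    then obtain z where z: "z \<in> Nall" "c = pr (z + x)" unfolding coset by blast
    have "z + x = (z + (x - y)) + y" by simp
    moreover have "z + (x - y) \<in> Nall" by (rule fm.subspace_add[OF subspace_Nall z(1) that])
    ultimately show "c \<in> N +>\<^bsub>M\<^esub> pr y"
      unfolding coset z(2) by (intro CollectI exI[of _ "z + (x - y)"] conjI) simp_all
  qed
  assume "x - y \<in> Nall"
  moreover from this have "y - x \<in> Nall" using fm.subspace_neg[OF subspace_Nall, of "x - y"] by simp
  ultimately show "N +>\<^bsub>M\<^esub> pr x = N +>\<^bsub>M\<^esub> pr y" using sub by blast
qed

lemma coset_add: "set_add M (N +>\<^bsub>M\<^esub> pr x) (N +>\<^bsub>M\<^esub> pr y) = N +>\<^bsub>M\<^esub> pr (x + y)"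
proof (intro equalityI subsetI)
  fix c assume "c \<in> set_add M (N +>\<^bsub>M\<^esub> pr x) (N +>\<^bsub>M\<^esub> pr y)"
  then obtain z w where zw: "z \<in> Nall" "w \<in> Nall" "c = pr ((z + x) + (w + y))"
    unfolding set_add_alt coset by (auto simp: add_free_module)
  have "(z + x) + (w + y) = (z + w) + (x + y)" by (simp add: algebra_simps)
  then show "c \<in> N +>\<^bsub>M\<^esub> pr (x + y)"
    unfolding coset zw(3) using fm.subspace_add[OF subspace_Nall zw(1,2)]
    by (intro CollectI exI[of _ "z + w"] conjI) (simp_all add: ac_simps)
next
  fix c assume "c \<in> N +>\<^bsub>M\<^esub> pr (x + y)"
  then obtain z where z: "z \<in> Nall" "c = pr (z + (x + y))" unfolding coset by blast
  have "c = pr (z + x) \<oplus>\<^bsub>M\<^esub> pr (0 + y)" by (simp add: z(2) add_free_module add.assoc)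
  moreover have "pr (z + x) \<in> N +>\<^bsub>M\<^esub> pr x" "pr (0 + y) \<in> N +>\<^bsub>M\<^esub> pr y"
    unfolding coset using z(1) fm.subspace_0[OF subspace_Nall] by blast+
  ultimately show "c \<in> set_add M (N +>\<^bsub>M\<^esub> pr x) (N +>\<^bsub>M\<^esub> pr y)"
    unfolding set_add_alt by blast
qed

lemma coset_smult:
  assumes x: "x \<in> allparts p r"
  shows "(\<Union>z\<in>N +>\<^bsub>M\<^esub> pr x. N +>\<^bsub>M\<^esub> (ring.indexed_const A (\<phi> a) \<odot>\<^bsub>M\<^esub> z)) = N +>\<^bsub>M\<^esub> pr (scl a x)"
proof -
  have eq: "N +>\<^bsub>M\<^esub> (ring.indexed_const A (\<phi> a) \<odot>\<^bsub>M\<^esub> pr (z + x)) = N +>\<^bsub>M\<^esub> pr (scl a x)" if z: "z \<in> Nall" for z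
  proof -
    have "scl a (z + x) - scl a x = scl a z" by (simp add: fm.scale_right_distrib)
    then have "scl a (z + x) - scl a x \<in> Nall" using fm.subspace_scale[OF subspace_Nall z] by simp
    moreover have "z \<in> allparts p r" using z by (simp add: Nall_def)
    ultimately show ?thesis
      unfolding smult_const_free_module
      by (subst coset_eq_iff) (auto intro: fm.subspace_scale[OF subspace_allparts] fm.subspace_add[OF subspace_allparts] x)
  qed
  have "N +>\<^bsub>M\<^esub> (ring.indexed_const A (\<phi> a) \<odot>\<^bsub>M\<^esub> c) = N +>\<^bsub>M\<^esub> pr (scl a x)" if c: "c \<in> N +>\<^bsub>M\<^esub> pr x" for c
  proof -
    obtain z where "z \<in> Nall" "c = pr (z + x)" using c unfolding coset[of x] by blast
    then show ?thesis using eq by simp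
  qed
  moreover have "N +>\<^bsub>M\<^esub> pr x \<noteq> {}" unfolding coset using fm.subspace_0[OF subspace_Nall] by blast
  ultimately show ?thesis by (simp add: SUP_eq_const)
qed

lemma module_pres_part:
  "module_pres A \<phi> scl (part p r t) (Nt t) (\<lambda>m. N +>\<^bsub>M\<^esub> pr m) (quotient_part A r p N t)"
proof
  show "fm.subspace (part p r t)" by (rule subspace_part)
  show "fm.subspace (Nt t)" by (rule subspace_Nt)
  show "(\<lambda>m. N +>\<^bsub>M\<^esub> pr m) ` part p r t = carrier (quotient_part A r p N t)"
    by (auto simp: quotient_part_def Let_def restrict_scalars_def free_part_eq)
  fix x y :: "nat \<times> nat multiset \<Rightarrow> 'r" and a assume x: "x \<in> part p r t"
  show "N +>\<^bsub>M\<^esub> pr (scl a x) = \<phi> a \<odot>\<^bsub>quotient_part A r p N t\<^esub> (N +>\<^bsub>M\<^esub> pr x)"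
    using coset_smult[OF part_allparts[OF x]]
    by (simp add: quotient_part_def Let_def restrict_scalars_def quotient_module_def)
  assume y: "y \<in> part p r t"
  have "x - y \<in> allparts p r"
    by (intro fm.subspace_diff[OF subspace_allparts] part_allparts[OF x] part_allparts[OF y])
  then show "N +>\<^bsub>M\<^esub> pr x = N +>\<^bsub>M\<^esub> pr y \<longleftrightarrow> x - y \<in> Nt t"
    unfolding coset_eq_iff[OF part_allparts[OF x] part_allparts[OF y]]
    using fm.subspace_diff[OF subspace_part x y] by (auto simp: Nall_def Nt_def)
  show "N +>\<^bsub>M\<^esub> pr (x + y) = (N +>\<^bsub>M\<^esub> pr x) \<oplus>\<^bsub>quotient_part A r p N t\<^esub> (N +>\<^bsub>M\<^esub> pr y)"
    using coset_add by (simp add: quotient_part_def Let_def restrict_scalars_def quotient_module_def)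
qed

text \<open>Primes correspond by image and preimage under \<open>\<phi>\<close>, and bases on
  \<open>D(f)\<close> by \<open>free_of_rank_iff\<close>.\<close>

lemma locally_free_iff:
  "locally_free_of_rank A (quotient_part A r p N t) n \<longleftrightarrow> zariski_free ker n (part p r t) (Nt t)"
proof -
  have free: "free_of_rank (loc_ring A (powers A (\<phi> f))) (loc_module A (powers A (\<phi> f)) (quotient_part A r p N t)) n
    \<longleftrightarrow> basis_at ker n (part p r t) (Nt t) f" for f
  proof -
    interpret module_pres A \<phi> scl "part p r t" "Nt t" "\<lambda>m. N +>\<^bsub>M\<^esub> pr m" "quotient_part A r p N t" f
      by (rule module_pres_part)
    show ?thesis unfolding free_of_rank_iff free_basis_def basis_at_def ..
  qed
  show ?thesis
  proof
    assume L: "locally_free_of_rank A (quotient_part A r p N t) n"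
    show "zariski_free ker n (part p r t) (Nt t)"
      unfolding zariski_free_def
    proof (intro allI impI, elim conjE)
      fix P assume P: "prm P" "ker \<subseteq> P"
      from L primeideal_image[OF P] obtain g where g: "g \<in> carrier A - \<phi> ` P"
        "free_of_rank (loc_ring A (powers A g)) (loc_module A (powers A g) (quotient_part A r p N t)) n"
        unfolding locally_free_of_rank_def by blast
      then obtain f where "g = \<phi> f" using phi_range by blast
      with g show "\<exists>f. f \<notin> P \<and> basis_at ker n (part p r t) (Nt t) f" using free by blast
    qed
  next
    assume Z: "zariski_free ker n (part p r t) (Nt t)"
    show "locally_free_of_rank A (quotient_part A r p N t) n"
      unfolding locally_free_of_rank_def
    proof (intro allI impI)
      fix P assume P: "primeideal P A"
      from Z prm_vimage[OF P] obtain f where "f \<notin> \<phi> -` P" "basis_at ker n (part p r t) (Nt t) f"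
        unfolding zariski_free_def by blast
      then show "\<exists>f\<in>carrier A - P. free_of_rank (loc_ring A (powers A f)) (loc_module A (powers A f) (quotient_part A r p N t)) n"
        using free phi_closed by (intro bexI[of _ "\<phi> f"]) auto
    qed
  qed
qed

lemma inv_M: "inv\<^bsub>add_monoid M\<^esub> pr m = pr (scl (- 1) m)" if m: "m \<in> allparts p r"
  unfolding m_inv_def
proof (rule the_equality)
  have 0: "scl (- 1) m + m = 0" "m + scl (- 1) m = 0" by (auto simp: fun_eq_iff)
  show "pr (scl (- 1) m) \<in> carrier (add_monoid M) \<and> pr m \<otimes>\<^bsub>add_monoid M\<^esub> pr (scl (- 1) m) = \<one>\<^bsub>add_monoid M\<^esub>
    \<and> pr (scl (- 1) m) \<otimes>\<^bsub>add_monoid M\<^esub> pr m = \<one>\<^bsub>add_monoid M\<^esub>"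
    using fm.subspace_scale[OF subspace_allparts m, of "- 1"]
    by (simp add: carrier_free_module add_free_module zero_free_module 0)
  fix y assume y: "y \<in> carrier (add_monoid M) \<and> pr m \<otimes>\<^bsub>add_monoid M\<^esub> y = \<one>\<^bsub>add_monoid M\<^esub>
    \<and> y \<otimes>\<^bsub>add_monoid M\<^esub> pr m = \<one>\<^bsub>add_monoid M\<^esub>"
  then obtain z where z: "y = pr z" by (auto simp: carrier_free_module)
  with y have "pr (m + z) = pr 0" by (simp add: add_free_module zero_free_module)
  then show "y = pr (scl (- 1) m)" unfolding z pi_eq_iff by (simp add: add.commute)
qed

text \<open>In degrees \<open>t + 1 > d\<close>, having a homogeneous component in the span of the \<open>X\<^sub>i N\<^sub>t\<close> defines a
  submodule, which contains the generators.\<close>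

lemma graded_Nt:
  assumes "generated_in_degrees_le S M (free_part A r p) N d"
  shows "graded ker p r Nt d"
proof
  show "idl ker" by (rule idl_ker)
  show "fm.subspace (Nt t)" "Nt t \<subseteq> part p r t" for t by (rule subspace_Nt, rule Nt_part)
  show "scl a m \<in> Nt t" if "a \<in> ker" "m \<in> part p r t" for a m t
    using that fm.subspace_scale[OF subspace_part] idl_mult2[OF idl_ker] by (auto simp: Nt_def intro!: ker_N)
  show "shift i m \<in> Nt (Suc t)" if "i \<le> r" "m \<in> Nt t" for i m t
    using that by (auto simp: Nt_def shift_N shift_part)
  fix t m assume t: "d \<le> t" and m: "m \<in> Nt (Suc t)"
  obtain B where B: "B \<subseteq> (\<Union>t\<le>d. free_part A r p t)" and N_gen: "N = submodule_generated S M B"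
    using assms unfolding generated_in_degrees_le_def by blast
  let ?W = "\<lambda>t. fm.span (\<Union>i\<le>r. shift i ` Nt t)"
  define H where "H = {x \<in> allparts p r. \<forall>t. comp t x \<in> Nt t \<and> (d \<le> t \<longrightarrow> comp (Suc t) x \<in> ?W t)}"
  have H_sub: "fm.subspace H"
    by (rule fm.subspaceI)
      (auto simp: H_def module_hom.zero[OF lin_comp] module_hom.add[OF lin_comp] module_hom.scale[OF lin_comp]
        fm.span_zero fm.span_add fm.span_scale fm.subspace_0[OF subspace_allparts] fm.subspace_add[OF subspace_allparts]
        fm.subspace_scale[OF subspace_allparts] fm.subspace_0[OF subspace_Nt] fm.subspace_add[OF subspace_Nt]
        fm.subspace_scale[OF subspace_Nt])
  have H_shift: "shift i x \<in> H" if i: "i \<le> r" and x: "x \<in> H" for i x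
  proof -
    have "comp t (shift i x) \<in> Nt t" for t
      using x i fm.subspace_0[OF subspace_Nt]
      by (cases t) (auto simp: comp_shift H_def Nt_def shift_N shift_part)
    moreover have "comp (Suc t) (shift i x) \<in> ?W t" for t
      using i x by (auto simp: comp_shift H_def intro!: fm.span_base)
    ultimately show ?thesis using x shift_allparts[OF i] by (auto simp: H_def)
  qed
  have "submodule (pr ` H) S M"
  proof (intro submodule.intro subgroup.intro submodule_axioms.intro)
    show "pr ` H \<subseteq> carrier (add_monoid M)" by (auto simp: carrier_free_module H_def)
    show "\<one>\<^bsub>add_monoid M\<^esub> \<in> pr ` H" using fm.subspace_0[OF H_sub] by (simp add: zero_free_module)
    show "x \<otimes>\<^bsub>add_monoid M\<^esub> y \<in> pr ` H" if "x \<in> pr ` H" "y \<in> pr ` H" for x y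
      using that fm.subspace_add[OF H_sub] by (auto simp: add_free_module)
    show "inv\<^bsub>add_monoid M\<^esub> x \<in> pr ` H" if x: "x \<in> pr ` H" for x
    proof -
      obtain y where y: "y \<in> H" "x = pr y" using x by blast
      then have "y \<in> allparts p r" by (simp add: H_def)
      then show ?thesis unfolding y(2) using inv_M fm.subspace_scale[OF H_sub y(1), of "- 1"] by simp
    qed
    show "c \<odot>\<^bsub>M\<^esub> x \<in> pr ` H" if c: "c \<in> carrier S" and x: "x \<in> pr ` H" for c x
    proof -
      obtain g where g: "c = (\<lambda>u. \<phi> (g u))" "g \<in> mvars r" using c unfolding carrier_mpoly by blast
      obtain y where y: "y \<in> H" "x = pr y" using x by blast
      have "conv g y \<in> H" by (rule conv_closed[OF H_sub H_shift g(2) y(1)])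
      then show ?thesis by (simp add: g(1) y(2) smult_free_module)
    qed
  qed
  moreover have "B \<subseteq> pr ` H"
  proof
    fix b assume b: "b \<in> B"
    then obtain t0 x where x: "t0 \<le> d" "x \<in> part p r t0" "b = pr x"
      using B unfolding free_part_eq by blast
    have "b \<in> N" using b unfolding N_gen submodule_generated_def by blast
    then have xN: "x \<in> Nt t0" using x by (simp add: Nt_def)
    have "comp t x \<in> Nt t" for t
      using comp_same[OF x(2)] comp_other[OF x(2), of t] xN fm.subspace_0[OF subspace_Nt] by (cases "t = t0") auto
    \<comment> \<open>Generators have degree at most \<open>d\<close>, so they have no component in
      the degrees where the span condition is imposed.\<close>
    moreover have "comp (Suc t) x = 0" if "d \<le> t" for t
      by (rule comp_other[OF x(2)]) (use x(1) that in auto)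
    ultimately have "x \<in> H" using part_allparts[OF x(2)] by (auto simp: H_def fm.span_zero)
    then show "b \<in> pr ` H" using x(3) by blast
  qed
  ultimately have "N \<subseteq> pr ` H" unfolding N_gen submodule_generated_def by blast
  moreover have "pr m \<in> N" using m by (simp add: Nt_def)
  ultimately obtain x where x: "x \<in> H" "pr m = pr x" by blast
  have mp: "m \<in> part p r (Suc t)" using m by (simp add: Nt_def)
  have xp: "comp (Suc t) x \<in> part p r (Suc t)" using x(1) by (intro comp_part) (simp add: H_def)
  \<comment> \<open>\<open>m\<close> and \<open>x\<close> agree only after applying
    \<open>\<phi>\<close>. The difference has coefficients in \<open>ker\<close>, so its quotients
    \<open>lead i ?y\<close> are relations and it lies in the span as well.\<close>
  let ?y = "m - comp (Suc t) x"
  have y: "?y \<in> part p r (Suc t)" by (rule fm.subspace_diff[OF subspace_part mp xp])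
  have y_ker: "?y (j, u) \<in> ker" for j u
  proof (cases "?y (j, u) = 0")
    case False
    then have j: "j \<in> {1..p}" and u: "size u = Suc t" using partD[OF y False] by auto
    have "m (j, u) - x (j, u) \<in> ker" using x(2) j unfolding pi_eq_iff by blast
    then show ?thesis using u by (simp add: comp_def)
  qed (simp add: idl_0[OF idl_ker])
  have "lead i ?y \<in> Nt t" for i
  proof -
    have "lead i ?y z \<in> ker" for z
      using y_ker[of "fst z" "add_mset i (snd z)"] by (cases z) (simp add: lead_def idl_0[OF idl_ker])
    then have "pr (lead i ?y) \<in> N" by (rule ker_N)
    then show ?thesis using lead_part[OF y] by (simp add: Nt_def)
  qed
  then have "(\<Sum>i\<le>r. shift i (lead i ?y)) \<in> ?W t"
    by (intro fm.span_sum fm.span_base) blast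
  then have "?y \<in> ?W t" using part_decomp[OF y] by simp
  moreover have "comp (Suc t) x \<in> ?W t" using x(1) t by (simp add: H_def)
  ultimately have "?y + comp (Suc t) x \<in> ?W t" by (rule fm.span_add)
  then show "m \<in> ?W t" by simp
qed

end

theorem theorem1:
  fixes A :: "('a, 'b) ring_scheme"
    and S :: "(nat multiset \<Rightarrow> 'a) ring"
    and M :: "(nat multiset \<Rightarrow> 'a, nat \<Rightarrow> nat multiset \<Rightarrow> 'a) module"
    and N :: "(nat \<Rightarrow> nat multiset \<Rightarrow> 'a) set"
    and r p d n :: nat
  assumes "cring A"
    and "S = mpoly_ring A r"
    and "M = free_module S p"
    and "graded_submodule S M (free_part A r p) N"
    and "generated_in_degrees_le S M (free_part A r p) N d"
    and "n \<le> d"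
    and "locally_free_of_rank A (quotient_part A r p N d) n"
    and "locally_free_of_rank A (quotient_part A r p N (d + 1)) n"
  shows "\<forall>t\<ge>d. locally_free_of_rank A (quotient_part A r p N t) n"
proof -
  \<comment> \<open>\<open>A\<close> is a quotient of the product \<open>uring\<close> by projection
    to the factor indexed by its truncated record.\<close>
  interpret cring_pres A "uring_proj (ring.truncate A)"
    by (rule cring_pres.intro)
      (rule assms(1) uring_proj_add[OF assms(1)] uring_proj_mult[OF assms(1)] uring_proj_one[OF assms(1)]
        uring_proj_range[OF assms(1)])+
  interpret submodule_pres A "uring_proj (ring.truncate A)" r p N
    by (intro submodule_pres.intro submodule_pres_axioms.intro cring_pres_axioms)
      (use assms(2,3,4) in \<open>simp add: graded_submodule_def\<close>)
  interpret graded ker p r Nt d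
    by (rule graded_Nt) (use assms(2,3,5) in simp)
  show ?thesis
    using zariski_free_persistence[OF assms(6)] assms(7,8) unfolding locally_free_iff by simp
qed

end
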